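(* Let $A=[a_{ij}]_{i,j\in I}$ be a symmetrizable generalized Cartan matrix symmetrized by $\{d_i\}_{i\in I}$, with a root datum $(Y,X,\langle\,,\rangle,\{\alpha_i^\vee\}_{i\in I},\{\alpha_i\}_{i\in I})$ of type $A$, and let $\mathcal A_{q,0}$, $f_i$, $\mathcal A_q=\mathcal A_{q,0}\otimes U_q^0$, $Q(\mathcal A_q)$, $\tilde s_i$ and $\gamma(f_i^\lambda)$ be as defined in the context. Assume that $f_i\neq 0$ for all $i\in I$. For each $i\in I$ define the algebra automorphism $S_i$ of $Q(\mathcal A_q)$ by $$S_i=\tilde s_i\circ\gamma(f_i^{-\alpha_i^\vee})=\gamma(f_i^{\alpha_i^\vee})\circ\tilde s_i$$ (the two expressions coincide). Then an action of the Weyl group $W=W(A)$ on $Q(\mathcal A_q)$ is defined by $s_i(x)=S_i(x)$ for $i\in I$ and $x\in Q(\mathcal A_q)$. Explicitly, the following formulae define a representation of the Weyl group $W$ in algebra automorphisms of $Q(\mathcal A_q)$: $$s_i(f_j)=\begin{cases}\displaystyle\sum_{k=0}^{-a_{ij}} q_i^{(k+a_{ij})(\alpha_i^\vee-k)}\begin{bmatrix}\alpha_i^\vee\\ k\end{bmatrix}_{q_i}\mathrm{ad}(f_i)^k(f_j)\,f_i^{-k} & \text{if } i\neq j,\\[2mm] f_i & \text{if } i=j,\end{cases}$$ $$s_i(q^\lambda)=q^{s_i(\lambda)}=q^{\lambda-\langle\lambda,\alpha_i\rangle\alpha_i^\vee}\quad(\lambda\in d^{-1}Y).$$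
   Context: Generalized Cartan matrix (GCM): a matrix $A=[a_{ij}]_{i,j\in I}$ ($I$ finite) of integers with $a_{ii}=2$, $a_{ij}\le 0$ for $i\ne j$, and $a_{ij}=0\iff a_{ji}=0$. It is symmetrized by positive rationals $\{d_i\}$ if $d_ia_{ij}=d_ja_{ji}$ for all $i,j$. A root datum of type $A$: finitely generated free $\mathbb Z$-modules $X,Y$, a perfect bilinear pairing $\langle\,,\rangle:Y\times X\to\mathbb Z$, and families $\alpha_i^\vee\in Y$, $\alpha_i\in X$ with $\langle\alpha_i^\vee,\alpha_j\rangle=a_{ij}$. Let $d$ be the least common denominator of the $d_i$, $\mathbb F=\mathbb Q(q^{1/d})$ ($q^{1/d}$ an indeterminate), $q_i=q^{d_i}$; extend the pairing to $d^{-1}Y\times X\to d^{-1}\mathbb Z$. The Weyl group $W(A)$ is the group generated by $\{s_i\}_{i\in I}$ with relations $s_i^2=1$ and, for $i\neq j$: $s_is_j=s_js_i$ if $a_{ij}a_{ji}=0$; $s_is_js_i=s_js_is_j$ if $a_{ij}a_{ji}=1$; $(s_is_j)^2=(s_js_i)^2$ if $a_{ij}a_{ji}=2$; $(s_is_j)^3=(s_js_i)^3$ if $a_{ij}a_{ji}=3$ (no relation if $a_{ij}a_{ji}\ge4$). It acts on $Y$ and $d^{-1}Y$ by $s_i(\lambda)=\lambda-\langle\lambda,\alpha_i\rangle\alpha_i^\vee$. $q$-numbers: $[x]_q=\frac{q^x-q^{-x}}{q-q^{-1}}$, $[n]_q!=\prod_{k=1}^n[k]_q$, $\begin{bmatrix}x\\k\end{bmatrix}_q=\frac{[x]_q[x-1]_q\cdots[x-k+1]_q}{[k]_q!}$.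 $U_q^-$ is the lower part of the quantized universal enveloping algebra: the $\mathbb F$-algebra generated by $\{F_i\}_{i\in I}$ with the $q$-Serre relations $\sum_{k=0}^{1-a_{ij}}(-1)^k\begin{bmatrix}1-a_{ij}\\k\end{bmatrix}_{q_i}F_i^kF_jF_i^{1-a_{ij}-k}=0$ ($i\ne j$). $U_q^0=\bigoplus_{\lambda\in d^{-1}Y}\mathbb Fq^\lambda$ is the group algebra of $d^{-1}Y$ ($q^0=1$, $q^\lambda q^\mu=q^{\lambda+\mu}$). A filtration of an $\mathbb F$-algebra $B$ is an increasing sequence of subspaces $F_0B\subset F_1B\subset\cdots$ with union $B$, $1\in F_0B$, $F_kB\,F_lB\subset F_{k+l}B$; $B$ is a tempered domain if it is an integral domain (possibly non-commutative, nonzero, without zero divisors) having a filtration with all $\dim_{\mathbb F}F_kB<\infty$ and $\limsup_k(\dim_{\mathbb F}F_kB)^{1/k}\le1$. A tempered domain is a (left and right) Ore domain, so it has a skew field of fractions $Q(B)$. $\mathcal A_{q,0}$ is a quotient algebra of $U_q^-$ that is a tempered domain; $f_i$ is the image of $F_i$ in $\mathcal A_{q,0}$. $\mathcal A_q=\mathcal A_{q,0}\otimes_{\mathbb F}U_q^0$ (a Laurent polynomial ring over $\mathcal A_{q,0}$ in which the $q^\lambda$ commute with the $f_j$); it is also a tempered domain, with skew field of fractions $Q(\mathcal A_q)$. For $i\in I$, $\tilde s_i$ is the algebra automorphism of $Q(\mathcal A_q)$ with $\tilde s_i(f_j)=f_j$ ($j\in I$), $\tilde s_i(q^\lambda)=q^{s_i(\lambda)}$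 ($\lambda\in d^{-1}Y$). $\mathrm{ad}(f_i)^k(f_j)=\sum_{\nu=0}^k(-1)^\nu q_i^{\nu(k-1+a_{ij})}\begin{bmatrix}k\\\nu\end{bmatrix}_{q_i}f_i^{k-\nu}f_jf_i^\nu$. For $\lambda\in Y$ one writes $q_i^{\lambda}=q^{d_i\lambda}\in U_q^0$, $q_i^{m(\lambda-k)}=(q_i^\lambda)^m q_i^{-mk}$, and $\begin{bmatrix}\lambda\\k\end{bmatrix}_{q_i}=\frac{[\lambda]_{q_i}[\lambda-1]_{q_i}\cdots[\lambda-k+1]_{q_i}}{[k]_{q_i}!}$ with $[\lambda-\nu]_{q_i}=\frac{q_i^\lambda q_i^{-\nu}-q_i^{-\lambda}q_i^{\nu}}{q_i-q_i^{-1}}\in U_q^0$. For $\lambda\in Y$ and $f_i\neq0$, $\gamma(f_i^\lambda)$ (conjugation by the non-integral power $f_i^\lambda$) denotes the algebra automorphism of $Q(\mathcal A_q)$ determined by $\gamma(f_i^\lambda)(q^\mu)=q^\mu$ ($\mu\in d^{-1}Y$), $\gamma(f_i^\lambda)(f_i)=f_i$, and $\gamma(f_i^\lambda)(f_j)=\sum_{k=0}^{-a_{ij}}q_i^{(k+a_{ij})(\lambda-k)}\begin{bmatrix}\lambda\\k\end{bmatrix}_{q_i}\mathrm{ad}(f_i)^k(f_j)f_i^{-k}$ for $j\ne i$. *)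

theory Defs
  imports
    "HOL-Algebra.Algebraic_Closure_Type"
    "HOL-Algebra.Group_Action"
    "HOL-Library.Poly_Mapping"
    "HOL-Library.Extended_Real"
begin

section \<open>Lattices, Cartan matrices and root data\<close>

definition zmul :: "int \<Rightarrow> 'a::ab_group_add \<Rightarrow> 'a" where
  "zmul n x = (\<Sum>_<nat n. x) - (\<Sum>_<nat (- n). x)"

lemma zmul_diff_of_nat: "zmul (int a - int b) x = (\<Sum>_<a. x) - (\<Sum>_<b. x)"
proof -
  have split: "(\<Sum>_<m + k. x) = (\<Sum>_<m. x) + (\<Sum>_<k. x)" for m k :: nat
    by (induction k) (simp_all add: add.assoc)
  show ?thesis
  proof (cases "a \<le> b")
    case True
    then obtain k where "b = a + k" using le_Suc_ex by blast
    then show ?thesis by (simp add: zmul_def split algebra_simps)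
  next
    case False
    then obtain k where "a = b + k" using le_Suc_ex nat_le_linear by blast
    then show ?thesis by (simp add: zmul_def split algebra_simps)
  qed
qed

lemma zmul_add_left: "zmul (m + n) x = zmul m x + zmul n x"
proof -
  obtain a b c d where *: "m = int a - int b" "n = int c - int d"
    by (metis int_diff_cases)
  have split: "(\<Sum>_<u + k. x) = (\<Sum>_<u. x) + (\<Sum>_<k. x)" for u k :: nat
    by (induction k) (simp_all add: add.assoc)
  have "m + n = int (a + c) - int (b + d)" using * by simp
  then have "zmul (m + n) x = (\<Sum>_<a + c. x) - (\<Sum>_<b + d. x)"
    by (simp only: zmul_diff_of_nat)
  also have "\<dots> = zmul m x + zmul n x"
    unfolding * zmul_diff_of_nat split by (simp add: algebra_simps)
  finally show ?thesis .
qed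

lemma zmul_add_right: "zmul n (x + y) = zmul n x + zmul n y"
  by (simp add: zmul_def sum.distrib)

lemma zmul_zero [simp]: "zmul 0 x = 0" and zmul_one [simp]: "zmul 1 x = x"
  by (simp_all add: zmul_def)

lemma zmul_minus: "zmul (- n) x = - zmul n x"
  by (simp add: zmul_def)

lemma zmul_zmul: "zmul m (zmul n x) = zmul (m * n) x"
proof (induction m rule: int_induct[where k = 0])
  case base
  then show ?case by simp
next
  case (step1 i)
  then show ?case by (simp add: zmul_add_left distrib_right)
next
  case (step2 i)
  then show ?case
    using zmul_add_left[of i "-1" "zmul n x"] zmul_add_left[of "i * n" "- n" x]
    by (simp add: zmul_minus left_diff_distrib)
qed

global_interpretation zmod: Modules.module "zmul :: int \<Rightarrow> 'a::ab_group_add \<Rightarrow> 'a"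
  by unfold_locales (simp_all add: zmul_add_left zmul_add_right zmul_zmul)

definition fg_free :: "'a::ab_group_add itself \<Rightarrow> bool" where
  "fg_free _ \<longleftrightarrow> (\<exists>B :: 'a set. finite B \<and> zmod.independent B \<and> zmod.span B = UNIV)"

definition gcm :: "('i::finite \<Rightarrow> 'i \<Rightarrow> int) \<Rightarrow> bool" where
  "gcm A \<longleftrightarrow> (\<forall>i. A i i = 2) \<and> (\<forall>i j. i \<noteq> j \<longrightarrow> A i j \<le> 0) \<and> (\<forall>i j. A i j = 0 \<longleftrightarrow> A j i = 0)"

definition symmetrized_by :: "('i::finite \<Rightarrow> 'i \<Rightarrow> int) \<Rightarrow> ('i \<Rightarrow> rat) \<Rightarrow> bool" where
  "symmetrized_by A D \<longleftrightarrow>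
     (\<forall>i. D i > 0) \<and> (\<forall>i j. D i * of_int (A i j) = D j * of_int (A j i))"

text \<open>A perfect pairing induces isomorphisms \<open>Y \<cong> Hom(X, \<int>)\<close> and \<open>X \<cong> Hom(Y, \<int>)\<close>.\<close>

definition perfect_pairing :: "('y::ab_group_add \<Rightarrow> 'x::ab_group_add \<Rightarrow> int) \<Rightarrow> bool" where
  "perfect_pairing p \<longleftrightarrow>
     (\<forall>y. Modules.additive (p y)) \<and> (\<forall>x. Modules.additive (\<lambda>y. p y x)) \<and>
     bij_betw p UNIV {h. Modules.additive h} \<and>
     bij_betw (\<lambda>x y. p y x) UNIV {h. Modules.additive h}"

record ('i, 'x, 'y) root_data =
  cartan :: "'i \<Rightarrow> 'i \<Rightarrow> int"
  symz :: "'i \<Rightarrow> rat"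
  pairing :: "'y \<Rightarrow> 'x \<Rightarrow> int"
  coroot :: "'i \<Rightarrow> 'y"
  simple_root :: "'i \<Rightarrow> 'x"

definition root_datum ::
  "('i::finite, 'x::ab_group_add, 'y::ab_group_add) root_data \<Rightarrow> bool" where
  "root_datum R \<longleftrightarrow>
     fg_free TYPE('x) \<and> fg_free TYPE('y) \<and> perfect_pairing (pairing R) \<and>
     (\<forall>i j. pairing R (coroot R i) (simple_root R j) = cartan R i j)"

definition lcden :: "('i, 'x, 'y) root_data \<Rightarrow> nat" where
  "lcden R = (LEAST n. n > 0 \<and> (\<forall>i. of_nat n * symz R i \<in> \<int>))"

text \<open>The lattice \<open>d\<^sup>-\<^sup>1Y\<close>: the element \<open>OverD y\<close> is \<open>d\<^sup>-\<^sup>1y\<close>. As \<open>Y\<close> is torsion free,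
  \<open>y \<mapsto> d\<^sup>-\<^sup>1y\<close> is an isomorphism of groups; the inclusion \<open>Y \<subseteq> d\<^sup>-\<^sup>1Y\<close> is \<open>y \<mapsto> OverD (d y)\<close>,
  i.e. \<open>dscale R 1\<close> below.\<close>

datatype 'y dlat = OverD 'y

instantiation dlat :: (ab_group_add) ab_group_add
begin

definition "0 = OverD 0"
fun plus_dlat where "OverD x + OverD y = OverD (x + y)"
fun minus_dlat where "OverD x - OverD y = OverD (x - y)"
fun uminus_dlat where "- OverD x = OverD (- x)"

instance
proof
  fix a b c :: "'a dlat"
  show "a + b + c = a + (b + c)" by (cases a; cases b; cases c) (simp add: add.assoc)
  show "a + b = b + a" by (cases a; cases b) (simp add: add.commute)
  show "0 + a = a" by (cases a) (simp add: zero_dlat_def)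
  show "- a + a = 0" by (cases a) (simp add: zero_dlat_def)
  show "a - b = a + - b" by (cases a; cases b) simp
qed

end

text \<open>The product \<open>r y \<in> d\<^sup>-\<^sup>1Y\<close> of \<open>r \<in> d\<^sup>-\<^sup>1\<int>\<close> and \<open>y \<in> Y\<close>; here \<open>d r\<close> is an integer.\<close>

definition dscale ::
  "('i, 'x, 'y) root_data \<Rightarrow> rat \<Rightarrow> 'y::ab_group_add \<Rightarrow> 'y dlat" where
  "dscale R r y = OverD (zmul \<lfloor>of_nat (lcden R) * r\<rfloor> y)"

fun dpairing :: "('i, 'x, 'y) root_data \<Rightarrow> 'y dlat \<Rightarrow> 'x \<Rightarrow> rat" where
  "dpairing R (OverD y) x = of_int (pairing R y x) / of_nat (lcden R)"

definition reflection ::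
  "('i, 'x, 'y::ab_group_add) root_data \<Rightarrow> 'i \<Rightarrow> 'y dlat \<Rightarrow> 'y dlat" where
  "reflection R i v = v - dscale R (dpairing R v (simple_root R i)) (coroot R i)"

section \<open>The Weyl group\<close>

text \<open>The group presented by generators \<open>'g\<close> and relations \<open>Rel\<close>: words in the letters
  \<open>(g, True)\<close> for \<open>g\<close> and \<open>(g, False)\<close> for \<open>g\<^sup>-\<^sup>1\<close>, modulo the congruence generated
  by free cancellation and \<open>Rel\<close>.\<close>

type_synonym 'g signed_word = "('g \<times> bool) list"

inductive pres_cong ::
  "('g signed_word \<times> 'g signed_word) set \<Rightarrow> 'g signed_word \<Rightarrow> 'g signed_word \<Rightarrow> bool"
  for Rel where
  "(u, v) \<in> Rel \<Longrightarrow> pres_cong Rel u v"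
| "pres_cong Rel [(g, e), (g, \<not> e)] []"
| "pres_cong Rel u u"
| "pres_cong Rel u v \<Longrightarrow> pres_cong Rel v u"
| "pres_cong Rel u v \<Longrightarrow> pres_cong Rel v w \<Longrightarrow> pres_cong Rel u w"
| "pres_cong Rel u u' \<Longrightarrow> pres_cong Rel v v' \<Longrightarrow> pres_cong Rel (u @ v) (u' @ v')"

definition pres_class ::
  "('g signed_word \<times> 'g signed_word) set \<Rightarrow> 'g signed_word \<Rightarrow> 'g signed_word set" where
  "pres_class Rel u = {v. pres_cong Rel u v}"

definition presented_group ::
  "('g signed_word \<times> 'g signed_word) set \<Rightarrow> 'g signed_word set monoid" where
  "presented_group Rel =
     \<lparr>carrier = range (pres_class Rel),
      monoid.mult = (\<lambda>U V. \<Union>u\<in>U. \<Union>v\<in>V. pres_class Rel (u @ v)),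
      one = pres_class Rel []\<rparr>"

lemma pres_class_eq_iff: "pres_class Rel u = pres_class Rel v \<longleftrightarrow> pres_cong Rel u v"
proof
  assume "pres_class Rel u = pres_class Rel v"
  moreover have "v \<in> pres_class Rel v" by (simp add: pres_class_def pres_cong.intros(3))
  ultimately show "pres_cong Rel u v" by (simp add: pres_class_def set_eq_iff)
next
  assume "pres_cong Rel u v"
  then have "pres_cong Rel u w \<longleftrightarrow> pres_cong Rel v w" for w
    by (meson pres_cong.intros(4,5))
  then show "pres_class Rel u = pres_class Rel v" by (simp add: pres_class_def)
qed

lemma presented_group_mult:
  "pres_class Rel u \<otimes>\<^bsub>presented_group Rel\<^esub> pres_class Rel v = pres_class Rel (u @ v)"
proof -
  have "pres_class Rel (u' @ v') = pres_class Rel (u @ v)"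
    if "u' \<in> pres_class Rel u" "v' \<in> pres_class Rel v" for u' v'
  proof -
    have "pres_cong Rel u u'" "pres_cong Rel v v'"
      using that by (simp_all add: pres_class_def)
    then show ?thesis
      unfolding pres_class_eq_iff by (intro pres_cong.intros(4)[OF pres_cong.intros(6)])
  qed
  moreover have "u \<in> pres_class Rel u" "v \<in> pres_class Rel v"
    by (simp_all add: pres_class_def pres_cong.intros(3))
  ultimately have "(\<Union>u'\<in>pres_class Rel u. \<Union>v'\<in>pres_class Rel v. pres_class Rel (u' @ v'))
      = pres_class Rel (u @ v)"
    by blast
  then show ?thesis by (simp add: presented_group_def)
qed

lemma presented_group_inv_word: "\<exists>v. pres_cong Rel (v @ u) []"
proof (induction u)
  case Nil
  then show ?case by (metis append_Nil pres_cong.intros(3))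
next
  case (Cons x u)
  then obtain v where v: "pres_cong Rel (v @ u) []" by blast
  obtain g e where x: "x = (g, e)" by (cases x)
  have c: "pres_cong Rel [(g, \<not> e), (g, e)] []"
    using pres_cong.intros(2)[of Rel g "\<not> e"] by simp
  have "pres_cong Rel ([(g, \<not> e), (g, e)] @ u) ([] @ u)"
    by (rule pres_cong.intros(6)[OF c pres_cong.intros(3)])
  then have "pres_cong Rel (v @ ([(g, \<not> e), (g, e)] @ u)) (v @ ([] @ u))"
    by (rule pres_cong.intros(6)[OF pres_cong.intros(3)])
  then have "pres_cong Rel ((v @ [(g, \<not> e)]) @ x # u) (v @ u)"
    by (simp add: x)
  then have "pres_cong Rel ((v @ [(g, \<not> e)]) @ x # u) []"
    by (rule pres_cong.intros(5)[OF _ v])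
  then show ?case by blast
qed

lemma group_presented_group: "group (presented_group Rel)"
proof (rule groupI)
  fix S assume "S \<in> carrier (presented_group Rel)"
  then obtain u where u: "S = pres_class Rel u" by (auto simp: presented_group_def)
  obtain v where "pres_cong Rel (v @ u) []" using presented_group_inv_word by blast
  then have "pres_class Rel v \<otimes>\<^bsub>presented_group Rel\<^esub> S = \<one>\<^bsub>presented_group Rel\<^esub>"
    unfolding u presented_group_mult
    by (simp add: presented_group_def pres_class_eq_iff)
  moreover have "pres_class Rel v \<in> carrier (presented_group Rel)"
    by (simp add: presented_group_def)
  ultimately show "\<exists>T\<in>carrier (presented_group Rel).
      T \<otimes>\<^bsub>presented_group Rel\<^esub> S = \<one>\<^bsub>presented_group Rel\<^esub>" by blast
next
  have c: "carrier (presented_group Rel) = range (pres_class Rel)"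
    and o: "\<one>\<^bsub>presented_group Rel\<^esub> = pres_class Rel []"
    by (simp_all add: presented_group_def)
  show "\<one>\<^bsub>presented_group Rel\<^esub> \<in> carrier (presented_group Rel)" by (simp add: c o)
  fix S assume S: "S \<in> carrier (presented_group Rel)"
  show "\<one>\<^bsub>presented_group Rel\<^esub> \<otimes>\<^bsub>presented_group Rel\<^esub> S = S"
    using S by (auto simp: c o presented_group_mult)
  fix T assume T: "T \<in> carrier (presented_group Rel)"
  show "S \<otimes>\<^bsub>presented_group Rel\<^esub> T \<in> carrier (presented_group Rel)"
    using S T by (auto simp: c presented_group_mult)
  fix V assume V: "V \<in> carrier (presented_group Rel)"
  show "S \<otimes>\<^bsub>presented_group Rel\<^esub> T \<otimes>\<^bsub>presented_group Rel\<^esub> V =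
        S \<otimes>\<^bsub>presented_group Rel\<^esub> (T \<otimes>\<^bsub>presented_group Rel\<^esub> V)"
    using S T V by (auto simp: c presented_group_mult)
qed

abbreviation alternating :: "nat \<Rightarrow> 'i \<Rightarrow> 'i \<Rightarrow> 'i signed_word" where
  "alternating n i j \<equiv> concat (replicate n [(i, True), (j, True)])"

definition weyl_relations ::
  "('i \<Rightarrow> 'i \<Rightarrow> int) \<Rightarrow> ('i signed_word \<times> 'i signed_word) set" where
  "weyl_relations A =
     {([(i, True), (i, True)], []) | i. True}
   \<union> {(alternating 1 i j, alternating 1 j i) | i j. i \<noteq> j \<and> A i j * A j i = 0}
   \<union> {([(i, True), (j, True), (i, True)], [(j, True), (i, True), (j, True)]) | i j.
        i \<noteq> j \<and> A i j * A j i = 1}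
   \<union> {(alternating 2 i j, alternating 2 j i) | i j. i \<noteq> j \<and> A i j * A j i = 2}
   \<union> {(alternating 3 i j, alternating 3 j i) | i j. i \<noteq> j \<and> A i j * A j i = 3}"

definition weyl_group :: "('i \<Rightarrow> 'i \<Rightarrow> int) \<Rightarrow> 'i signed_word set monoid" where
  "weyl_group A = presented_group (weyl_relations A)"

definition weyl_gen :: "('i \<Rightarrow> 'i \<Rightarrow> int) \<Rightarrow> 'i \<Rightarrow> 'i signed_word set" where
  "weyl_gen A i = pres_class (weyl_relations A) [(i, True)]"

section \<open>The ground field and \<open>q\<close>-numbers\<close>

text \<open>The field \<open>\<rat>(q\<^sup>1\<^sup>/\<^sup>d)\<close> is realized as \<open>\<rat>(t)\<close> with \<open>t = q\<^sup>1\<^sup>/\<^sup>d\<close>.\<close>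

type_synonym qfield = "rat poly fract"

definition tvar :: qfield where
  "tvar = Fract [:0, 1:] 1"

text \<open>\<open>q\<^sup>r\<close> for \<open>r \<in> d\<^sup>-\<^sup>1\<int>\<close>, and \<open>q\<^sub>i = q\<close> to the power \<open>d\<^sub>i\<close>.\<close>

definition qpow :: "('i, 'x, 'y) root_data \<Rightarrow> rat \<Rightarrow> qfield" where
  "qpow R r = tvar powi \<lfloor>of_nat (lcden R) * r\<rfloor>"

definition qi :: "('i, 'x, 'y) root_data \<Rightarrow> 'i \<Rightarrow> qfield" where
  "qi R i = qpow R (symz R i)"

definition qnum :: "'f::field \<Rightarrow> int \<Rightarrow> 'f" where
  "qnum p x = (p powi x - p powi (- x)) / (p - inverse p)"

definition qfact :: "'f::field \<Rightarrow> nat \<Rightarrow> 'f" where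
  "qfact p n = (\<Prod>k = 1..n. qnum p (int k))"

definition qbinom :: "'f::field \<Rightarrow> int \<Rightarrow> nat \<Rightarrow> 'f" where
  "qbinom p x k = (\<Prod>\<nu><k. qnum p (x - int \<nu>)) / qfact p k"

section \<open>The algebra \<open>U\<^sub>q\<^sup>-\<close>\<close>

text \<open>The free monoid, written additively so that \<open>'i fmon \<Rightarrow>\<^sub>0 qfield\<close> (its monoid algebra,
  with the library's convolution product) is the free associative algebra on \<open>'i\<close>.\<close>

datatype 'i fmon = FMon "'i list"

instantiation fmon :: (type) monoid_add
begin

definition "0 = FMon []"
fun plus_fmon where "FMon u + FMon v = FMon (u @ v)"

instance
proof
  fix a b c :: "'a fmon"
  show "a + b + c = a + (b + c)" by (cases a; cases b; cases c) simp
  show "0 + a = a" by (cases a) (simp add: zero_fmon_def)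
  show "a + 0 = a" by (cases a) (simp add: zero_fmon_def)
qed

end

type_synonym 'i free_alg = "'i fmon \<Rightarrow>\<^sub>0 qfield"

definition free_gen :: "'i \<Rightarrow> 'i free_alg" where
  "free_gen i = Poly_Mapping.single (FMon [i]) 1"

definition free_const :: "qfield \<Rightarrow> 'i free_alg" where
  "free_const c = Poly_Mapping.single 0 c"

definition serre :: "('i, 'x, 'y) root_data \<Rightarrow> 'i \<Rightarrow> 'i \<Rightarrow> 'i free_alg" where
  "serre R i j =
     (let n = nat (1 - cartan R i j) in
      \<Sum>k\<le>n. (- 1) ^ k * free_const (qbinom (qi R i) (1 - cartan R i j) k)
             * free_gen i ^ k * free_gen j * free_gen i ^ (n - k))"

text \<open>In the noncommutative ring below, \<open>genideal\<close> is the generated two-sided ideal.\<close>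

definition serre_ideal :: "('i, 'x, 'y) root_data \<Rightarrow> 'i free_alg set" where
  "serre_ideal R = genideal ring_of_type_algebra {serre R i j | i j. i \<noteq> j}"

definition Uq_minus :: "('i, 'x, 'y) root_data \<Rightarrow> 'i free_alg set ring" where
  "Uq_minus R = ring_of_type_algebra Quot serre_ideal R"

definition Uq_class :: "('i, 'x, 'y) root_data \<Rightarrow> 'i free_alg \<Rightarrow> 'i free_alg set" where
  "Uq_class R x = serre_ideal R +>\<^bsub>ring_of_type_algebra\<^esub> x"

section \<open>Tempered domains and skew fields of fractions\<close>

definition assoc_algebra :: "('f::field \<Rightarrow> 'b::ring_1 \<Rightarrow> 'b) \<Rightarrow> bool" where
  "assoc_algebra s \<longleftrightarrow> Vector_Spaces.vector_space s \<and>
     (\<forall>c x y. s c (x * y) = s c x * y \<and> s c (x * y) = x * s c y)"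

definition algebra_filtration ::
  "('f::field \<Rightarrow> 'b::ring_1 \<Rightarrow> 'b) \<Rightarrow> (nat \<Rightarrow> 'b set) \<Rightarrow> bool" where
  "algebra_filtration s Fil \<longleftrightarrow>
     (\<forall>k. Modules.module.subspace s (Fil k)) \<and> (\<forall>k. Fil k \<subseteq> Fil (Suc k)) \<and>
     (\<Union>k. Fil k) = UNIV \<and> 1 \<in> Fil 0 \<and>
     (\<forall>k l. \<forall>x\<in>Fil k. \<forall>y\<in>Fil l. x * y \<in> Fil (k + l))"

definition tempered_domain :: "('f::field \<Rightarrow> 'b::ring_1 \<Rightarrow> 'b) \<Rightarrow> bool" where
  "tempered_domain s \<longleftrightarrow>
     assoc_algebra s \<and> (\<forall>x y :: 'b. x * y = 0 \<longrightarrow> x = 0 \<or> y = 0) \<and>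
     (\<exists>Fil. algebra_filtration s Fil \<and>
        (\<forall>k. \<exists>B. finite B \<and> Modules.module.span s B = Fil k) \<and>
        limsup (\<lambda>k. ereal (root k (real (Vector_Spaces.vector_space.dim s (Fil k))))) \<le> 1)"

definition skew_field_of_fractions :: "('b::ring_1 \<Rightarrow> 'k::division_ring) \<Rightarrow> bool" where
  "skew_field_of_fractions e \<longleftrightarrow>
     inj e \<and> e 1 = 1 \<and> (\<forall>x y. e (x + y) = e x + e y) \<and> (\<forall>x y. e (x * y) = e x * e y) \<and>
     (\<forall>z. \<exists>x y. y \<noteq> 0 \<and> z = e x * inverse (e y)) \<and>
     (\<forall>z. \<exists>x y. y \<noteq> 0 \<and> z = inverse (e y) * e x)"

section \<open>The algebras \<open>A\<^sub>q\<^sub>,\<^sub>0\<close>, \<open>A\<^sub>q\<close> and \<open>Q(A\<^sub>q)\<close>\<close>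

text \<open>\<open>'b\<close> is \<open>A\<^sub>q\<^sub>,\<^sub>0\<close>, with scalar multiplication \<open>scaleA\<close> and quotient map \<open>proj\<close> from
  \<open>U\<^sub>q\<^sup>-\<close>. The tensor product \<open>A\<^sub>q = A\<^sub>q\<^sub>,\<^sub>0 \<otimes> U\<^sub>q\<^sup>0\<close> is the group algebra \<open>'y dlat \<Rightarrow>\<^sub>0 'b\<close> of
  \<open>d\<^sup>-\<^sup>1Y\<close> over \<open>A\<^sub>q\<^sub>,\<^sub>0\<close>, and \<open>emb\<close> embeds it into its skew field of fractions \<open>'k\<close>.\<close>

record (overloaded) ('i, 'b, 'y, 'k) alg_data =
  scaleA :: "qfield \<Rightarrow> 'b \<Rightarrow> 'b"
  proj :: "'i free_alg set \<Rightarrow> 'b"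
  emb :: "('y dlat \<Rightarrow>\<^sub>0 'b) \<Rightarrow> 'k"

definition quotient_of_Uq_minus ::
  "('i, 'x, 'y) root_data \<Rightarrow> (qfield \<Rightarrow> 'b::ring_1 \<Rightarrow> 'b) \<Rightarrow> ('i free_alg set \<Rightarrow> 'b) \<Rightarrow> bool" where
  "quotient_of_Uq_minus R s \<pi> \<longleftrightarrow>
     \<pi> \<in> ring_hom (Uq_minus R) ring_of_type_algebra \<and>
     (\<forall>c x. \<pi> (Uq_class R (free_const c * x)) = s c (\<pi> (Uq_class R x))) \<and>
     \<pi> ` carrier (Uq_minus R) = UNIV"

definition alg_datum ::
  "('i, 'x, 'y::ab_group_add) root_data \<Rightarrow>
   ('i, 'b::ring_1, 'y, 'k::division_ring) alg_data \<Rightarrow> bool" where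
  "alg_datum R Q \<longleftrightarrow>
     tempered_domain (scaleA Q) \<and> quotient_of_Uq_minus R (scaleA Q) (proj Q) \<and>
     skew_field_of_fractions (emb Q)"

definition fgen0 :: "('i, 'x, 'y) root_data \<Rightarrow> ('i, 'b, 'y, 'k) alg_data \<Rightarrow> 'i \<Rightarrow> 'b" where
  "fgen0 R Q i = proj Q (Uq_class R (free_gen i))"

definition fgen ::
  "('i, 'x, 'y::ab_group_add) root_data \<Rightarrow> ('i, 'b::ring_1, 'y, 'k) alg_data \<Rightarrow> 'i \<Rightarrow> 'k" where
  "fgen R Q i = emb Q (Poly_Mapping.single 0 (fgen0 R Q i))"

text \<open>\<open>U\<^sub>q\<^sup>0\<close> is the (commutative) group algebra \<open>'y dlat \<Rightarrow>\<^sub>0 qfield\<close>; \<open>of_U0\<close> is its embedding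
  into \<open>Q(A\<^sub>q)\<close>.\<close>

definition of_U0 ::
  "('i, 'b::ring_1, 'y, 'k) alg_data \<Rightarrow> ('y dlat \<Rightarrow>\<^sub>0 qfield) \<Rightarrow> 'k" where
  "of_U0 Q u = emb Q (Poly_Mapping.map (\<lambda>c. scaleA Q c 1) u)"

definition qexp0 :: "'y dlat \<Rightarrow> ('y dlat \<Rightarrow>\<^sub>0 qfield)" where
  "qexp0 v = Poly_Mapping.single v 1"

definition const0 :: "qfield \<Rightarrow> ('y::ab_group_add dlat \<Rightarrow>\<^sub>0 qfield)" where
  "const0 c = Poly_Mapping.single 0 c"

definition qexp :: "('i, 'b::ring_1, 'y, 'k) alg_data \<Rightarrow> 'y dlat \<Rightarrow> 'k" where
  "qexp Q v = of_U0 Q (qexp0 v)"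

definition scalar ::
  "('i, 'b::ring_1, 'y::ab_group_add, 'k) alg_data \<Rightarrow> qfield \<Rightarrow> 'k" where
  "scalar Q c = of_U0 Q (const0 c)"

definition algebra_automorphism ::
  "('i, 'b::ring_1, 'y::ab_group_add, 'k::division_ring) alg_data \<Rightarrow> ('k \<Rightarrow> 'k) \<Rightarrow> bool" where
  "algebra_automorphism Q \<sigma> \<longleftrightarrow>
     bij \<sigma> \<and> \<sigma> 1 = 1 \<and> (\<forall>x y. \<sigma> (x + y) = \<sigma> x + \<sigma> y) \<and> (\<forall>x y. \<sigma> (x * y) = \<sigma> x * \<sigma> y) \<and>
     (\<forall>c x. \<sigma> (scalar Q c * x) = scalar Q c * \<sigma> x)"

section \<open>The automorphisms\<close>

text \<open>\<open>q\<^sub>i\<close> to the power \<open>m(\<lambda> - k)\<close>, for \<open>\<lambda> \<in> Y\<close>.\<close>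

definition qi_shift ::
  "('i, 'x, 'y::ab_group_add) root_data \<Rightarrow> 'i \<Rightarrow> int \<Rightarrow> 'y \<Rightarrow> int \<Rightarrow> ('y dlat \<Rightarrow>\<^sub>0 qfield)" where
  "qi_shift R i m l k =
     qexp0 (zmul m (dscale R (symz R i) l)) * const0 (qi R i powi (- (m * k)))"

definition qnum0 ::
  "('i, 'x, 'y::ab_group_add) root_data \<Rightarrow> 'i \<Rightarrow> 'y \<Rightarrow> int \<Rightarrow> ('y dlat \<Rightarrow>\<^sub>0 qfield)" where
  "qnum0 R i l \<nu> =
     const0 (inverse (qi R i - inverse (qi R i))) *
     (qexp0 (dscale R (symz R i) l) * const0 (qi R i powi (- \<nu>))
      - qexp0 (- dscale R (symz R i) l) * const0 (qi R i powi \<nu>))"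

definition qbinom0 ::
  "('i, 'x, 'y::ab_group_add) root_data \<Rightarrow> 'i \<Rightarrow> 'y \<Rightarrow> nat \<Rightarrow> ('y dlat \<Rightarrow>\<^sub>0 qfield)" where
  "qbinom0 R i l k = const0 (inverse (qfact (qi R i) k)) * (\<Prod>\<nu><k. qnum0 R i l (int \<nu>))"

definition ad_pow ::
  "('i, 'x, 'y::ab_group_add) root_data \<Rightarrow> ('i, 'b::ring_1, 'y, 'k::division_ring) alg_data \<Rightarrow>
   'i \<Rightarrow> nat \<Rightarrow> 'i \<Rightarrow> 'k" where
  "ad_pow R Q i k j =
     (\<Sum>\<nu>\<le>k. (- 1) ^ \<nu>
        * scalar Q (qi R i powi (int \<nu> * (int k - 1 + cartan R i j)) * qbinom (qi R i) (int k) \<nu>)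
        * fgen R Q i ^ (k - \<nu>) * fgen R Q j * fgen R Q i ^ \<nu>)"

definition s_tilde ::
  "('i, 'x, 'y::ab_group_add) root_data \<Rightarrow> ('i, 'b::ring_1, 'y, 'k::division_ring) alg_data \<Rightarrow>
   'i \<Rightarrow> 'k \<Rightarrow> 'k" where
  "s_tilde R Q i = (THE \<sigma>. algebra_automorphism Q \<sigma> \<and>
     (\<forall>j. \<sigma> (fgen R Q j) = fgen R Q j) \<and>
     (\<forall>v. \<sigma> (qexp Q v) = qexp Q (reflection R i v)))"

text \<open>\<open>gamma R Q i l\<close> is the conjugation by the (formal) power of \<open>f\<^sub>i\<close> with exponent \<open>l \<in> Y\<close>.\<close>

definition gamma ::
  "('i, 'x, 'y::ab_group_add) root_data \<Rightarrow> ('i, 'b::ring_1, 'y, 'k::division_ring) alg_data \<Rightarrow>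
   'i \<Rightarrow> 'y \<Rightarrow> 'k \<Rightarrow> 'k" where
  "gamma R Q i l = (THE \<sigma>. algebra_automorphism Q \<sigma> \<and>
     (\<forall>v. \<sigma> (qexp Q v) = qexp Q v) \<and>
     \<sigma> (fgen R Q i) = fgen R Q i \<and>
     (\<forall>j. j \<noteq> i \<longrightarrow> \<sigma> (fgen R Q j) =
        (\<Sum>k = 0..nat (- cartan R i j).
           of_U0 Q (qi_shift R i (int k + cartan R i j) l (int k) * qbinom0 R i l k)
           * ad_pow R Q i k j * inverse (fgen R Q i) ^ k)))"

definition S_op ::
  "('i, 'x, 'y::ab_group_add) root_data \<Rightarrow> ('i, 'b::ring_1, 'y, 'k::division_ring) alg_data \<Rightarrow>
   'i \<Rightarrow> 'k \<Rightarrow> 'k" where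
  "S_op R Q i = s_tilde R Q i \<circ> gamma R Q i (- coroot R i)"

end

theory Submission
  imports Defs
begin

text \<open>Evaluate \<open>U\<^sub>q\<^sup>0\<close> at the additive maps \<open>h : Y \<rightarrow> \<int>\<close>, sending the exponential of \<open>d\<^sup>-\<^sup>1y\<close> to the power
  of \<open>q\<^sup>1\<^sup>/\<^sup>d\<close> with exponent \<open>h(y)\<close>. Every element of \<open>Q(A\<^sub>q)\<close> becomes a function of generic \<open>h\<close>, and is
  determined by this function because the points \<open>h\<close> are dense. At the point \<open>h\<close>, the automorphism
  \<open>gamma R Q i l\<close> is conjugation by the genuine integral power of \<open>f\<^sub>i\<close> with exponent \<open>h(l)\<close>, while \<open>s_tilde\<close>
  only moves the point. Thus \<open>S_op R Q i\<close> reflects \<open>h\<close> and conjugates by a power of \<open>f\<^sub>i\<close>, and the Weyl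
  group relations reduce to Verma's identities between products of integral powers of \<open>f\<^sub>i\<close> and \<open>f\<^sub>j\<close>,
  e.g. \<open>f\<^sub>i\<^sup>a f\<^sub>j\<^sup>a\<^sup>+\<^sup>b f\<^sub>i\<^sup>b = f\<^sub>j\<^sup>b f\<^sub>i\<^sup>a\<^sup>+\<^sup>b f\<^sub>j\<^sup>a\<close>.

  By the Serre relations \<open>f\<^sub>j\<close> is a sum of eigenvectors of conjugation by \<open>f\<^sub>i\<close>, and vice versa. This makes
  conjugation of polynomials in \<open>f\<^sub>i\<close>, \<open>f\<^sub>j\<close> by \<open>f\<^sub>i\<^sup>n\<close> explicit. Verma's identities follow by
  induction on \<open>b\<close>: passing from \<open>b\<close> to \<open>b + 1\<close> multiplies both sides on the left by the same element.\<close>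

locale central_scalars =
  fixes sc :: "'f::field \<Rightarrow> 'k::division_ring"
  assumes sc_1 [simp]: "sc 1 = 1"
    and sc_add: "sc (a + b) = sc a + sc b"
    and sc_mult: "sc (a * b) = sc a * sc b"
    and sc_commute: "sc a * x = x * sc a"
begin

lemma sc_0 [simp]: "sc 0 = 0"
  using sc_add[of 0 0] by simp

lemma sc_minus: "sc (- a) = - sc a"
  using sc_add[of a "- a"] by (simp add: eq_neg_iff_add_eq_0 add.commute)

lemma sc_diff: "sc (a - b) = sc a - sc b"
  using sc_add[of a "- b"] by (simp add: sc_minus)

lemma sc_eq_0_iff [simp]: "sc a = 0 \<longleftrightarrow> a = 0"
proof
  assume *: "sc a = 0"
  show "a = 0"
  proof (rule ccontr)
    assume "a \<noteq> 0"
    then have "sc (a * inverse a) = 1" by simp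
    then show False using * by (simp only: sc_mult) simp
  qed
qed simp

lemma sc_power: "sc (a ^ n) = sc a ^ n"
  by (induction n) (simp_all add: sc_mult)

lemma sc_left_commute: "x * (sc a * y) = sc a * (x * y)"
  by (metis mult.assoc sc_commute)

lemma vandermonde:
  assumes "finite S" "inj_on l S"
    and "\<And>n::nat. (\<Sum>i\<in>S. sc (l i ^ n) * x i) = 0"
    and "i \<in> S"
  shows "x i = 0"
  using assms
proof (induction S arbitrary: x i rule: finite_induct)
  case (insert j S)
  have zero: "x i = 0" if i: "i \<in> S" for i
  proof -
    have "(\<Sum>i\<in>S. sc (l i ^ n) * (sc (l i - l j) * x i)) = 0" for n
    proof -
      have *: "sc (l i ^ n) * (sc (l i - l j) * x i)
          = sc (l i ^ Suc n) * x i - sc (l j) * (sc (l i ^ n) * x i)" for i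
        by (simp only: power_Suc2 sc_mult sc_diff left_diff_distrib right_diff_distrib mult.assoc
              sc_left_commute[of "sc (l j)" "l i ^ n"])
      have "(\<Sum>i\<in>insert j S. sc (l i ^ n) * (sc (l i - l j) * x i)) = 0"
        unfolding * sum_subtractf sum_distrib_left[symmetric] insert.prems(2) by simp
      then show ?thesis using insert.hyps by simp
    qed
    then have "sc (l i - l j) * x i = 0"
      using insert.IH[of "\<lambda>i. sc (l i - l j) * x i" i] insert.prems(1) i by auto
    moreover have "l i \<noteq> l j"
      using insert.prems(1) insert.hyps i by (auto simp: inj_on_def)
    ultimately show ?thesis by simp
  qed
  have "x j = 0"
    using insert.prems(2)[of 0] insert.hyps zero by simp
  then show ?case
    using insert.prems(3) zero by auto
qed simp

lemma powi_eigenvector: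
  assumes "f \<noteq> 0" "f * t = sc l * (t * f)" "l \<noteq> 0"
  shows "f powi n * t = sc (l powi n) * (t * f powi n)"
proof -
  have inv: "inverse f * t = sc (inverse l) * (t * inverse f)"
  proof -
    have "f * (sc (inverse l) * (t * inverse f)) = sc (inverse l) * (sc l * (t * f)) * inverse f"
      by (metis assms(2) mult.assoc sc_left_commute)
    also have "\<dots> = sc (inverse l * l) * t * (f * inverse f)"
      by (simp only: sc_mult mult.assoc)
    also have "\<dots> = t" using assms(1,3) by simp
    finally have "inverse f * (f * (sc (inverse l) * (t * inverse f))) = inverse f * t" by simp
    then show ?thesis using assms(1) by (simp add: mult.assoc[symmetric])
  qed
  have pow: "x ^ k * t = sc (m ^ k) * (t * x ^ k)" if x: "x * t = sc m * (t * x)" for x m k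
  proof (induction k)
    case (Suc k)
    have "x ^ Suc k * t = x * (x ^ k * t)" by (simp add: mult.assoc)
    also have "\<dots> = sc (m ^ k) * (x * t * x ^ k)"
      unfolding Suc by (simp add: sc_left_commute mult.assoc)
    also have "\<dots> = sc (m ^ k * m) * (t * (x * x ^ k))"
      unfolding x by (simp add: sc_mult mult.assoc)
    finally show ?case by (simp add: mult.commute)
  qed simp
  show ?thesis
    using pow[OF assms(2), of "nat n"] pow[OF inv, of "nat (- n)"]
    by (simp add: power_int_def)
qed

lemma eigenvector_decomposition:
  assumes "f \<noteq> 0" "distinct ls"
    and "foldr (\<lambda>l y. f * y * inverse f - sc l * y) ls x = 0"
  shows "\<exists>t. x = (\<Sum>l\<in>set ls. t l) \<and> (\<forall>l\<in>set ls. f * t l = sc l * (t l * f))"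
  using assms(2,3)
proof (induction ls arbitrary: x rule: rev_induct)
  case (snoc m ls)
  define y where "y = f * x * inverse f - sc m * x"
  have "foldr (\<lambda>l y. f * y * inverse f - sc l * y) ls y = 0"
    using snoc.prems(2) by (simp add: y_def)
  then obtain t where t: "y = (\<Sum>l\<in>set ls. t l)"
      "\<And>l. l \<in> set ls \<Longrightarrow> f * t l = sc l * (t l * f)"
    using snoc.IH snoc.prems(1) by auto
  have m: "m \<notin> set ls" using snoc.prems(1) by simp
  define u where "u l = (if l = m then x - (\<Sum>l\<in>set ls. sc (inverse (l - m)) * t l)
                         else sc (inverse (l - m)) * t l)" for l
  have u: "f * u l = sc l * (u l * f)" if "l \<in> set ls" for l
  proof -
    have "l \<noteq> m" using m that by auto
    then show ?thesis
      using t(2)[OF that] by (simp add: u_def mult.assoc) (metis sc_left_commute)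
  qed
  have conj: "f * u l * inverse f - sc m * u l = t l" if "l \<in> set ls" for l
  proof -
    have "l \<noteq> m" using m that by auto
    have "f * u l * inverse f - sc m * u l = sc (l - m) * u l"
      using u[OF that] assms(1) by (simp add: mult.assoc sc_diff left_diff_distrib)
    also have "\<dots> = sc ((l - m) * inverse (l - m)) * t l"
      using \<open>l \<noteq> m\<close> by (simp only: u_def sc_mult mult.assoc) simp
    also have "\<dots> = t l" using \<open>l \<noteq> m\<close> by simp
    finally show ?thesis .
  qed
  have ne: "(\<Sum>l\<in>set ls. sc (inverse (l - m)) * t l) = (\<Sum>l\<in>set ls. u l)"
    using m by (intro sum.cong) (auto simp: u_def)
  have um: "u m = x - (\<Sum>l\<in>set ls. u l)" using ne by (simp add: u_def)
  have "f * u m * inverse f - sc m * u m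
      = y - (\<Sum>l\<in>set ls. f * u l * inverse f - sc m * u l)"
    by (simp add: um y_def sum_subtractf sum_distrib_left sum_distrib_right algebra_simps)
  also have "\<dots> = 0" using t(1) conj by simp
  finally have "f * u m * inverse f * f = sc m * u m * f" by simp
  then have "f * u m = sc m * (u m * f)" using assms(1) by (simp add: mult.assoc)
  moreover have "x = (\<Sum>l\<in>set (ls @ [m]). u l)" using m um by simp
  ultimately show ?case using u by auto
qed simp

end

locale generic_q =
  fixes q :: "'f::field"
  assumes q_nonzero [simp]: "q \<noteq> 0"
    and q_generic: "q powi n = 1 \<Longrightarrow> n = 0"
begin

lemma q_powi_inj: "q powi m = q powi n \<longleftrightarrow> m = n"
proof
  assume "q powi m = q powi n"
  then have "q powi (m - n) = 1" by (simp add: power_int_diff)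
  then show "m = n" using q_generic by fastforce
qed simp

lemma qnum_denominator_nonzero: "q - inverse q \<noteq> 0"
proof
  assume "q - inverse q = 0"
  then have "q powi 2 = q powi 0" by (simp add: field_simps power2_eq_square)
  then show False unfolding q_powi_inj by simp
qed

lemma qnum_eq_0_iff [simp]: "qnum q k = 0 \<longleftrightarrow> k = 0"
  using qnum_denominator_nonzero q_powi_inj[of k "- k"] by (auto simp: qnum_def)

lemma qnum_add:
  "qnum q (x + y) = q powi (- y) * qnum q x + q powi x * qnum q y"
  "qnum q (x + y) = q powi y * qnum q x + q powi (- x) * qnum q y"
  by (simp_all add: qnum_def add_divide_distrib[symmetric] power_int_add power_int_minus
      power_int_diff divide_inverse algebra_simps)

lemma qfact_Suc: "qfact q (Suc n) = qfact q n * qnum q (int n + 1)"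
  by (simp add: qfact_def add.commute)

lemma qfact_nonzero [simp]: "qfact q n \<noteq> 0"
  by (simp add: qfact_def)

lemma qbinom_0 [simp]: "qbinom q x 0 = 1"
  by (simp add: qbinom_def qfact_def)

lemma qbinom_eq_0: "0 \<le> x \<Longrightarrow> x < int k \<Longrightarrow> qbinom q x k = 0"
  unfolding qbinom_def
  by (auto intro!: bexI[of _ "nat x"])

lemma qbinom_pascal:
  "qbinom q (x + 1) (Suc k) =
     q powi (- (int k + 1)) * qbinom q x (Suc k) + q powi (x - int k) * qbinom q x k"
  "qbinom q (x + 1) (Suc k) =
     q powi (int k + 1) * qbinom q x (Suc k) + q powi (- (x - int k)) * qbinom q x k"
proof -
  define P where "P = (\<Prod>\<nu><k. qnum q (x - int \<nu>))"
  have "(\<Prod>\<nu><Suc k. qnum q (x + 1 - int \<nu>)) = qnum q (x + 1) * P"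
    unfolding prod.lessThan_Suc_shift P_def by (simp add: algebra_simps)
  then have 1: "qbinom q (x + 1) (Suc k) = qnum q (x + 1) * P / qfact q (Suc k)"
    by (simp add: qbinom_def)
  have 2: "qbinom q x (Suc k) = qnum q (x - int k) * P / qfact q (Suc k)"
    by (simp add: qbinom_def P_def)
  have "qnum q (int k + 1) \<noteq> 0" by (subst qnum_eq_0_iff) linarith
  then have 3: "qbinom q x k = qnum q (int k + 1) * P / qfact q (Suc k)"
    by (simp add: qbinom_def P_def qfact_Suc)
  show "qbinom q (x + 1) (Suc k) =
     q powi (- (int k + 1)) * qbinom q x (Suc k) + q powi (x - int k) * qbinom q x k"
    unfolding 1 2 3 using qnum_add(1)[of "x - int k" "int k + 1"]
    by (simp add: add_divide_distrib[symmetric] algebra_simps)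
  show "qbinom q (x + 1) (Suc k) =
     q powi (int k + 1) * qbinom q x (Suc k) + q powi (- (x - int k)) * qbinom q x k"
    unfolding 1 2 3 using qnum_add(2)[of "x - int k" "int k + 1"]
    by (simp add: add_divide_distrib[symmetric] algebra_simps)
qed

end

locale q_conjugation = central_scalars sc + generic_q q
  for sc :: "'f::field \<Rightarrow> 'k::division_ring" and q :: 'f +
  fixes f g :: 'k and a :: int
  assumes f_nonzero: "f \<noteq> 0" and a_nonpos: "a \<le> 0"
begin

definition adp :: "nat \<Rightarrow> 'k" where
  "adp k = (\<Sum>\<nu>\<le>k. (- 1) ^ \<nu>
     * sc (q powi (int \<nu> * (int k - 1 + a)) * qbinom q (int k) \<nu>) * f ^ (k - \<nu>) * g * f ^ \<nu>)"

lemma adp_Suc: "adp (Suc k) = f * adp k - sc (q powi (a + 2 * int k)) * adp k * f"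
proof -
  define c where "c k \<nu> = (- 1) ^ \<nu> * (q powi (int \<nu> * (int k - 1 + a)) * qbinom q (int k) \<nu>)"
    for k \<nu>
  define w where "w i j = f ^ i * g * f ^ j" for i j
  have neg: "(- 1) ^ \<nu> * sc x = sc ((- 1) ^ \<nu> * x)" for \<nu> x
    by (simp add: sc_mult sc_power sc_minus)
  have adp: "adp k = (\<Sum>\<nu>\<le>k. sc (c k \<nu>) * w (k - \<nu>) \<nu>)" for k
    unfolding adp_def c_def w_def neg by (simp add: mult.assoc)
  have c0: "c k 0 = 1" for k by (simp add: c_def)
  have cS: "c (Suc k) (Suc \<nu>) = c k (Suc \<nu>) - q powi (a + 2 * int k) * c k \<nu>" for \<nu>
  proof -
    have e1: "q powi (int (Suc \<nu>) * (int (Suc k) - 1 + a)) * q powi (- (int \<nu> + 1))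
        = q powi (int (Suc \<nu>) * (int k - 1 + a))"
      by (simp add: power_int_add[symmetric] algebra_simps)
    have e2: "q powi (int (Suc \<nu>) * (int (Suc k) - 1 + a)) * q powi (int k - int \<nu>)
        = q powi (a + 2 * int k) * q powi (int \<nu> * (int k - 1 + a))"
      by (simp add: power_int_add[symmetric] algebra_simps)
    have e: "int (Suc k) = int k + 1" by simp
    have "c (Suc k) (Suc \<nu>) = (- 1) ^ Suc \<nu> * (
        (q powi (int (Suc \<nu>) * (int (Suc k) - 1 + a)) * q powi (- (int \<nu> + 1))) * qbinom q (int k) (Suc \<nu>)
      + (q powi (int (Suc \<nu>) * (int (Suc k) - 1 + a)) * q powi (int k - int \<nu>)) * qbinom q (int k) \<nu>)"
      unfolding c_def using qbinom_pascal(1)[of "int k" \<nu>]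
      by (simp only: e) (simp add: algebra_simps)
    then show ?thesis
      unfolding e1 e2 by (simp add: c_def algebra_simps)
  qed
  have top: "c k (Suc k) = 0" by (simp add: c_def qbinom_eq_0)
  have "adp (Suc k) = sc (c k 0) * w (Suc k) 0
      + (\<Sum>\<nu>\<le>k. sc (c k (Suc \<nu>) - q powi (a + 2 * int k) * c k \<nu>) * w (k - \<nu>) (Suc \<nu>))"
    unfolding adp sum.atMost_Suc_shift c0 cS by simp
  also have "\<dots> = (\<Sum>\<nu>\<le>Suc k. sc (c k \<nu>) * w (Suc k - \<nu>) \<nu>)
      - sc (q powi (a + 2 * int k)) * (\<Sum>\<nu>\<le>k. sc (c k \<nu>) * w (k - \<nu>) (Suc \<nu>))"
    unfolding sum.atMost_Suc_shift
    by (simp add: sc_diff left_diff_distrib sum_subtractf sum_distrib_left sc_mult mult.assoc)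
  also have "(\<Sum>\<nu>\<le>Suc k. sc (c k \<nu>) * w (Suc k - \<nu>) \<nu>) = f * adp k"
    unfolding adp sum_distrib_left
    by (auto simp: top w_def Suc_diff_le mult.assoc sc_left_commute[of f] intro!: sum.cong)
  also have "(\<Sum>\<nu>\<le>k. sc (c k \<nu>) * w (k - \<nu>) (Suc \<nu>)) = adp k * f"
    unfolding adp sum_distrib_right
    by (simp add: w_def mult.assoc power_commutes)
  finally show ?thesis by (simp add: mult.assoc)
qed

definition adn :: "nat \<Rightarrow> 'k" where
  "adn k = adp k * inverse f ^ k"

lemma adn_0 [simp]: "adn 0 = g"
  by (simp add: adn_def adp_def)

lemma adn_Suc: "adn (Suc k) = f * adn k * inverse f - sc (q powi (a + 2 * int k)) * adn k"
proof -
  have "adp k * f * inverse f ^ Suc k = adp k * inverse f ^ k"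
    using f_nonzero by (simp add: mult.assoc) (simp flip: mult.assoc)
  moreover have "f * adp k * inverse f ^ Suc k = f * (adp k * inverse f ^ k) * inverse f"
    by (simp add: mult.assoc power_commutes)
  ultimately show ?thesis
    unfolding adn_def adp_Suc left_diff_distrib by (simp only: mult.assoc)
qed

end

locale q_serre = q_conjugation +
  assumes serre: "adp (nat (1 - a)) = 0"
begin

lemma adn_top: "adn (Suc (nat (- a))) = 0"
proof -
  have "Suc (nat (- a)) = nat (1 - a)" using a_nonpos by simp
  then show ?thesis using serre by (simp add: adn_def)
qed

theorem conjugation_by_power:
  "f powi n * g * f powi (- n) = (\<Sum>k = 0..nat (- a).
     sc (q powi ((int k + a) * (n - int k)) * qbinom q n k) * adp k * inverse f ^ k)"
proof -
  define m where "m = nat (- a)"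
  define c where "c n k = q powi ((int k + a) * (n - int k)) * qbinom q n k" for n k
  define r where "r n = (\<Sum>k\<le>m. sc (c n k) * adn k)" for n
  have c0: "c (n + 1) 0 = q powi a * c n 0" for n
    by (simp add: c_def algebra_simps flip: power_int_add)
  have cS: "c (n + 1) (Suc k) = q powi (a + 2 * int (Suc k)) * c n (Suc k) + c n k" for n k
  proof -
    have e1: "q powi ((int (Suc k) + a) * (n + 1 - int (Suc k))) * q powi (int k + 1)
        = q powi (a + 2 * int (Suc k)) * q powi ((int (Suc k) + a) * (n - int (Suc k)))"
      by (simp add: power_int_add[symmetric] algebra_simps)
    have e2: "q powi ((int (Suc k) + a) * (n + 1 - int (Suc k))) * q powi (- (n - int k))
        = q powi ((int k + a) * (n - int k))"
      by (simp add: power_int_add[symmetric] algebra_simps)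
    have "c (n + 1) (Suc k) =
        (q powi ((int (Suc k) + a) * (n + 1 - int (Suc k))) * q powi (int k + 1)) * qbinom q n (Suc k)
      + (q powi ((int (Suc k) + a) * (n + 1 - int (Suc k))) * q powi (- (n - int k))) * qbinom q n k"
      unfolding c_def qbinom_pascal(2) by (simp only: distrib_left mult.assoc)
    then show ?thesis unfolding e1 e2 by (simp add: c_def)
  qed
  have step: "f * r n * inverse f = r (n + 1)" for n
  proof -
    have "f * (sc (c n k) * adn k) * inverse f
        = sc (c n k) * adn (Suc k) + sc (q powi (a + 2 * int k) * c n k) * adn k" for k
      by (simp add: adn_Suc sc_left_commute[of f] right_diff_distrib mult.assoc sc_mult
          sc_left_commute[of "sc (c n k)"] sc_commute[of "q powi (a + 2 * int k)" "sc (c n k)"])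
    then have "f * r n * inverse f = (\<Sum>k\<le>m. sc (c n k) * adn (Suc k))
        + (\<Sum>k\<le>m. sc (q powi (a + 2 * int k) * c n k) * adn k)"
      by (simp add: r_def sum_distrib_left sum_distrib_right sum.distrib)
    also have "(\<Sum>k\<le>m. sc (c n k) * adn (Suc k)) = (\<Sum>k<m. sc (c n k) * adn (Suc k))"
      using adn_top by (simp add: m_def flip: lessThan_Suc_atMost)
    also have "(\<Sum>k\<le>m. sc (q powi (a + 2 * int k) * c n k) * adn k)
        = sc (q powi a * c n 0) * adn 0
          + (\<Sum>k<m. sc (q powi (a + 2 * int (Suc k)) * c n (Suc k)) * adn (Suc k))"
      unfolding lessThan_Suc_atMost[symmetric] sum.lessThan_Suc_shift by simp
    also have "(\<Sum>k<m. sc (c n k) * adn (Suc k)) + (sc (q powi a * c n 0) * adn 0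
          + (\<Sum>k<m. sc (q powi (a + 2 * int (Suc k)) * c n (Suc k)) * adn (Suc k)))
        = sc (c (n + 1) 0) * adn 0 + (\<Sum>k<m. sc (c (n + 1) (Suc k)) * adn (Suc k))"
      unfolding c0 cS by (simp add: sc_add distrib_right sum.distrib)
    also have "\<dots> = r (n + 1)"
      unfolding r_def lessThan_Suc_atMost[symmetric] sum.lessThan_Suc_shift by simp
    finally show ?thesis .
  qed
  have "f powi n * g * f powi (- n) = r n"
  proof (induction n rule: int_induct[where k = 0])
    case base
    have "c 0 k = 0" if "k \<noteq> 0" for k
      using that by (simp add: c_def qbinom_eq_0)
    then have "r 0 = (\<Sum>k\<le>m. if k = 0 then sc (c 0 0) * adn 0 else 0)"
      unfolding r_def by (intro sum.cong) auto
    then show ?case by (simp add: c_def)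
  next
    case (step1 n)
    have "f powi (n + 1) * g * f powi (- (n + 1)) = f * (f powi n * g * f powi (- n)) * inverse f"
      using f_nonzero power_int_add_1'[of f n] power_int_add_1[of f "- (n + 1)"]
      by (simp add: power_int_diff mult.assoc divide_inverse)
    then show ?case unfolding step1 step .
  next
    case (step2 n)
    have "f powi n * g * f powi (- n)
        = f * (f powi (n - 1) * g * f powi (- (n - 1))) * inverse f"
      using f_nonzero power_int_add_1'[of f "n - 1"] power_int_add_1[of f "- n"]
      by (simp add: mult.assoc divide_inverse)
    then have "f * (f powi (n - 1) * g * f powi (- (n - 1))) * inverse f
        = f * r (n - 1) * inverse f"
      using step2 step[of "n - 1"] by (metis diff_add_cancel)
    then show ?case using f_nonzero by (metis mult_left_cancel mult_right_cancel nonzero_imp_inverse_nonzero)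
  qed
  then show ?thesis
    by (simp add: r_def c_def m_def adn_def mult.assoc atLeast0AtMost)
qed

theorem conjugation_eigenvectors:
  "\<exists>t. g = (\<Sum>m\<in>(\<lambda>k. a + 2 * int k) ` {..nat (- a)}. t m) \<and>
       (\<forall>m. m \<in> (\<lambda>k. a + 2 * int k) ` {..nat (- a)} \<longrightarrow> f * t m = sc (q powi m) * (t m * f))"
proof -
  define l where "l k = q powi (a + 2 * int k)" for k
  define F where "F x y = f * y * inverse f - sc x * y" for x y
  have "foldr F (rev (map l [0..<k])) g = adn k" for k
    by (induction k) (simp_all add: adn_Suc F_def l_def)
  then have "foldr F (rev (map l [0..<Suc (nat (- a))])) g = 0"
    using adn_top by metis
  moreover have "inj l" by (auto simp: l_def q_powi_inj intro: injI)
  then have "distinct (rev (map l [0..<Suc (nat (- a))]))"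
    by (simp add: distinct_map inj_on_subset[OF _ subset_UNIV] del: upt_Suc)
  ultimately obtain t where
    t: "g = (\<Sum>x\<in>set (rev (map l [0..<Suc (nat (- a))])). t x)"
      "\<And>x. x \<in> set (rev (map l [0..<Suc (nat (- a))])) \<Longrightarrow> f * t x = sc x * (t x * f)"
    using eigenvector_decomposition[OF f_nonzero, of "rev (map l [0..<Suc (nat (- a))])" g]
    unfolding F_def by blast
  have set: "set (rev (map l [0..<Suc (nat (- a))]))
      = (\<lambda>m. q powi m) ` (\<lambda>k. a + 2 * int k) ` {..nat (- a)}"
    unfolding image_image l_def set_rev set_map set_upt
    by (simp only: atLeast0LessThan lessThan_Suc_atMost)
  have "inj_on (\<lambda>m. q powi m) A" for A
    by (auto simp: q_powi_inj intro: inj_onI)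
  then have "g = (\<Sum>m\<in>(\<lambda>k. a + 2 * int k) ` {..nat (- a)}. t (q powi m))"
    using t(1) unfolding set by (simp add: sum.reindex[of "\<lambda>m. q powi m"])
  then show ?thesis
    using t(2) unfolding set by (intro exI[of _ "\<lambda>m. t (q powi m)"]) blast
qed

end

section \<open>Words in two letters and eigenvector frames\<close>

definition word :: "'k \<Rightarrow> 'k \<Rightarrow> bool list \<Rightarrow> 'k::monoid_mult" where
  "word f g u = prod_list (map (\<lambda>b. if b then f else g) u)"

lemma word_simps [simp]:
  "word f g [] = 1" "word f g (True # u) = f * word f g u" "word f g (False # u) = g * word f g u"
  by (simp_all add: word_def)

lemma word_swap: "word f g u = word g f (map Not u)"
  by (induction u) (auto simp: word_def)

definition tuples :: "int set \<Rightarrow> nat \<Rightarrow> int list set" where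
  "tuples E n = {w. set w \<subseteq> E \<and> length w = n}"

lemma finite_tuples: "finite E \<Longrightarrow> finite (tuples E n)"
  unfolding tuples_def by (rule finite_lists_length_eq)

lemma tuples_0: "tuples E 0 = {[]}"
  by (auto simp: tuples_def)

lemma tuples_Suc: "tuples E (Suc n) = (\<lambda>(e, w). e # w) ` (E \<times> tuples E n)"
  by (auto simp: tuples_def length_Suc_conv image_iff)

lemma sum_tuples_Suc: "(\<Sum>w\<in>tuples E (Suc n). h w) = (\<Sum>e\<in>E. \<Sum>w\<in>tuples E n. h (e # w))"
  unfolding tuples_Suc sum.cartesian_product
  by (subst sum.reindex) (auto intro!: inj_onI sum.cong)

lemma ball_tuples_Suc: "(\<forall>w\<in>tuples E (Suc n). P w) \<longleftrightarrow> (\<forall>e\<in>E. \<forall>w\<in>tuples E n. P (e # w))"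
  by (auto simp: tuples_Suc)

text \<open>If \<open>g\<close> is the sum of vectors \<open>s e\<close> with \<open>f s\<^sub>e = p\<^sup>e s\<^sub>e f\<close>, then a word in \<open>f, g\<close> is
  expanded by moving all letters \<open>f\<close> to the right.\<close>

fun wcoef :: "'f::field \<Rightarrow> bool list \<Rightarrow> int list \<Rightarrow> 'f" where
  "wcoef p [] w = 1"
| "wcoef p (True # u) w = p powi sum_list w * wcoef p u w"
| "wcoef p (False # u) [] = 0"
| "wcoef p (False # u) (e # w) = wcoef p u w"

definition pcoef :: "'f::field \<Rightarrow> ('f \<times> bool list) list \<Rightarrow> int list \<Rightarrow> 'f" where
  "pcoef p P w = (\<Sum>(c, u)\<leftarrow>P. c * wcoef p u w)"

lemma pcoef_simps [simp]:
  "pcoef p [] w = 0" "pcoef p ((c, u) # P) w = c * wcoef p u w + pcoef p P w"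
  by (simp_all add: pcoef_def)

definition homogeneous :: "nat \<Rightarrow> nat \<Rightarrow> ('f \<times> bool list) list \<Rightarrow> bool" where
  "homogeneous k n P \<longleftrightarrow>
     (\<forall>(c, u)\<in>set P. length (filter id u) = k \<and> length (filter Not u) = n)"

lemma homogeneous_simps [simp]:
  "homogeneous k n []"
  "homogeneous k n ((c, u) # P) \<longleftrightarrow>
     length (filter id u) = k \<and> length (filter Not u) = n \<and> homogeneous k n P"
  by (simp_all add: homogeneous_def)

definition swap_letters :: "('f \<times> bool list) list \<Rightarrow> ('f \<times> bool list) list" where
  "swap_letters P = map (\<lambda>(c, u). (c, map Not u)) P"

context central_scalars
begin

definition peval :: "'k \<Rightarrow> 'k \<Rightarrow> ('f \<times> bool list) list \<Rightarrow> 'k" where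
  "peval f g P = (\<Sum>(c, u)\<leftarrow>P. sc c * word f g u)"

lemma peval_simps [simp]:
  "peval f g [] = 0" "peval f g ((c, u) # P) = sc c * word f g u + peval f g P"
  by (simp_all add: peval_def)

lemma peval_swap: "peval f g P = peval g f (swap_letters P)"
  by (induction P) (auto simp: swap_letters_def word_swap[of f g])

definition expansion :: "int set \<Rightarrow> (int \<Rightarrow> 'k) \<Rightarrow> nat \<Rightarrow> (int list \<Rightarrow> 'f) \<Rightarrow> 'k" where
  "expansion E s n A = (\<Sum>w\<in>tuples E n. sc (A w) * prod_list (map s w))"

context
  fixes f g :: 'k and E :: "int set" and s :: "int \<Rightarrow> 'k" and p :: 'f
  assumes f: "f \<noteq> 0" and p: "p \<noteq> 0" and E: "finite E"
    and g: "g = (\<Sum>e\<in>E. s e)"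
    and s: "\<And>e. e \<in> E \<Longrightarrow> f * s e = sc (p powi e) * (s e * f)"
begin

lemma eigen_product:
  "w \<in> tuples E n \<Longrightarrow>
   f * prod_list (map s w) = sc (p powi sum_list w) * (prod_list (map s w) * f)"
proof (induction w arbitrary: n)
  case (Cons e w)
  then have e: "e \<in> E" and w: "w \<in> tuples E (length w)" by (auto simp: tuples_def)
  let ?v = "prod_list (map s w)"
  have "f * (s e * ?v) = sc (p powi e) * (s e * (f * ?v))"
    by (simp only: s[OF e] mult.assoc flip: mult.assoc[of f "s e"])
  also have "\<dots> = sc (p powi e) * (sc (p powi sum_list w) * (s e * (?v * f)))"
    by (simp only: Cons.IH[OF w] sc_left_commute[of "s e"])
  also have "\<dots> = sc (p powi (e + sum_list w)) * (s e * ?v * f)"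
    using p by (simp add: power_int_add sc_mult mult.assoc)
  finally show ?case by simp
qed simp

lemma expansion_powi:
  "f powi m * expansion E s n A = expansion E s n (\<lambda>w. (p powi m) powi sum_list w * A w) * f powi m"
proof -
  have "f powi m * (sc (A w) * prod_list (map s w))
      = sc ((p powi m) powi sum_list w * A w) * prod_list (map s w) * f powi m"
    if "w \<in> tuples E n" for w
  proof -
    have e: "sc ((p powi m) powi sum_list w * A w) = sc (A w) * sc ((p powi sum_list w) powi m)"
      by (simp add: power_int_mult[symmetric] mult.commute flip: sc_mult)
    have "f powi m * prod_list (map s w)
        = sc ((p powi sum_list w) powi m) * (prod_list (map s w) * f powi m)"
      using powi_eigenvector[OF f eigen_product[OF that], of m] p by simp
    then show ?thesis
      by (simp only: e mult.assoc sc_left_commute[of "f powi m"])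
  qed
  then show ?thesis
    by (simp add: expansion_def sum_distrib_left sum_distrib_right)
qed

lemma word_expansion:
  "word f g u = expansion E s (length (filter Not u)) (wcoef p u) * f ^ length (filter id u)"
proof (induction u)
  case Nil
  then show ?case by (simp add: expansion_def tuples_0)
next
  case (Cons b u)
  let ?n = "length (filter Not u)" and ?k = "length (filter id u)"
  show ?case
  proof (cases b)
    case True
    have "f * (expansion E s ?n (wcoef p u) * f ^ ?k)
        = expansion E s ?n (\<lambda>w. p powi sum_list w * wcoef p u w) * (f * f ^ ?k)"
      using expansion_powi[of 1 ?n "wcoef p u"] by (simp flip: mult.assoc)
    also have "(\<lambda>w. p powi sum_list w * wcoef p u w) = wcoef p (True # u)"
      by (rule ext) simp
    finally show ?thesis using True Cons.IH by simp
  next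
    case False
    have "g * expansion E s ?n (wcoef p u) = expansion E s (Suc ?n) (wcoef p (False # u))"
      unfolding expansion_def sum_tuples_Suc g
      by (simp add: sum_distrib_left sum_distrib_right sc_left_commute[of "s _"] mult.assoc)
        (rule sum.swap)
    then show ?thesis using False Cons.IH by (simp flip: mult.assoc)
  qed
qed

lemma peval_expansion:
  "homogeneous k n P \<Longrightarrow> peval f g P = expansion E s n (pcoef p P) * f ^ k"
proof (induction P)
  case (Cons x P)
  obtain c u where x: "x = (c, u)" by (cases x)
  have "sc c * word f g u = expansion E s n (\<lambda>w. c * wcoef p u w) * f ^ k"
    using Cons.prems word_expansion[of u]
    by (simp add: x expansion_def sum_distrib_left sc_mult flip: mult.assoc)
  then show ?case
    using Cons by (simp add: x expansion_def distrib_right sc_add sum.distrib)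
qed (simp add: expansion_def)

text \<open>Conjugation by \<open>f\<close> separates the homogeneous parts of a linear relation.\<close>

lemma graded_relation:
  assumes "expansion E s n R = 0" and q: "inj (\<lambda>d. p powi d)"
  shows "expansion E s n (\<lambda>w. \<kappa> (sum_list w) * R w) = 0"
proof -
  let ?D = "sum_list ` tuples E n"
  define y where "y d = (\<Sum>w\<in>{w \<in> tuples E n. sum_list w = d}. sc (R w) * prod_list (map s w))" for d
  have fin: "finite (tuples E n)" using E by (rule finite_tuples)
  have group: "expansion E s n (\<lambda>w. c (sum_list w) * R w) = (\<Sum>d\<in>?D. sc (c d) * y d)" for c
  proof -
    have "(\<Sum>d\<in>?D. sc (c d) * y d) = (\<Sum>d\<in>?D. \<Sum>w\<in>{w \<in> tuples E n. sum_list w = d}.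
        sc (c (sum_list w) * R w) * prod_list (map s w))"
      unfolding y_def sum_distrib_left
      by (intro sum.cong) (auto simp: sc_mult mult.assoc)
    also have "\<dots> = expansion E s n (\<lambda>w. c (sum_list w) * R w)"
      unfolding expansion_def by (rule sum.image_gen[OF fin, symmetric])
    finally show ?thesis by simp
  qed
  have "(\<Sum>d\<in>?D. sc ((p powi d) ^ m) * y d) = 0" for m
  proof -
    have "f powi int m * expansion E s n R = 0" using assms(1) by simp
    then have "expansion E s n (\<lambda>w. (p powi int m) powi sum_list w * R w) = 0"
      unfolding expansion_powi using f by simp
    moreover have "(p powi int m) powi d = (p powi d) ^ m" for d
      by (simp add: power_int_mult[symmetric] mult.commute flip: power_int_of_nat)
    ultimately show ?thesis using group[of "\<lambda>d. (p powi d) ^ m"] by simp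
  qed
  then have "y d = 0" if "d \<in> ?D" for d
    using vandermonde[of ?D "\<lambda>d. p powi d" y d] that fin q
    by (simp add: inj_on_subset[OF _ subset_UNIV])
  then show ?thesis unfolding group by simp
qed

lemma frame_conjugation:
  assumes "homogeneous k n P" "homogeneous k n P'" "homogeneous k n R"
    and "peval f g R = 0" and "inj (\<lambda>d. p powi d)"
    and "\<forall>w\<in>tuples E n.
           (p powi m) powi sum_list w * pcoef p P w - pcoef p P' w = \<kappa> (sum_list w) * pcoef p R w"
  shows "f powi m * peval f g P = peval f g P' * f powi m"
proof -
  have R: "expansion E s n (pcoef p R) = 0"
    using assms(4) peval_expansion[OF assms(3)] f by simp
  have "expansion E s n (\<lambda>w. (p powi m) powi sum_list w * pcoef p P w) - expansion E s n (pcoef p P')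
      = expansion E s n (\<lambda>w. \<kappa> (sum_list w) * pcoef p R w)"
    unfolding expansion_def sum_subtractf[symmetric] left_diff_distrib[symmetric] sc_diff[symmetric]
    by (intro sum.cong refl) (simp only: assms(6)[rule_format])
  also have "\<dots> = 0"
    using R assms(5) by (rule graded_relation)
  finally have "f powi m * expansion E s n (pcoef p P) = expansion E s n (pcoef p P') * f powi m"
    unfolding expansion_powi by simp
  moreover have "f powi m * f ^ k = f ^ k * f powi m"
    using f by (simp add: add.commute flip: power_int_of_nat power_int_add)
  ultimately show ?thesis
    unfolding peval_expansion[OF assms(1)] peval_expansion[OF assms(2)]
    by (metis mult.assoc)
qed

end

end

section \<open>Verma relations of types \<open>A\<^sub>2\<close> and \<open>B\<^sub>2\<close>\<close>

lemma int_eq_by_common_factor: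
  fixes l r :: "int \<Rightarrow> 'k::division_ring"
  assumes "l 0 = r 0" and "\<And>b. l b \<noteq> 0"
    and "\<And>b. \<exists>x. l (b + 1) = x * l b \<and> r (b + 1) = x * r b"
  shows "l b = r b"
proof (induction b rule: int_induct[where k = 0])
  case base
  show ?case by (rule assms(1))
next
  case (step1 b)
  then show ?case using assms(3)[of b] by auto
next
  case (step2 b)
  obtain x where x: "l b = x * l (b - 1)" "r b = x * r (b - 1)"
    using assms(3)[of "b - 1"] by auto
  moreover have "x \<noteq> 0" using x(1) assms(2)[of b] by auto
  ultimately show ?case using step2 by simp
qed

abbreviation letters :: "nat list \<Rightarrow> bool list" where
  "letters u \<equiv> map (\<lambda>i. i = 1) u"

definition br :: "'f::field \<Rightarrow> 'f" where
  "br x = x - 1 / x"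

lemma (in generic_q) br_powi_nonzero: "n \<noteq> 0 \<Longrightarrow> br (q ^ n) \<noteq> 0"
proof
  assume n: "n \<noteq> 0" and "br (q ^ n) = 0"
  then have "q ^ n * q ^ n = 1" by (simp add: br_def field_simps)
  then have "q powi int (n + n) = q powi 0" by (simp only: power_int_of_nat power_add) simp
  then show False unfolding q_powi_inj using n by simp
qed

definition pscale :: "'f::field \<Rightarrow> ('f \<times> bool list) list \<Rightarrow> ('f \<times> bool list) list" where
  "pscale k P = map (\<lambda>(c, u). (k * c, u)) P"

definition pmult :: "bool list \<Rightarrow> ('f \<times> bool list) list \<Rightarrow> bool list \<Rightarrow> ('f \<times> bool list) list" where
  "pmult v P v' = map (\<lambda>(c, u). (c, v @ u @ v')) P"

lemma word_append: "word f g (u @ v) = word f g u * word f g v"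
  by (simp add: word_def)

lemma pcoef_append [simp]: "pcoef p (P @ P') w = pcoef p P w + pcoef p P' w"
  by (simp add: pcoef_def)

lemma pcoef_pscale [simp]: "pcoef p (pscale k P) w = k * pcoef p P w"
  by (induction P) (auto simp: pscale_def distrib_left mult.assoc)

lemma swap_letters_simps [simp]:
  "swap_letters [] = []"
  "swap_letters ((c, u) # P) = (c, map Not u) # swap_letters P"
  "swap_letters (P @ P') = swap_letters P @ swap_letters P'"
  "swap_letters (pscale k P) = pscale k (swap_letters P)"
  "swap_letters (pmult v P v') = pmult (map Not v) (swap_letters P) (map Not v')"
  by (auto simp: swap_letters_def pscale_def pmult_def)

lemma homogeneous_append [simp]:
  "homogeneous k n (P @ P') \<longleftrightarrow> homogeneous k n P \<and> homogeneous k n P'"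
  by (auto simp: homogeneous_def)

lemma homogeneous_pscale [simp]: "homogeneous k n (pscale c P) = homogeneous k n P"
  by (auto simp: homogeneous_def pscale_def)

lemma homogeneous_pmult:
  assumes "homogeneous k n P" "k' = k + length (filter id v) + length (filter id v')"
    "n' = n + length (filter Not v) + length (filter Not v')"
  shows "homogeneous k' n' (pmult v P v')"
  using assms by (fastforce simp: homogeneous_def pmult_def)

lemma (in central_scalars) peval_ops:
  "peval f g (P @ P') = peval f g P + peval f g P'"
  "peval f g (pscale k P) = sc k * peval f g P"
  "peval f g (pmult v P v') = word f g v * peval f g P * word f g v'"
proof -
  show "peval f g (P @ P') = peval f g P + peval f g P'"
    by (simp add: peval_def)
  show "peval f g (pscale k P) = sc k * peval f g P"
    by (induction P) (auto simp: pscale_def sc_mult distrib_left mult.assoc)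
  show "peval f g (pmult v P v') = word f g v * peval f g P * word f g v'"
    by (induction P) (auto simp: pmult_def word_append distrib_left distrib_right mult.assoc
        sc_left_commute[of "word f g v"])
qed

lemma (in central_scalars) rescale:
  assumes "sc d * (F * y) = Z * G" "d \<noteq> 0"
  shows "F * (sc k * y) = sc (k / d) * Z * G"
proof -
  have "sc (k / d) * Z * G = sc (k / d) * (sc d * (F * y))"
    by (simp only: assms(1) mult.assoc)
  also have "\<dots> = sc k * (F * y)"
    using assms(2) by (simp flip: mult.assoc sc_mult)
  finally show ?thesis by (simp only: sc_left_commute[of F])
qed

locale rank_two = central_scalars sc + generic_q q
  for sc :: "'f::field \<Rightarrow> 'k::division_ring" and q :: 'f +
  fixes f1 f2 :: 'k and r :: int and M :: "int set" and s t :: "int \<Rightarrow> 'k"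
  assumes f1: "f1 \<noteq> 0" and f2: "f2 \<noteq> 0" and r: "r \<noteq> 0" and M: "finite M"
    and s_sum: "f2 = (\<Sum>e\<in>{-1, 1}. s e)"
    and s_eigen: "\<And>e. e \<in> {-1, 1} \<Longrightarrow> f1 * s e = sc ((q powi r) powi e) * (s e * f1)"
    and t_sum: "f1 = (\<Sum>m\<in>M. t m)"
    and t_eigen: "\<And>m. m \<in> M \<Longrightarrow> f2 * t m = sc (q powi m) * (t m * f2)"
begin

abbreviation poly where "poly \<equiv> peval f1 f2"

lemma conj_f1:
  assumes "homogeneous k n P" "homogeneous k n P'" "homogeneous k n R" "poly R = 0"
    and "\<forall>w\<in>tuples {-1, 1} n. ((q powi r) powi m) powi sum_list w * pcoef (q powi r) P w
           - pcoef (q powi r) P' w = \<kappa> (sum_list w) * pcoef (q powi r) R w"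
  shows "f1 powi m * poly P = poly P' * f1 powi m"
proof (rule frame_conjugation[OF f1 _ _ s_sum s_eigen])
  show "inj (\<lambda>d. (q powi r) powi d)"
    using r by (auto simp: q_powi_inj power_int_mult[symmetric] intro: injI)
qed (use assms in auto)

lemma conj_f2:
  assumes "homogeneous k n (swap_letters P)" "homogeneous k n (swap_letters P')"
    and "homogeneous k n (swap_letters R)" and "poly R = 0"
    and "\<forall>w\<in>tuples M n. (q powi m) powi sum_list w * pcoef q (swap_letters P) w
           - pcoef q (swap_letters P') w = \<kappa> (sum_list w) * pcoef q (swap_letters R) w"
  shows "f2 powi m * poly P = poly P' * f2 powi m"
  unfolding peval_swap[of f1 f2]
proof (rule frame_conjugation[OF f2 _ _ t_sum t_eigen])
  show "inj (\<lambda>d. q powi d)"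
    by (auto simp: q_powi_inj intro: injI)
qed (use assms M in \<open>auto simp: peval_swap[of f1 f2]\<close>)

lemma powi_succ: "f1 powi (n + 1) = f1 powi n * f1" "f2 powi (n + 1) = f2 powi n * f2"
  using f1 f2 by (simp_all add: power_int_add_1)

end

lemma ball_tuples:
  "(\<forall>w\<in>tuples E (Suc 0). P w) \<longleftrightarrow> (\<forall>a\<in>E. P [a])"
  "(\<forall>w\<in>tuples E 2. P w) \<longleftrightarrow> (\<forall>a\<in>E. \<forall>b\<in>E. P [a, b])"
  "(\<forall>w\<in>tuples E 3. P w) \<longleftrightarrow> (\<forall>a\<in>E. \<forall>b\<in>E. \<forall>c\<in>E. P [a, b, c])"
  "(\<forall>w\<in>tuples E 4. P w) \<longleftrightarrow> (\<forall>a\<in>E. \<forall>b\<in>E. \<forall>c\<in>E. \<forall>d\<in>E. P [a, b, c, d])"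
  by (simp_all add: ball_tuples_Suc tuples_0 numeral_eq_Suc)

lemmas frame_simps = ball_tuples power_int_minus pmult_def

text \<open>In the polynomials below, \<open>B\<close>, \<open>C\<close>, \<open>D\<close>, \<open>N\<close> stand for powers of \<open>q\<close> with integral exponents.
  Each polynomial arises from the previous one by conjugation with a power of \<open>f1\<close> or \<open>f2\<close>.\<close>

definition a2_poly :: "'f::field \<Rightarrow> 'f \<Rightarrow> ('f \<times> bool list) list" where
  "a2_poly q B = [(q * B - 1 / (q * B), letters [2, 1]), (1 / B - B, letters [1, 2])]"

locale rank_two_A2 = rank_two sc q f1 f2 1 "{-1, 1}" s t
  for sc :: "'f::field \<Rightarrow> 'k::division_ring" and q f1 f2 s t
begin

lemma a2_step1:
  "sc (q - 1 / q) * (f2 powi (n + 1) * f1) = poly (a2_poly q (q powi n)) * f2 powi n"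
proof -
  have "f2 powi n * poly [(q - 1 / q, letters [2, 1])] = poly (a2_poly q (q powi n)) * f2 powi n"
  proof (rule conj_f2[where n = 1 and k = 1 and R = "[]" and \<kappa> = "\<lambda>_. 0"])
    define B where "B = q powi n"
    have "B \<noteq> 0" by (simp add: B_def)
    then show "\<forall>w\<in>tuples {-1, 1} 1. (q powi n) powi sum_list w
        * pcoef q (swap_letters [(q - 1 / q, letters [2, 1])]) w
        - pcoef q (swap_letters (a2_poly q (q powi n))) w = 0 * pcoef q (swap_letters []) w"
      unfolding B_def[symmetric] a2_poly_def
      by (simp add: frame_simps divide_simps; intro conjI; Groebner_Basis.algebra)
  qed (simp_all add: a2_poly_def)
  then show ?thesis by (simp add: powi_succ mult.assoc sc_left_commute[of "_ powi _"])
qed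

lemma a2_step2:
  "f1 powi a * poly (a2_poly q (q powi (a + b))) = poly (a2_poly q (q powi b)) * f1 powi a"
proof (rule conj_f1[where n = 1 and k = 1 and R = "[]" and \<kappa> = "\<lambda>_. 0"])
  define A B where "A = q powi a" and "B = q powi b"
  have *: "A \<noteq> 0" "B \<noteq> 0" "q powi (a + b) = A * B" by (simp_all add: A_def B_def power_int_add)
  show "\<forall>w\<in>tuples {-1, 1} 1. ((q powi 1) powi a) powi sum_list w
      * pcoef (q powi 1) (a2_poly q (q powi (a + b))) w
      - pcoef (q powi 1) (a2_poly q (q powi b)) w = 0 * pcoef (q powi 1) [] w"
    unfolding *(3) power_int_1_right A_def[symmetric] B_def[symmetric] a2_poly_def
    using *(1,2)
    by (simp add: frame_simps divide_simps; intro conjI; Groebner_Basis.algebra)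
qed (simp_all add: a2_poly_def)

theorem verma_A2:
  "f1 powi a * f2 powi (a + b) * f1 powi b = f2 powi b * f1 powi (a + b) * f2 powi a"
proof (rule int_eq_by_common_factor[where b = b])
  show "f1 powi a * f2 powi (a + b) * f1 powi b \<noteq> 0" for b
    using f1 f2 by simp
  define x where "x b = sc (inverse (q - 1 / q)) * poly (a2_poly q (q powi b))" for b
  have comm: "f1 powi (n + 1) = f1 * f1 powi n" for n
    using f1 by (simp add: power_int_add_1')
  have "q - 1 / q \<noteq> 0"
    using qnum_denominator_nonzero by (simp add: divide_inverse)
  then have "y = sc (inverse (q - 1 / q)) * (sc (q - 1 / q) * y)" for y
    by (simp flip: mult.assoc sc_mult)
  then have 1: "f2 powi (n + 1) * f1 = x n * f2 powi n" for n
    using a2_step1[of n] by (metis mult.assoc x_def)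
  have 2: "f1 powi a * x (a + b) = x b * f1 powi a" for b
    unfolding x_def sc_left_commute[of "f1 powi a"] a2_step2 mult.assoc ..
  show "\<exists>x. f1 powi a * f2 powi (a + (b + 1)) * f1 powi (b + 1)
          = x * (f1 powi a * f2 powi (a + b) * f1 powi b) \<and>
        f2 powi (b + 1) * f1 powi (a + (b + 1)) * f2 powi a
          = x * (f2 powi b * f1 powi (a + b) * f2 powi a)" for b
  proof (intro exI conjI)
    have "f1 powi a * f2 powi (a + (b + 1)) * f1 powi (b + 1)
        = f1 powi a * (f2 powi (a + b + 1) * f1) * f1 powi b"
      by (simp only: comm mult.assoc add.assoc)
    also have "\<dots> = (f1 powi a * x (a + b)) * (f2 powi (a + b) * f1 powi b)"
      unfolding 1 by (simp only: mult.assoc)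
    finally show "f1 powi a * f2 powi (a + (b + 1)) * f1 powi (b + 1)
        = x b * (f1 powi a * f2 powi (a + b) * f1 powi b)"
      unfolding 2 by (simp only: mult.assoc)
    have "f2 powi (b + 1) * f1 powi (a + (b + 1)) * f2 powi a
        = (f2 powi (b + 1) * f1) * f1 powi (a + b) * f2 powi a"
      by (simp only: comm mult.assoc add.assoc[symmetric])
    then show "f2 powi (b + 1) * f1 powi (a + (b + 1)) * f2 powi a
        = x b * (f2 powi b * f1 powi (a + b) * f2 powi a)"
      unfolding 1 by (simp only: mult.assoc)
  qed
qed simp

end

definition b2_poly1 :: "'f::field \<Rightarrow> 'f \<Rightarrow> ('f \<times> bool list) list" where
  "b2_poly1 q C = [(br (q^2 * C^2), letters [1, 2]), (- br (C^2), letters [2, 1])]"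

definition b2_poly2 :: "'f::field \<Rightarrow> 'f \<Rightarrow> 'f \<Rightarrow> ('f \<times> bool list) list" where
  "b2_poly2 q C N =
     [(br (q^2 * C^2) * (br N * br (N / q)) - br (C^2) * (br (q * N) * br N), letters [1, 2, 2]),
      ((q + 1 / q) * (br (C^2) * (br (q^2 * N) * br N) - br (q^2 * C^2) * (br (q * N) * br (N / q))),
       letters [2, 1, 2]),
      (br (q^2 * C^2) * (br (q * N) * br N) - br (C^2) * (br (q^2 * N) * br (q * N)), letters [2, 2, 1])]"

locale rank_two_B2 = rank_two sc q f1 f2 2 "{-2, 0, 2}" s t
  for sc :: "'f::field \<Rightarrow> 'k::division_ring" and q f1 f2 s t
begin

lemma b2_step1:
  "sc (br (q^2)) * (f1 powi (c + 1) * f2) = poly (b2_poly1 q (q powi c)) * f1 powi c"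
proof -
  have "f1 powi c * poly [(br (q^2), letters [1, 2])] = poly (b2_poly1 q (q powi c)) * f1 powi c"
  proof (rule conj_f1[where n = 1 and k = 1 and R = "[]" and \<kappa> = "\<lambda>_. 0"])
    define C where "C = q powi c"
    have C: "C \<noteq> 0" "(q powi 2) powi c = C ^ 2"
      by (simp_all add: C_def power_int_mult[symmetric] mult.commute flip: power_int_numeral)
    show "\<forall>w\<in>tuples {-1, 1} 1. ((q powi 2) powi c) powi sum_list w
        * pcoef (q powi 2) [(br (q^2), letters [1, 2])] w
        - pcoef (q powi 2) (b2_poly1 q (q powi c)) w = 0 * pcoef (q powi 2) [] w"
      unfolding C(2) C_def[symmetric] b2_poly1_def br_def
      using C(1) by (simp add: frame_simps divide_simps; intro conjI; Groebner_Basis.algebra)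
  qed (simp_all add: b2_poly1_def)
  then show ?thesis by (simp add: powi_succ mult.assoc sc_left_commute[of "_ powi _"])
qed

lemma b2_step2:
  "sc (br q * br (q^2)) * (f2 powi (n + 1) * poly (b2_poly1 q C))
     = poly (b2_poly2 q C (q powi n)) * f2 powi n" if C: "C \<noteq> 0"
proof -
  have "f2 powi n * poly (pscale (br q * br (q^2)) (pmult [False] (b2_poly1 q C) []))
      = poly (b2_poly2 q C (q powi n)) * f2 powi n"
  proof (rule conj_f2[where n = 1 and k = 2 and R = "[]" and \<kappa> = "\<lambda>_. 0"])
    define N where "N = q powi n"
    have N: "N \<noteq> 0" by (simp add: N_def)
    show "\<forall>w\<in>tuples {-2, 0, 2} 1. (q powi n) powi sum_list w
        * pcoef q (swap_letters (pscale (br q * br (q^2)) (pmult [False] (b2_poly1 q C) []))) w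
        - pcoef q (swap_letters (b2_poly2 q C (q powi n))) w = 0 * pcoef q (swap_letters []) w"
      unfolding N_def[symmetric] b2_poly1_def b2_poly2_def br_def
      using C N by (simp add: frame_simps divide_simps; intro conjI; Groebner_Basis.algebra)
  qed (simp_all add: b2_poly1_def b2_poly2_def pmult_def)
  then show ?thesis by (simp add: peval_ops powi_succ mult.assoc sc_left_commute[of "_ powi _"])
qed

lemma b2_step3:
  "f1 powi a * poly (b2_poly2 q (q powi (a + b)) (q powi (2 * a + b)))
     = poly (b2_poly2 q (q powi (a + b)) (q powi b)) * f1 powi a"
proof (rule conj_f1[where n = 2 and k = 1 and R = "[]" and \<kappa> = "\<lambda>_. 0"])
  define A B where "A = q powi a" and "B = q powi b"
  have *: "A \<noteq> 0" "B \<noteq> 0" "q powi (a + b) = A * B" "q powi (2 * a + b) = A^2 * B"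
      "(q powi 2) powi a = A ^ 2"
    by (simp_all add: A_def B_def power_int_add power_int_mult[symmetric] mult.commute
        flip: power_int_numeral)
  show "\<forall>w\<in>tuples {-1, 1} 2. ((q powi 2) powi a) powi sum_list w
      * pcoef (q powi 2) (b2_poly2 q (q powi (a + b)) (q powi (2 * a + b))) w
      - pcoef (q powi 2) (b2_poly2 q (q powi (a + b)) (q powi b)) w = 0 * pcoef (q powi 2) [] w"
    unfolding *(3-5) B_def[symmetric] b2_poly2_def br_def
    using *(1,2)
    by (simp add: frame_simps divide_simps; intro conjI; Groebner_Basis.algebra)
qed (simp_all add: b2_poly2_def)

theorem verma_B2:
  "f1 powi a * f2 powi (2 * a + b) * f1 powi (a + b) * f2 powi b
     = f2 powi b * f1 powi (a + b) * f2 powi (2 * a + b) * f1 powi a"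
proof (rule int_eq_by_common_factor[where b = b])
  show "f1 powi a * f2 powi (2 * a + b) * f1 powi (a + b) * f2 powi b \<noteq> 0" for b
    using f1 f2 by simp
  have br: "br q \<noteq> 0" "br (q^2) \<noteq> 0"
    using br_powi_nonzero[of 1] br_powi_nonzero[of 2] by simp_all
  define k1 where "k1 c = sc (1 / br (q^2)) * poly (b2_poly1 q (q powi c))" for c
  define k2 where "k2 c n = sc (1 / br (q^2) / (br q * br (q^2)))
    * poly (b2_poly2 q (q powi c) (q powi n))" for c n
  have 1: "f1 powi (c + 1) * f2 = k1 c * f1 powi c" for c
    using rescale[OF b2_step1 br(2), of c 1] by (simp add: k1_def)
  have 2: "f2 powi (n + 1) * k1 c = k2 c n * f2 powi n" for c n
    using rescale[OF b2_step2, of "q powi c" n "1 / br (q^2)"] br by (simp add: k1_def k2_def)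
  have 3: "f1 powi a * k2 (a + b) (2 * a + b) = k2 (a + b) b * f1 powi a" for b
    unfolding k2_def sc_left_commute[of "f1 powi a"] b2_step3 mult.assoc ..
  have comm: "f1 powi (n + 1) = f1 * f1 powi n" "f2 powi (n + 1) = f2 * f2 powi n" for n
    using f1 f2 by (simp_all add: power_int_add_1')
  show "\<exists>x. f1 powi a * f2 powi (2 * a + (b + 1)) * f1 powi (a + (b + 1)) * f2 powi (b + 1)
          = x * (f1 powi a * f2 powi (2 * a + b) * f1 powi (a + b) * f2 powi b) \<and>
        f2 powi (b + 1) * f1 powi (a + (b + 1)) * f2 powi (2 * a + (b + 1)) * f1 powi a
          = x * (f2 powi b * f1 powi (a + b) * f2 powi (2 * a + b) * f1 powi a)" for b
  proof (intro exI conjI)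
    have "f1 powi a * f2 powi (2 * a + (b + 1)) * f1 powi (a + (b + 1)) * f2 powi (b + 1)
        = f1 powi a * (f2 powi (2 * a + b + 1) * (f1 powi (a + b + 1) * f2)) * f2 powi b"
      by (simp only: comm(2)[of b] mult.assoc add.assoc)
    also have "\<dots> = f1 powi a * (f2 powi (2 * a + b + 1) * k1 (a + b)) * (f1 powi (a + b) * f2 powi b)"
      by (simp only: 1 mult.assoc)
    also have "\<dots> = (f1 powi a * k2 (a + b) (2 * a + b)) * (f2 powi (2 * a + b) * f1 powi (a + b) * f2 powi b)"
      by (simp only: 2 mult.assoc)
    finally show "f1 powi a * f2 powi (2 * a + (b + 1)) * f1 powi (a + (b + 1)) * f2 powi (b + 1)
        = k2 (a + b) b * (f1 powi a * f2 powi (2 * a + b) * f1 powi (a + b) * f2 powi b)"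
      by (simp only: 3 mult.assoc)
    have "f2 powi (b + 1) * f1 powi (a + (b + 1)) * f2 powi (2 * a + (b + 1)) * f1 powi a
        = f2 powi (b + 1) * (f1 powi (a + b + 1) * f2) * f2 powi (2 * a + b) * f1 powi a"
      by (simp only: comm(2)[of "2 * a + b"] mult.assoc add.assoc[symmetric])
    also have "\<dots> = (f2 powi (b + 1) * k1 (a + b)) * (f1 powi (a + b) * f2 powi (2 * a + b) * f1 powi a)"
      by (simp only: 1 mult.assoc)
    finally show "f2 powi (b + 1) * f1 powi (a + (b + 1)) * f2 powi (2 * a + (b + 1)) * f1 powi a
        = k2 (a + b) b * (f2 powi b * f1 powi (a + b) * f2 powi (2 * a + b) * f1 powi a)"
      by (simp only: 2 mult.assoc)
  qed
qed simp

end

lemma wcoef_snoc: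
  assumes "p \<noteq> 0"
  shows "length w = length (filter Not u) \<Longrightarrow>
    wcoef p (u @ [False]) (w @ [e]) = p powi (int (length (filter id u)) * e) * wcoef p u w"
proof (induction u arbitrary: w)
  case (Cons b u)
  show ?case
  proof (cases b)
    case True
    then show ?thesis
      using Cons by (simp add: power_int_add[OF disjI1[OF assms]] distrib_right)
  next
    case False
    then obtain x w' where "w = x # w'" using Cons.prems by (cases w) auto
    then show ?thesis using False Cons by simp
  qed
qed simp

lemma pcoef_pmult:
  "pcoef p (pmult [True] P []) w = p powi sum_list w * pcoef p P w"
  "pcoef p (pmult [False] P []) (e # w) = pcoef p P w"
  by (induction P) (auto simp: pmult_def algebra_simps)

lemma pcoef_pmult_right:
  assumes "homogeneous k n P" "length w = n"
  shows "pcoef p (pmult [] P [True]) w = pcoef p P w"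
    and "p \<noteq> 0 \<Longrightarrow> pcoef p (pmult [] P [False]) (w @ [e]) = p powi (int k * e) * pcoef p P w"
proof -
  have *: "length w = length (filter Not u) \<Longrightarrow> wcoef p (u @ [True]) w = wcoef p u w" for u
    by (induction p u w rule: wcoef.induct) auto
  show "pcoef p (pmult [] P [True]) w = pcoef p P w"
    using assms by (induction P) (auto simp: pmult_def *)
  show "pcoef p (pmult [] P [False]) (w @ [e]) = p powi (int k * e) * pcoef p P w" if "p \<noteq> 0"
    using assms by (induction P) (auto simp: pmult_def wcoef_snoc[OF that] distrib_left)
qed

section \<open>Verma relations of type \<open>G\<^sub>2\<close>\<close>

fun wdeg :: "bool list \<Rightarrow> int list \<Rightarrow> int" where
  "wdeg [] w = 0"
| "wdeg (True # u) w = sum_list w + wdeg u w"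
| "wdeg (False # u) w = wdeg u (tl w)"

text \<open>The shift \<open>N\<close> clears denominators; it has to be at least every \<open>- r * wdeg u w\<close> that occurs.\<close>

definition ncoef :: "'f::field \<Rightarrow> int \<Rightarrow> nat \<Rightarrow> ('f \<times> bool list) list \<Rightarrow> int list \<Rightarrow> 'f" where
  "ncoef q r N P w = (\<Sum>(c, u)\<leftarrow>P. c * q ^ nat (int N + r * wdeg u w))"

lemma ncoef_simps:
  "ncoef q r N [] w = 0"
  "ncoef q r N ((c, u) # P) w = c * q ^ nat (int N + r * wdeg u w) + ncoef q r N P w"
  by (simp_all add: ncoef_def)

lemma wcoef_wdeg:
  "p \<noteq> 0 \<Longrightarrow> length w = length (filter Not u) \<Longrightarrow> wcoef p u w = p powi wdeg u w"
  by (induction p u w rule: wcoef.induct) (auto simp: power_int_add)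

lemma pcoef_ncoef:
  assumes q: "q \<noteq> 0" and P: "homogeneous k (length w) P"
    and N: "\<forall>(c, u)\<in>set P. 0 \<le> int N + r * wdeg u w"
  shows "pcoef (q powi r) P w = ncoef q r N P w / q ^ N"
  using P N
proof (induction P)
  case (Cons x P)
  obtain c u where x: "x = (c, u)" by (cases x)
  have "q ^ nat (int N + r * wdeg u w) = q powi (int N + r * wdeg u w)"
    using Cons.prems by (simp add: x power_int_def)
  also have "\<dots> = q ^ N * (q powi r) powi wdeg u w"
    using q by (simp add: power_int_add power_int_mult)
  finally have "wcoef (q powi r) u w = q ^ nat (int N + r * wdeg u w) / q ^ N"
    using q Cons.prems by (simp add: x wcoef_wdeg field_simps)
  then show ?case using Cons by (simp add: x ncoef_simps add_divide_distrib)
qed (simp add: ncoef_def)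

lemma graded_ratio:
  fixes \<Delta> \<rho> :: "int list \<Rightarrow> 'f::field"
  assumes "\<forall>w\<in>T. (\<rho> (z (sum_list w)) \<noteq> 0 \<and> \<Delta> w * \<rho> (z (sum_list w)) = \<Delta> (z (sum_list w)) * \<rho> w)
      \<or> (\<Delta> w = 0 \<and> \<rho> w = 0)"
  shows "\<forall>w\<in>T. \<Delta> w = (\<lambda>d. \<Delta> (z d) / \<rho> (z d)) (sum_list w) * \<rho> w"
proof
  fix w assume "w \<in> T"
  then consider "\<rho> (z (sum_list w)) \<noteq> 0" "\<Delta> w * \<rho> (z (sum_list w)) = \<Delta> (z (sum_list w)) * \<rho> w"
    | "\<Delta> w = 0" "\<rho> w = 0"
    using assms by blast
  then show "\<Delta> w = (\<lambda>d. \<Delta> (z d) / \<rho> (z d)) (sum_list w) * \<rho> w"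
    by cases (simp_all add: field_simps)
qed

context rank_two
begin

lemma poly_eq_0_f1:
  assumes "homogeneous k n P" "\<forall>w\<in>tuples {-1, 1} n. pcoef (q powi r) P w = 0"
  shows "poly P = 0"
proof -
  have "poly P = expansion {-1, 1} s n (pcoef (q powi r) P) * f1 ^ k"
    using assms(1) by (intro peval_expansion[OF f1 _ _ s_sum s_eigen]) auto
  then show ?thesis using assms(2) by (simp add: expansion_def)
qed

lemma poly_eq_0_f2:
  assumes "homogeneous k n (swap_letters P)" "\<forall>w\<in>tuples M n. pcoef q (swap_letters P) w = 0"
  shows "poly P = 0"
proof -
  have "poly P = expansion M t n (pcoef q (swap_letters P)) * f2 ^ k"
    unfolding peval_swap[of f1 f2]
    using assms(1) M by (intro peval_expansion[OF f2 _ _ t_sum t_eigen]) auto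
  then show ?thesis using assms(2) by (simp add: expansion_def)
qed

end

definition g2_poly1 :: "'f::field \<Rightarrow> 'f \<Rightarrow> ('f \<times> bool list) list" where
  "g2_poly1 q C = [(br (q^3 * C^3), letters [1, 2]), (- br (C^3), letters [2, 1])]"

definition g2_poly2 :: "'f::field \<Rightarrow> 'f \<Rightarrow> 'f \<Rightarrow> ('f \<times> bool list) list" where
  "g2_poly2 q C N =
     [(br (C^3) * (br (q^2 * N) * br (q * N) * br N)
       - br (q^3 * C^3) * (br (q * N) * br N * br (N / q)), letters [1, 2, 2, 2]),
      ((q^2 + 1 + 1 / q^2) * (br (q^3 * C^3) * (br (q^2 * N) * br N * br (N / q))
       - br (C^3) * (br (q^3 * N) * br (q * N) * br N)), letters [2, 1, 2, 2]),
      ((q^2 + 1 + 1 / q^2) * (br (C^3) * (br (q^3 * N) * br (q^2 * N) * br N)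
       - br (q^3 * C^3) * (br (q^2 * N) * br (q * N) * br (N / q))), letters [2, 2, 1, 2]),
      (br (q^3 * C^3) * (br (q^2 * N) * br (q * N) * br N)
       - br (C^3) * (br (q^3 * N) * br (q^2 * N) * br (q * N)), letters [2, 2, 2, 1])]"

definition g2_poly3 :: "'f::field \<Rightarrow> 'f \<Rightarrow> 'f \<Rightarrow> ('f \<times> bool list) list" where
  "g2_poly3 q C D =
     pscale ((q^3 + 1 / q^3) * br (q^3 * D^3)) (pmult [True] (g2_poly2 q C (C * D)) []) @
     pscale (- (q^3 + 1 / q^3) * br (D^3)) (pmult [] (g2_poly2 q C (C * D)) [True]) @
     pscale (br q * br (q^2) * br (q^3) * br (D^3) * br (q^3 * D^3))
       [(1, letters [1, 1, 2, 2, 2]), (- (q^3 + 1 / q^3), letters [1, 2, 2, 2, 1]),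
        (1, letters [2, 2, 2, 1, 1])]"

text \<open>Modulo the Serre relations the words of degree \<open>(2, 4)\<close> are dependent. The coefficients
  below belong to the nine products of two words from \<open>122\<close>, \<open>212\<close>, \<open>221\<close>; they solve a linear
  system over \<open>\<rat>(q, C, D)\<close>. The parameters \<open>C\<close> and \<open>D\<close> are squares of powers of \<open>q\<close>.\<close>

definition g2_poly4 :: "'f::field \<Rightarrow> 'f \<Rightarrow> 'f \<Rightarrow> ('f \<times> bool list) list" where
  "g2_poly4 q C D =
      [(q^6*D^6 - q^6*D^3 + q^6*C*D - q^6*C*D^4 + q^8*C^2*D^2 - q^8*C^2*D^5 - q^8*C^3
        + (q^8 + q^12)*C^3*D^3 - q^12*C^3*D^6 - q^12*C^4*D + q^12*C^4*D^4 - q^14*C^5*D^2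
        + q^14*C^5*D^5 + q^14*C^6 - q^14*C^6*D^3,
        letters [1, 2, 2, 1, 2, 2]),
       ((q^3 + q^5 + q^7 + q^9)*D^3 - (q^7 + q^9)*D^6 - (q^3 + q^5 + q^7 + q^9)*C*D
        - (q^5 + q^7)*C*D^4 + (q^7 + q^9)*C^2*D^2 + (q^5 + q^7 + q^9 + q^11)*C^2*D^5
        + (q^5 + q^7)*C^3 - (q^5 + q^7 + 2*q^9 + 2*q^11 + q^13 + q^15)*C^3*D^3
        + (q^13 + q^15)*C^3*D^6 + (q^9 + q^11 + q^13 + q^15)*C^4*D + (q^11 + q^13)*C^4*D^4
        - (q^13 + q^15)*C^5*D^2 - (q^11 + q^13 + q^15 + q^17)*C^5*D^5 - (q^11 + q^13)*C^6
        + (q^11 + q^13 + q^15 + q^17)*C^6*D^3,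
        letters [1, 2, 2, 2, 1, 2]),
       (q^10*D^6 - (q^6 + q^8)*D^3 + q^6*C*D + (q^8 + q^10)*C*D^4 + q^8*C^2*D^2
        - (q^8 + q^10 + q^12 + q^14)*C^2*D^5 + (q^6 + q^8 - 2*q^10 + q^12 + q^14)*C^3*D^3
        - (q^6 + q^8 + q^10 + q^12)*C^4*D + q^12*C^4*D^4 + (q^10 + q^12)*C^5*D^2
        + q^14*C^5*D^5 + q^10*C^6 - (q^12 + q^14)*C^6*D^3,
        letters [1, 2, 2, 2, 2, 1]),
       ((q^7 + q^9)*D^3 - (q^7 + q^9)*D^6 - (q^3 + q^5 + q^7 + q^9)*C*D
        + (q^3 + q^5 + q^7 + q^9)*C*D^4 + (q^7 + q^9)*C^2*D^2 - (q^7 + q^9)*C^2*D^5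
        + (q^5 + q^7 + q^9 + q^11)*C^3 - (q^5 + q^7 + 2*q^9 + 2*q^11 + q^13 + q^15)*C^3*D^3
        + (q^9 + q^11 + q^13 + q^15)*C^3*D^6 - (q^11 + q^13)*C^4*D + (q^11 + q^13)*C^4*D^4
        + (q^11 + q^13 + q^15 + q^17)*C^5*D^2 - (q^11 + q^13 + q^15 + q^17)*C^5*D^5
        - (q^11 + q^13)*C^6 + (q^11 + q^13)*C^6*D^3,
        letters [2, 1, 2, 1, 2, 2]),
       ((q^8 + 2*q^10 + q^12)*D^6 - (q^2 + 2*q^4 + 2*q^6 + 2*q^8 + 2*q^10 + q^12)*D^3
        + (1 + 2*q^2 + 3*q^4 + 4*q^6 + 3*q^8 + 2*q^10 + q^12)*C*D + (q^8 + q^10)*C*D^4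
        - (q^2 + 3*q^4 + 4*q^6 + 4*q^8 + 4*q^10 + 3*q^12 + q^14)*C^2*D^2
        + (q^10 + q^12)*C^2*D^5 - (q^2 + 2*q^4 + 2*q^6 + 2*q^8 + 2*q^10 + q^12)*C^3
        + (q^2 + 2*q^4 + 3*q^6 + 6*q^8 + 8*q^10 + 6*q^12 + 3*q^14 + 2*q^16 + q^18)*C^3*D^3
        - (q^8 + 2*q^10 + 2*q^12 + 2*q^14 + 2*q^16 + q^18)*C^3*D^6 + (q^8 + q^10)*C^4*D
        - (q^6 + 3*q^8 + 4*q^10 + 4*q^12 + 4*q^14 + 3*q^16 + q^18)*C^4*D^4
        + (q^10 + q^12)*C^5*D^2
        + (q^8 + 2*q^10 + 3*q^12 + 4*q^14 + 3*q^16 + 2*q^18 + q^20)*C^5*D^5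
        + (q^8 + 2*q^10 + q^12)*C^6
        - (q^8 + 2*q^10 + 2*q^12 + 2*q^14 + 2*q^16 + q^18)*C^6*D^3,
        letters [2, 1, 2, 2, 1, 2]),
       ((q^5 + q^7 + q^9 + q^11)*D^3 - (q^11 + q^13)*D^6 - (q^3 + q^5 + q^7 + q^9)*C*D
        - (q^11 + q^13)*C*D^4 + (q^7 + q^9)*C^2*D^2 + (q^11 + q^13 + q^15 + q^17)*C^2*D^5
        + (q^7 + q^9)*C^3 - (q^5 + q^7 + 2*q^9 + 2*q^11 + q^13 + q^15)*C^3*D^3
        + (q^11 + q^13)*C^3*D^6 + (q^3 + q^5 + q^7 + q^9)*C^4*D + (q^11 + q^13)*C^4*D^4
        - (q^7 + q^9)*C^5*D^2 - (q^11 + q^13 + q^15 + q^17)*C^5*D^5 - (q^7 + q^9)*C^6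
        + (q^9 + q^11 + q^13 + q^15)*C^6*D^3,
        letters [2, 1, 2, 2, 2, 1]),
       ((q^6 + q^8)*D^3 + q^10*D^6 - (q^4 + q^6 + q^8)*C*D - (q^6 + 2*q^8 + 2*q^10 + q^12)*C*D^4
        + (q^4 + 2*q^6 + 3*q^8 + 2*q^10 + q^12)*C^2*D^2
        - (q^6 + q^8 + 2*q^10 + q^12 + q^14)*C^3*D^3
        + (q^8 + 2*q^10 + 3*q^12 + 2*q^14 + q^16)*C^4*D^4
        - (q^8 + 2*q^10 + 2*q^12 + q^14)*C^5*D^2 - (q^12 + q^14 + q^16)*C^5*D^5 + q^10*C^6
        + (q^12 + q^14)*C^6*D^3,
        letters [2, 2, 1, 1, 2, 2]),
       ((q^5 + q^7)*D^3 - (q^11 + q^13)*D^6 - (q^3 + q^5 + q^7 + q^9)*C*D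
        + (q^9 + q^11 + q^13 + q^15)*C*D^4 + (q^7 + q^9)*C^2*D^2 - (q^13 + q^15)*C^2*D^5
        + (q^3 + q^5 + q^7 + q^9)*C^3 - (q^5 + q^7 + 2*q^9 + 2*q^11 + q^13 + q^15)*C^3*D^3
        + (q^11 + q^13 + q^15 + q^17)*C^3*D^6 - (q^5 + q^7)*C^4*D + (q^11 + q^13)*C^4*D^4
        + (q^5 + q^7 + q^9 + q^11)*C^5*D^2 - (q^11 + q^13 + q^15 + q^17)*C^5*D^5
        - (q^7 + q^9)*C^6 + (q^13 + q^15)*C^6*D^3,
        letters [2, 2, 1, 2, 1, 2]),
       (q^14*D^6 - q^8*D^3 + q^6*C*D - q^12*C*D^4 + q^8*C^2*D^2 - q^14*C^2*D^5 - q^6*C^3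
        + (q^8 + q^12)*C^3*D^3 - q^14*C^3*D^6 - q^6*C^4*D + q^12*C^4*D^4 - q^8*C^5*D^2
        + q^14*C^5*D^5 + q^6*C^6 - q^12*C^6*D^3,
        letters [2, 2, 1, 2, 2, 1])]"

definition g2_serre1 :: "'f::field \<Rightarrow> ('f \<times> bool list) list" where
  "g2_serre1 q = [(q^3, letters [1, 1, 2, 2, 2, 2]), (- (q^6 + 1), letters [1, 2, 1, 2, 2, 2]),
                  (q^3, letters [2, 1, 1, 2, 2, 2])]"

definition g2_serre2 :: "'f::field \<Rightarrow> ('f \<times> bool list) list" where
  "g2_serre2 q =
     [(q^4, letters [1, 2, 2, 2, 2, 1]), (- (q + q^3 + q^5 + q^7), letters [2, 1, 2, 2, 2, 1]),
      (1 + q^2 + 2 * q^4 + q^6 + q^8, letters [2, 2, 1, 2, 2, 1]),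
      (- (q + q^3 + q^5 + q^7), letters [2, 2, 2, 1, 2, 1]), (q^4, letters [2, 2, 2, 2, 1, 1])]"

lemma g2_poly_homogeneous [simp]:
  "homogeneous (Suc 0) (Suc 0) (g2_poly1 q C)" "homogeneous (Suc 0) (Suc 0) (swap_letters (g2_poly1 q C))"
  "homogeneous (Suc 0) 3 (g2_poly2 q C N)" "homogeneous 3 (Suc 0) (swap_letters (g2_poly2 q C N))"
  "homogeneous 2 3 (g2_poly3 q C D)" "homogeneous 3 2 (swap_letters (g2_poly3 q C D))"
  "homogeneous 2 4 (g2_poly4 q C D)" "homogeneous 4 2 (swap_letters (g2_poly4 q C D))"
  "homogeneous 2 4 (g2_serre1 q)" "homogeneous 4 2 (swap_letters (g2_serre1 q))"
  "homogeneous 2 4 (g2_serre2 q)"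
  by (simp_all add: g2_poly1_def g2_poly2_def g2_poly3_def g2_poly4_def g2_serre1_def g2_serre2_def
      pmult_def)

lemma br_fractions:
  fixes q N :: "'f::field"
  assumes "q \<noteq> 0" "N \<noteq> 0"
  shows "br N = (N^2 - 1) / N" "br (q * N) = (q^2 * N^2 - 1) / (q * N)"
    "br (q^2 * N) = (q^4 * N^2 - 1) / (q^2 * N)" "br (N / q) = (N^2 - q^2) / (q * N)"
    "br q = (q^2 - 1) / q" "br (q^2) = (q^4 - 1) / q^2" "br (q^3) = (q^6 - 1) / q^3"
    "q^2 + 1 + 1 / q^2 = (q^4 + q^2 + 1) / q^2"
  using assms unfolding br_def by (simp_all add: divide_simps; Groebner_Basis.algebra)+

lemma g2_interpolation:
  fixes q N :: "'f::field"
  assumes "q \<noteq> 0" "N \<noteq> 0"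
  shows "\<forall>m\<in>{-3, -1, 1, 3}. - (br (q * N) * br N * br (N / q))
      + (q^2 + 1 + 1 / q^2) * (br (q^2 * N) * br N * br (N / q)) * q powi m
      - (q^2 + 1 + 1 / q^2) * (br (q^2 * N) * br (q * N) * br (N / q)) * q powi (2 * m)
      + br (q^2 * N) * br (q * N) * br N * q powi (3 * m)
    = br q * br (q^2) * br (q^3) * (q^2 * N) powi m"
  unfolding br_fractions[OF assms] using assms
  by (simp add: power_int_minus divide_simps; intro conjI; Groebner_Basis.algebra)

lemma g2_poly2_coef:
  assumes "q \<noteq> 0" "C \<noteq> 0" "N \<noteq> 0" "m \<in> {-3, -1, 1, 3}"
  shows "pcoef q (swap_letters (g2_poly2 q C N)) [m] = br q * br (q^2) * br (q^3)
    * ((q^2 * N) powi m * (br (q^3 * C^3) - br (C^3) * q powi m))"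
proof -
  define x y where "x = br (q^3 * C^3)" and "y = br (C^3)"
  let ?k = "br q * br (q^2) * br (q^3)"
  define A where "A N = - (br (q * N) * br N * br (N / q))
      + (q^2 + 1 + 1 / q^2) * (br (q^2 * N) * br N * br (N / q)) * q powi m
      - (q^2 + 1 + 1 / q^2) * (br (q^2 * N) * br (q * N) * br (N / q)) * q powi (2 * m)
      + br (q^2 * N) * br (q * N) * br N * q powi (3 * m)" for N
  have A: "A N = ?k * (q^2 * N) powi m" if "N \<noteq> 0" for N
    unfolding A_def using g2_interpolation[OF assms(1) that] assms(4) by blast
  have pw: "q powi (m + m) = q powi (2 * m)" "q powi (m + (m + m)) = q powi (3 * m)"
    by (simp_all add: algebra_simps)
  have e: "q^2 * (q * N) = q^3 * N" "q * (q * N) = q^2 * N" "q * N / q = N"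
    using assms(1) by (simp_all add: power2_eq_square power3_eq_cube)
  have "pcoef q (swap_letters (g2_poly2 q C N)) [m] = x * A N - y * A (q * N)"
    unfolding A_def g2_poly2_def x_def[symmetric] y_def[symmetric] e using assms(1)
    by (simp add: pw power_int_add[symmetric] mult.assoc algebra_simps)
  also have "\<dots> = x * (?k * (q^2 * N) powi m) - y * (?k * (q powi m * (q^2 * N) powi m))"
    using assms(1,3) A[of N] A[of "q * N"]
    by (simp add: power_int_mult_distrib[symmetric] mult.left_commute)
  finally show ?thesis
    by (simp add: x_def y_def algebra_simps)
qed

lemma g2_poly2_coef_extremal:
  assumes "q \<noteq> 0" "C \<noteq> 0" "D \<noteq> 0"
  shows "pcoef (q powi 3) (g2_poly2 q C (C * D)) [1, 1, 1]
      = br q * br (q^2) * br (q^3) * (q^3 * br (q^3) / D^3)"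
    and "pcoef (q powi 3) (g2_poly2 q C (C * D)) [-1, -1, -1]
      = br q * br (q^2) * br (q^3) * (D^3 * br (q^3) / q^3)"
proof -
  let ?x = "\<lambda>m. pcoef q (swap_letters (g2_poly2 q C (C * D))) [m]"
  have "pcoef (q powi 3) (g2_poly2 q C (C * D)) [1, 1, 1] = q^9 * ?x (-3)"
    "pcoef (q powi 3) (g2_poly2 q C (C * D)) [-1, -1, -1] = ?x 3 / q^9"
    unfolding g2_poly2_def using assms
    by (simp_all add: power_int_minus divide_simps; Groebner_Basis.algebra)+
  moreover have b: "br (q^3 * C^3) - br (C^3) * q powi -3 = C^3 * br (q^3)"
    "br (q^3 * C^3) - br (C^3) * q powi 3 = br (q^3) / C^3"
    unfolding br_def using assms by (simp_all add: power_int_minus divide_simps; Groebner_Basis.algebra)+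
  have "q^9 * ((q^2 * (C * D)) powi -3 * (br (q^3 * C^3) - br (C^3) * q powi -3)) = q^3 * br (q^3) / D^3"
    "(q^2 * (C * D)) powi 3 * (br (q^3 * C^3) - br (C^3) * q powi 3) / q^9 = D^3 * br (q^3) / q^3"
    unfolding b using assms
    by (simp_all add: power_int_minus divide_simps; Groebner_Basis.algebra)+
  ultimately show "pcoef (q powi 3) (g2_poly2 q C (C * D)) [1, 1, 1]
      = br q * br (q^2) * br (q^3) * (q^3 * br (q^3) / D^3)"
    "pcoef (q powi 3) (g2_poly2 q C (C * D)) [-1, -1, -1]
      = br q * br (q^2) * br (q^3) * (D^3 * br (q^3) / q^3)"
    using g2_poly2_coef[of q C "C * D" 3] g2_poly2_coef[of q C "C * D" "-3"] assms
    by (simp_all add: mult.assoc mult.left_commute flip: times_divide_eq_right)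
qed

locale rank_two_G2 = rank_two sc q f1 f2 3 "{-3, -1, 1, 3}" s t
  for sc :: "'f::field \<Rightarrow> 'k::division_ring" and q f1 f2 s t
begin

lemma g2_step1:
  "sc (br (q^3)) * (f1 powi (c + 1) * f2) = poly (g2_poly1 q (q powi c)) * f1 powi c"
proof -
  have "f1 powi c * poly [(br (q^3), letters [1, 2])] = poly (g2_poly1 q (q powi c)) * f1 powi c"
  proof (rule conj_f1[where n = 1 and k = 1 and R = "[]" and \<kappa> = "\<lambda>_. 0"])
    define C where "C = q powi c"
    have C: "C \<noteq> 0" "(q powi 3) powi c = C ^ 3"
      by (simp_all add: C_def power_int_mult[symmetric] mult.commute flip: power_int_numeral)
    show "\<forall>w\<in>tuples {-1, 1} 1. ((q powi 3) powi c) powi sum_list w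
        * pcoef (q powi 3) [(br (q^3), letters [1, 2])] w
        - pcoef (q powi 3) (g2_poly1 q (q powi c)) w = 0 * pcoef (q powi 3) [] w"
      unfolding C(2) C_def[symmetric] g2_poly1_def br_def
      using C(1) by (simp add: frame_simps divide_simps; intro conjI; Groebner_Basis.algebra)
  qed simp_all
  then show ?thesis by (simp add: powi_succ mult.assoc sc_left_commute[of "_ powi _"])
qed

lemma g2_step2:
  "sc (br q * br (q^2) * br (q^3)) * (f2 powi (n + 2) * poly (g2_poly1 q C))
     = poly (g2_poly2 q C (q powi n)) * f2 powi n" if C: "C \<noteq> 0"
proof -
  have "f2 powi n * poly (pscale (br q * br (q^2) * br (q^3)) (pmult [False, False] (g2_poly1 q C) []))
      = poly (g2_poly2 q C (q powi n)) * f2 powi n"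
  proof (rule conj_f2[where n = 1 and k = 3 and R = "[]" and \<kappa> = "\<lambda>_. 0"])
    define N where "N = q powi n"
    have N: "N \<noteq> 0" by (simp add: N_def)
    have "(q powi n) powi m
        * pcoef q (swap_letters (pscale (br q * br (q^2) * br (q^3)) (pmult [False, False] (g2_poly1 q C) []))) [m]
        = pcoef q (swap_letters (g2_poly2 q C (q powi n))) [m]" if "m \<in> {-3, -1, 1, 3}" for m
      unfolding N_def[symmetric] g2_poly2_coef[OF q_nonzero C N that]
      by (simp add: g2_poly1_def pmult_def power_int_mult_distrib algebra_simps
          power_int_mult[symmetric] flip: power_int_numeral power_int_add)
    then show "\<forall>w\<in>tuples {-3, -1, 1, 3} 1. (q powi n) powi sum_list w
        * pcoef q (swap_letters (pscale (br q * br (q^2) * br (q^3)) (pmult [False, False] (g2_poly1 q C) []))) w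
        - pcoef q (swap_letters (g2_poly2 q C (q powi n))) w = 0 * pcoef q (swap_letters []) w"
      by (simp only: One_nat_def ball_tuples) simp
  qed (simp_all add: g2_poly1_def pmult_def)
  moreover have "f2 powi (n + 2) = f2 powi n * f2 * f2"
    using powi_succ(2)[of n] powi_succ(2)[of "n + 1"] by (simp add: add.commute)
  ultimately show ?thesis by (simp add: peval_ops mult.assoc sc_left_commute[of "_ powi _"])
qed

lemma g2_step3:
  "sc (br (q^6)) * (f1 powi (d + 1) * poly (g2_poly2 q C (C * q powi d)))
     = poly (g2_poly3 q C (q powi d)) * f1 powi d" if C: "C \<noteq> 0"
proof -
  define D where "D = q powi d"
  have D: "D \<noteq> 0" "(q powi 3) powi d = D ^ 3"
    by (simp_all add: D_def power_int_mult[symmetric] mult.commute flip: power_int_numeral)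
  have "f1 powi d * poly (pscale (br (q^6)) (pmult [True] (g2_poly2 q C (C * D)) []))
      = poly (g2_poly3 q C D) * f1 powi d"
  proof (rule conj_f1[where n = 3 and k = 2 and R = "[]" and \<kappa> = "\<lambda>_. 0"])
    have q3: "q powi 3 = q ^ 3" by simp
    let ?x = "\<lambda>w. pcoef (q ^ 3) (g2_poly2 q C (C * D)) w"
    have x: "pcoef p (pmult [] (g2_poly2 q C (C * D)) [True]) [i, j, k] = pcoef p (g2_poly2 q C (C * D)) [i, j, k]" for i j k p
        by (rule pcoef_pmult_right(1)[OF g2_poly_homogeneous(3)]) simp
    define k where "k = br q * br (q^2) * br (q^3)"
    have e: "?x [1, 1, 1] = k * (q^3 * br (q^3) / D^3)" "?x [-1, -1, -1] = k * (D^3 * br (q^3) / q^3)"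
      unfolding k_def by (rule g2_poly2_coef_extremal[OF q_nonzero C D(1), unfolded q3])+
    have b: "br (q^6) = (q^12 - 1) / q^6" "br (q^3) = (q^6 - 1) / q^3" "br (D^3) = (D^6 - 1) / D^3"
        "br (q^3 * D^3) = (q^6 * D^6 - 1) / (q^3 * D^3)" "q^3 + 1 / q^3 = (q^6 + 1) / q^3"
      using D(1) unfolding br_def by (simp_all add: divide_simps; Groebner_Basis.algebra)+
    show "\<forall>w\<in>tuples {-1, 1} 3. ((q powi 3) powi d) powi sum_list w
        * pcoef (q powi 3) (pscale (br (q^6)) (pmult [True] (g2_poly2 q C (C * D)) [])) w
        - pcoef (q powi 3) (g2_poly3 q C D) w = 0 * pcoef (q powi 3) [] w"
      unfolding q3 D(2)[unfolded q3] g2_poly3_def ball_tuples pcoef_append pcoef_pscale pcoef_pmult(1) x k_def[symmetric]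
      using C D(1)
      by (simp add: e b; simp add: power_int_minus divide_simps; intro conjI; Groebner_Basis.algebra)
  qed (simp_all add: g2_poly2_def g2_poly3_def pmult_def)
  then show ?thesis
    by (simp add: D_def peval_ops powi_succ mult.assoc sc_left_commute[of "_ powi _"])
qed

end

text \<open>The coefficients of the difference of the two sides of the last two steps, with cleared
  denominators; here \<open>C\<close> and \<open>D\<close> stand for squares.\<close>

definition g2_diff4 :: "'f::field \<Rightarrow> 'f \<Rightarrow> 'f \<Rightarrow> int list \<Rightarrow> 'f" where
  "g2_diff4 q C D w = (let m = w ! 0; k = w ! 1;
      x = (\<lambda>n. q ^ nat (2 * n + 6) * (C * D) ^ nat ((n + 3) div 2)
                * (q^6 * C^3 - 1 - (C^3 - 1) * q ^ nat (n + 3)))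
    in (q^4 - 1)^2 * q ^ nat (12 + m + k) * D ^ nat (m + k + 6) * C ^ nat ((6 - m - k) div 2)
       * ((q^6 + 1) * ((q^6 * D^3 - 1) * q^6 * x k - (D^3 - 1) * q ^ nat (3 * k + 9) * x m)
          + (D^3 - 1) * (q^6 * D^3 - 1) * C^3
            * (q^18 - (q^6 + 1) * q ^ nat (3 * k + 15) + q ^ nat (3 * (m + k) + 18)))
     - (q^6 + 1) * C^3 * D^6 * ncoef q 1 24 (swap_letters (g2_poly4 q C D)) w)"

definition g2_diff5 :: "'f::field \<Rightarrow> 'f \<Rightarrow> 'f \<Rightarrow> int list \<Rightarrow> 'f" where
  "g2_diff5 q C D w =
     D ^ nat (6 + 3 * (sum_list w div 2)) * C ^ nat (6 - 3 * (sum_list w div 2))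
       * ncoef q 3 24 (g2_poly4 q C D) w
     - C^6 * D^6 * ncoef q 3 24 (g2_poly4 q D C) w"

abbreviation g2_rel4 :: "'f::field \<Rightarrow> int list \<Rightarrow> 'f" where
  "g2_rel4 q \<equiv> ncoef q 1 6 (swap_letters (g2_serre1 q))"

abbreviation g2_rel5 :: "'f::field \<Rightarrow> int list \<Rightarrow> 'f" where
  "g2_rel5 q \<equiv> ncoef q 3 12 (g2_serre2 q)"

lemma g2_rel_values:
  fixes q :: "'f::field"
  shows "g2_rel4 q [1, 3] = q^13 * (1 - q^2)" "g2_rel4 q [3, -1] = q^5 * (q^4 - 1)"
    "g2_rel4 q [3, -3] = q^3 * (q^6 - 1)" "g2_rel4 q [-3, 1] = q^9 * (1 - q^4)"
    "g2_rel4 q [-3, -1] = q^9 * (1 - q^2)" "g2_rel4 q [3, 3] = 0" "g2_rel4 q [-3, -3] = 0"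
    "g2_rel5 q [1, 1, 1, -1] = q^10 * (q^6 - 1)"
    "g2_rel5 q [1, 1, -1, -1] = q^6 * (1 - q^6) * (q^2 + 1)"
    "g2_rel5 q [-1, -1, -1, 1] = q^16 * (1 - q^6)"
    "g2_rel5 q [1, 1, 1, 1] = 0" "g2_rel5 q [-1, -1, -1, -1] = 0"
  by (simp_all add: ncoef_simps g2_serre1_def g2_serre2_def; Groebner_Basis.algebra)+

lemma g2_diff4_relations:
  fixes q C D :: "'f::field"
  shows "g2_diff4 q C D [3, 3] = 0"
    and "g2_diff4 q C D [-3, -3] = 0"
    and "g2_diff4 q C D [3, 1] * g2_rel4 q [1, 3] = g2_diff4 q C D [1, 3] * g2_rel4 q [3, 1]"
    and "g2_diff4 q C D [1, 1] * g2_rel4 q [3, -1] = g2_diff4 q C D [3, -1] * g2_rel4 q [1, 1]"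
    and "g2_diff4 q C D [1, -1] * g2_rel4 q [3, -3] = g2_diff4 q C D [3, -3] * g2_rel4 q [1, -1]"
    and "g2_diff4 q C D [1, -3] * g2_rel4 q [-3, 1] = g2_diff4 q C D [-3, 1] * g2_rel4 q [1, -3]"
    and "g2_diff4 q C D [-1, 3] * g2_rel4 q [3, -1] = g2_diff4 q C D [3, -1] * g2_rel4 q [-1, 3]"
    and "g2_diff4 q C D [-1, 1] * g2_rel4 q [3, -3] = g2_diff4 q C D [3, -3] * g2_rel4 q [-1, 1]"
    and "g2_diff4 q C D [-1, -1] * g2_rel4 q [-3, 1] = g2_diff4 q C D [-3, 1] * g2_rel4 q [-1, -1]"
    and "g2_diff4 q C D [-1, -3] * g2_rel4 q [-3, -1] = g2_diff4 q C D [-3, -1] * g2_rel4 q [-1, -3]"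
    and "g2_diff4 q C D [-3, 3] * g2_rel4 q [3, -3] = g2_diff4 q C D [3, -3] * g2_rel4 q [-3, 3]"
  unfolding g2_diff4_def g2_poly4_def g2_serre1_def
  by (simp_all add: ncoef_simps; Groebner_Basis.algebra)+

lemma g2_diff5_relations:
  fixes q C D :: "'f::field"
  shows "g2_diff5 q C D [1, 1, 1, 1] = 0"
    and "g2_diff5 q C D [-1, -1, -1, -1] = 0"
    and "g2_diff5 q C D [1, 1, -1, 1] * g2_rel5 q [1, 1, 1, -1] = g2_diff5 q C D [1, 1, 1, -1] * g2_rel5 q [1, 1, -1, 1]"
    and "g2_diff5 q C D [1, -1, 1, 1] * g2_rel5 q [1, 1, 1, -1] = g2_diff5 q C D [1, 1, 1, -1] * g2_rel5 q [1, -1, 1, 1]"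
    and "g2_diff5 q C D [1, -1, 1, -1] * g2_rel5 q [1, 1, -1, -1] = g2_diff5 q C D [1, 1, -1, -1] * g2_rel5 q [1, -1, 1, -1]"
    and "g2_diff5 q C D [1, -1, -1, 1] * g2_rel5 q [1, 1, -1, -1] = g2_diff5 q C D [1, 1, -1, -1] * g2_rel5 q [1, -1, -1, 1]"
    and "g2_diff5 q C D [1, -1, -1, -1] * g2_rel5 q [-1, -1, -1, 1] = g2_diff5 q C D [-1, -1, -1, 1] * g2_rel5 q [1, -1, -1, -1]"
    and "g2_diff5 q C D [-1, 1, 1, 1] * g2_rel5 q [1, 1, 1, -1] = g2_diff5 q C D [1, 1, 1, -1] * g2_rel5 q [-1, 1, 1, 1]"
    and "g2_diff5 q C D [-1, 1, 1, -1] * g2_rel5 q [1, 1, -1, -1] = g2_diff5 q C D [1, 1, -1, -1] * g2_rel5 q [-1, 1, 1, -1]"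
    and "g2_diff5 q C D [-1, 1, -1, 1] * g2_rel5 q [1, 1, -1, -1] = g2_diff5 q C D [1, 1, -1, -1] * g2_rel5 q [-1, 1, -1, 1]"
    and "g2_diff5 q C D [-1, 1, -1, -1] * g2_rel5 q [-1, -1, -1, 1] = g2_diff5 q C D [-1, -1, -1, 1] * g2_rel5 q [-1, 1, -1, -1]"
    and "g2_diff5 q C D [-1, -1, 1, 1] * g2_rel5 q [1, 1, -1, -1] = g2_diff5 q C D [1, 1, -1, -1] * g2_rel5 q [-1, -1, 1, 1]"
    and "g2_diff5 q C D [-1, -1, 1, -1] * g2_rel5 q [-1, -1, -1, 1] = g2_diff5 q C D [-1, -1, -1, 1] * g2_rel5 q [-1, -1, 1, -1]"
  unfolding g2_diff5_def g2_poly4_def g2_serre2_def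
  by (simp_all add: ncoef_simps; Groebner_Basis.algebra)+

lemma g2_poly3_coef:
  assumes "q \<noteq> 0" "C \<noteq> 0" "D \<noteq> 0" "m \<in> {-3, -1, 1, 3}" "k \<in> {-3, -1, 1, 3}"
  shows "pcoef q (swap_letters (g2_poly3 q C D)) [m, k] = br q * br (q^2) * br (q^3) *
    ((q^3 + 1 / q^3) * (br (q^3 * D^3) * ((q^2 * (C * D)) powi k * (br (q^3 * C^3) - br (C^3) * q powi k))
       - br (D^3) * (q powi (3 * k) * ((q^2 * (C * D)) powi m * (br (q^3 * C^3) - br (C^3) * q powi m))))
     + br (D^3) * br (q^3 * D^3) * (1 - (q^3 + 1 / q^3) * q powi (3 * k) + q powi (3 * (m + k))))"
proof -
  let ?P = "swap_letters (g2_poly2 q C (C * D))"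
  have left: "pcoef q (pmult (map Not [True]) ?P (map Not [])) [m, k] = pcoef q ?P [k]"
    by (simp add: pcoef_pmult)
  have right: "pcoef q (pmult (map Not []) ?P (map Not [True])) [m, k] = q powi (3 * k) * pcoef q ?P [m]"
    using pcoef_pmult_right(2)[of 3 1 ?P "[m]" q k] assms(1) by simp
  have pw: "q powi (3 * x) = q powi x * (q powi x * q powi x)" for x
    using assms(1) by (simp add: power_int_add[symmetric])
  have words: "pcoef q (swap_letters [(1, letters [1, 1, 2, 2, 2]), (- (q^3 + 1 / q^3), letters [1, 2, 2, 2, 1]),
      (1, letters [2, 2, 2, 1, 1])]) [m, k] = 1 - (q^3 + 1 / q^3) * q powi (3 * k) + q powi (3 * (m + k))"
    using pw[of k] pw[of "m + k"] by (simp add: algebra_simps)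
  have "C * D \<noteq> 0" using assms by simp
  note X = g2_poly2_coef[OF assms(1,2) this assms(4)] g2_poly2_coef[OF assms(1,2) this assms(5)]
  show ?thesis
    unfolding g2_poly3_def swap_letters_simps(3-5) pcoef_append pcoef_pscale
      left right words X
    by (simp only: distrib_left right_diff_distrib minus_mult_left[symmetric] mult_minus_left) (simp add: algebra_simps)
qed

lemma g2_diff4_eq:
  fixes q C D :: "'f::field"
  assumes "q \<noteq> 0" "C \<noteq> 0" "D \<noteq> 0"
  shows "\<forall>m\<in>{-3, -1, 1, 3}. \<forall>k\<in>{-3, -1, 1, 3}.
    (D^2 / C) powi (m + k) * (br (q^2)^2 * q^10 * C^6 * D^6 * (q powi (m + k) *
      ((q^3 + 1 / q^3) * (br (q^3 * D^3) * ((q^2 * (C * D)) powi k * (br (q^3 * C^3) - br (C^3) * q powi k))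
         - br (D^3) * (q powi (3 * k) * ((q^2 * (C * D)) powi m * (br (q^3 * C^3) - br (C^3) * q powi m))))
       + br (D^3) * br (q^3 * D^3) * (1 - (q^3 + 1 / q^3) * q powi (3 * k) + q powi (3 * (m + k))))))
     - (q^3 + 1 / q^3) * (ncoef q 1 24 (swap_letters (g2_poly4 q (C^2) (D^2))) [m, k] / q^24)
    = g2_diff4 q (C^2) (D^2) [m, k] / (q^27 * C^6 * D^12)"
proof -
  have b: "br (q^2) = (q^4 - 1) / q^2" "br (D^3) = (D^6 - 1) / D^3" "br (C^3) = (C^6 - 1) / C^3"
      "br (q^3 * D^3) = (q^6 * D^6 - 1) / (q^3 * D^3)" "br (q^3 * C^3) = (q^6 * C^6 - 1) / (q^3 * C^3)"
      "q^3 + 1 / q^3 = (q^6 + 1) / q^3"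
    using assms unfolding br_def by (simp_all add: divide_simps; Groebner_Basis.algebra)+
  have "\<forall>n\<in>{-3, -1, 1, 3}. (q^2 * (C * D)) powi n * (br (q^3 * C^3) - br (C^3) * q powi n)
      = q ^ nat (2 * n + 6) * (C^2 * D^2) ^ nat ((n + 3) div 2)
        * (q^6 * (C^2)^3 - 1 - ((C^2)^3 - 1) * q ^ nat (n + 3)) / (q^9 * C^6 * D^3)"
    using assms unfolding b
    by (simp add: power_int_minus divide_simps; intro conjI; Groebner_Basis.algebra)
  note xi = this[rule_format]
  have shift: "x powi n = x ^ nat (n + int j) / x ^ j" if "x \<noteq> 0" "0 \<le> n + int j" for x :: 'f and n j
  proof -
    have "x ^ nat (n + int j) = x powi (n + int j)" using that(2) by (simp add: power_int_def)
    then show ?thesis using that(1) by (simp add: power_int_add)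
  qed
  have "\<forall>n\<in>{-6, -4, -2, 0, 2, 4, 6}. (D^2 / C) powi n = (D^2) ^ nat (n + 6) * (C^2) ^ nat ((6 - n) div 2) / (C^6 * D^12)"
    using assms
    by (simp add: power_int_minus divide_simps; intro conjI; Groebner_Basis.algebra)
  note ratio = this[rule_format]
  show ?thesis
  proof (intro ballI)
    fix m k :: int
    assume mk: "m \<in> {-3, -1, 1, 3}" "k \<in> {-3, -1, 1, 3}"
    then have range: "m + k \<in> {-6, -4, -2, 0, 2, 4, 6}" by auto
    define u v w y where "u = q ^ nat (3 * k + 9)" and "v = q ^ nat (3 * m + 3 * k + 18)"
      and "w = q ^ nat (12 + m + k)" and "y = ncoef q 1 24 (swap_letters (g2_poly4 q (C^2) (D^2))) [m, k]"
    define \<xi> where "\<xi> n = q ^ nat (2 * n + 6) * (C^2 * D^2) ^ nat ((n + 3) div 2)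
        * (q^6 * (C^2)^3 - 1 - ((C^2)^3 - 1) * q ^ nat (n + 3))" for n
    define z where "z = (D^2) ^ nat (m + k + 6) * (C^2) ^ nat ((6 - m - k) div 2)"
    have e: "q powi (3 * k) = u / q^9" "q powi (3 * (m + k)) = v / q^18" "q powi (m + k) = w / q^12"
      using shift[of q "3 * k" 9] shift[of q "3 * (m + k)" 18] shift[of q "m + k" 12] assms(1) mk
      by (auto simp: u_def v_def w_def add.commute add.left_commute)
    have r: "(D^2 / C) powi (m + k) = z / (C^6 * D^12)"
      using ratio[OF range] by (simp add: z_def algebra_simps)
    have u: "q ^ nat (3 * k + 15) = u * q^6"
    proof -
      have "nat (3 * k + 15) = nat (3 * k + 9) + 6" using mk by auto
      then show ?thesis by (simp add: u_def power_add)
    qed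
    have d: "g2_diff4 q (C^2) (D^2) [m, k] = (q^4 - 1)^2 * w * z
       * ((q^6 + 1) * ((q^6 * (D^2)^3 - 1) * q^6 * \<xi> k - ((D^2)^3 - 1) * u * \<xi> m)
          + ((D^2)^3 - 1) * (q^6 * (D^2)^3 - 1) * (C^2)^3 * (q^18 - (q^6 + 1) * (u * q^6) + v))
       - (q^6 + 1) * (C^2)^3 * (D^2)^6 * y"
      by (simp add: g2_diff4_def u \<xi>_def u_def[symmetric] v_def[symmetric] w_def[symmetric]
          y_def[symmetric] z_def mult.assoc Let_def)
    show "(D^2 / C) powi (m + k) * (br (q^2)^2 * q^10 * C^6 * D^6 * (q powi (m + k) *
      ((q^3 + 1 / q^3) * (br (q^3 * D^3) * ((q^2 * (C * D)) powi k * (br (q^3 * C^3) - br (C^3) * q powi k))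
         - br (D^3) * (q powi (3 * k) * ((q^2 * (C * D)) powi m * (br (q^3 * C^3) - br (C^3) * q powi m))))
       + br (D^3) * br (q^3 * D^3) * (1 - (q^3 + 1 / q^3) * q powi (3 * k) + q powi (3 * (m + k))))))
     - (q^3 + 1 / q^3) * (ncoef q 1 24 (swap_letters (g2_poly4 q (C^2) (D^2))) [m, k] / q^24)
     = g2_diff4 q (C^2) (D^2) [m, k] / (q^27 * C^6 * D^12)"
      unfolding xi[OF mk(1)] xi[OF mk(2)] \<xi>_def[symmetric] y_def[symmetric] e r d
      unfolding b using assms by (simp add: divide_simps; Groebner_Basis.algebra)
  qed
qed

lemma g2_diff5_eq:
  fixes q C D :: "'f::field"
  assumes "q \<noteq> 0" "C \<noteq> 0" "D \<noteq> 0"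
  shows "\<forall>w\<in>tuples {-1, 1} 4. (D^3 / C^3) powi sum_list w * (ncoef q 3 24 (g2_poly4 q (C^2) (D^2)) w / q^24)
      - ncoef q 3 24 (g2_poly4 q (D^2) (C^2)) w / q^24
    = g2_diff5 q (C^2) (D^2) w / (q^24 * C^12 * D^12)"
  unfolding g2_diff5_def ball_tuples using assms
  by (simp add: power_int_minus; simp add: divide_simps; intro conjI; Groebner_Basis.algebra)

context rank_two_G2
begin

lemma g2_serre1: "poly (g2_serre1 q) = 0"
proof -
  have "poly [(q^3, letters [1, 1, 2]), (- (q^6 + 1), letters [1, 2, 1]), (q^3, letters [2, 1, 1])] = 0"
    by (rule poly_eq_0_f1[where k = 2 and n = 1])
      (simp_all add: frame_simps divide_simps; (intro conjI)?; Groebner_Basis.algebra)+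
  moreover have "poly (g2_serre1 q)
      = poly [(q^3, letters [1, 1, 2]), (- (q^6 + 1), letters [1, 2, 1]), (q^3, letters [2, 1, 1])] * (f2 * (f2 * f2))"
    by (simp add: g2_serre1_def algebra_simps)
  ultimately show ?thesis by simp
qed

lemma g2_serre2: "poly (g2_serre2 q) = 0"
proof -
  let ?P = "[(q^4, letters [1, 2, 2, 2, 2]), (- (q + q^3 + q^5 + q^7), letters [2, 1, 2, 2, 2]),
      (1 + q^2 + 2 * q^4 + q^6 + q^8, letters [2, 2, 1, 2, 2]),
      (- (q + q^3 + q^5 + q^7), letters [2, 2, 2, 1, 2]), (q^4, letters [2, 2, 2, 2, 1])]"
  have "poly ?P = 0"
    by (rule poly_eq_0_f2[where k = 4 and n = 1])
      (simp_all add: frame_simps divide_simps; (intro conjI)?; Groebner_Basis.algebra)+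
  moreover have "poly (g2_serre2 q) = poly ?P * f1"
    by (simp add: g2_serre2_def algebra_simps)
  ultimately show ?thesis by simp
qed

lemma br_nonzero: "br q \<noteq> 0" "br (q^2) \<noteq> 0" "br (q^3) \<noteq> 0" "br (q^6) \<noteq> 0" "q^3 + 1 / q^3 \<noteq> 0"
proof -
  show *: "br q \<noteq> 0" "br (q^2) \<noteq> 0" "br (q^3) \<noteq> 0" "br (q^6) \<noteq> 0"
    using br_powi_nonzero[of 1] br_powi_nonzero[of 2] br_powi_nonzero[of 3] br_powi_nonzero[of 6]
    by simp_all
  have "br (q^6) = br (q^3) * (q^3 + 1 / q^3)"
    unfolding br_def by (simp add: divide_simps; Groebner_Basis.algebra)
  then show "q^3 + 1 / q^3 \<noteq> 0" using *(4) by auto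
qed

lemma g2_rel_nonzero:
  "g2_rel4 q [1, 3] \<noteq> 0" "g2_rel4 q [3, -1] \<noteq> 0" "g2_rel4 q [3, -3] \<noteq> 0"
  "g2_rel4 q [-3, 1] \<noteq> 0" "g2_rel4 q [-3, -1] \<noteq> 0"
  "g2_rel5 q [1, 1, 1, -1] \<noteq> 0" "g2_rel5 q [1, 1, -1, -1] \<noteq> 0" "g2_rel5 q [-1, -1, -1, 1] \<noteq> 0"
proof -
  have one: "q ^ n \<noteq> 1" if "n \<noteq> 0" for n
    using q_powi_inj[of "int n" 0] that by simp
  have "(q^2 + 1) * (q^2 - 1) = q^4 - 1" by (simp add: algebra_simps flip: power_add)
  then have "q^2 + 1 \<noteq> 0" using one[of 4] by auto
  then show "g2_rel4 q [1, 3] \<noteq> 0" "g2_rel4 q [3, -1] \<noteq> 0" "g2_rel4 q [3, -3] \<noteq> 0"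
    "g2_rel4 q [-3, 1] \<noteq> 0" "g2_rel4 q [-3, -1] \<noteq> 0"
    "g2_rel5 q [1, 1, 1, -1] \<noteq> 0" "g2_rel5 q [1, 1, -1, -1] \<noteq> 0" "g2_rel5 q [-1, -1, -1, 1] \<noteq> 0"
    unfolding g2_rel_values using one[of 2] one[of 4] one[of 6] by auto
qed

lemma g2_step4:
  assumes "n = 2 * d - c"
  shows "sc (br (q^2)^2 * q^10 * (q powi c)^6 * (q powi d)^6 / (br q * br (q^2) * br (q^3)))
      * (f2 powi (n + 1) * poly (g2_poly3 q (q powi c) (q powi d)))
    = sc (q^3 + 1 / q^3) * poly (g2_poly4 q ((q powi c)^2) ((q powi d)^2)) * f2 powi n"
proof -
  define C D where "C = q powi c" and "D = q powi d"
  have CD: "C \<noteq> 0" "D \<noteq> 0" by (simp_all add: C_def D_def)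
  have n: "q powi n = D^2 / C"
    by (simp add: assms C_def D_def power_int_diff power_int_mult[symmetric] mult.commute
        flip: power_int_numeral)
  define \<alpha> where "\<alpha> = br (q^2)^2 * q^10 * C^6 * D^6 / (br q * br (q^2) * br (q^3))"
  define P where "P = pscale \<alpha> (pmult [False] (g2_poly3 q C D) [])"
  define P' where "P' = pscale (q^3 + 1 / q^3) (g2_poly4 q (C^2) (D^2))"
  define \<Delta> where "\<Delta> w = (D^2 / C) powi sum_list w * pcoef q (swap_letters P) w - pcoef q (swap_letters P') w" for w
  define \<rho> where "\<rho> = pcoef q (swap_letters (g2_serre1 q))"
  define z :: "int \<Rightarrow> int list" where "z d = (if d = 4 then [1, 3] else if d = 2 then [3, -1] else if d = 0 then [3, -3]
      else if d = -2 then [-3, 1] else [-3, -1])" for d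
  have \<rho>: "\<rho> [m, k] = g2_rel4 q [m, k] / q^6" if "m \<in> {-3, -1, 1, 3}" "k \<in> {-3, -1, 1, 3}" for m k
  proof -
    have "pcoef (q powi 1) (swap_letters (g2_serre1 q)) [m, k] = g2_rel4 q [m, k] / q^6"
      using that by (intro pcoef_ncoef[where k = 4]) (auto simp: g2_serre1_def)
    then show ?thesis by (simp add: \<rho>_def)
  qed
  have \<Delta>: "\<Delta> [m, k] = g2_diff4 q (C^2) (D^2) [m, k] / (q^27 * C^6 * D^12)"
    if mk: "m \<in> {-3, -1, 1, 3}" "k \<in> {-3, -1, 1, 3}" for m k
  proof -
    have "pcoef (q powi 1) (swap_letters (g2_poly4 q (C^2) (D^2))) [m, k]
        = ncoef q 1 24 (swap_letters (g2_poly4 q (C^2) (D^2))) [m, k] / q^24"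
      using mk by (intro pcoef_ncoef[where k = 4]) (auto simp: g2_poly4_def)
    then have P': "pcoef q (swap_letters P') [m, k]
        = (q^3 + 1 / q^3) * (ncoef q 1 24 (swap_letters (g2_poly4 q (C^2) (D^2))) [m, k] / q^24)"
      by (simp add: P'_def)
    have P: "pcoef q (swap_letters P) [m, k]
        = \<alpha> * (q powi (m + k) * pcoef q (swap_letters (g2_poly3 q C D)) [m, k])"
      by (simp add: P_def pcoef_pmult)
    have cancel: "\<alpha> * (x * (br q * br (q^2) * br (q^3) * y)) = br (q^2)^2 * q^10 * C^6 * D^6 * (x * y)" for x y
      using br_nonzero by (simp add: \<alpha>_def)
    show ?thesis
      unfolding \<Delta>_def P P' g2_poly3_coef[OF q_nonzero CD mk] cancel sum_list.Cons sum_list.Nil add_0_right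
      by (rule g2_diff4_eq[OF q_nonzero CD, rule_format, OF mk])
  qed
  have "\<forall>w\<in>tuples {-3, -1, 1, 3} 2. \<Delta> w = (\<lambda>d. \<Delta> (z d) / \<rho> (z d)) (sum_list w) * \<rho> w"
  proof (rule graded_ratio)
    show "\<forall>w\<in>tuples {-3, -1, 1, 3} 2. \<rho> (z (sum_list w)) \<noteq> 0
        \<and> \<Delta> w * \<rho> (z (sum_list w)) = \<Delta> (z (sum_list w)) * \<rho> w \<or> \<Delta> w = 0 \<and> \<rho> w = 0"
      using CD by (simp add: ball_tuples z_def \<Delta> \<rho> g2_diff4_relations g2_rel_nonzero g2_rel_values(6,7))
  qed
  then have "\<forall>w\<in>tuples {-3, -1, 1, 3} 2. (q powi n) powi sum_list w * pcoef q (swap_letters P) w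
      - pcoef q (swap_letters P') w
      = (\<lambda>d. \<Delta> (z d) / \<rho> (z d)) (sum_list w) * pcoef q (swap_letters (g2_serre1 q)) w"
    by (simp only: n \<Delta>_def \<rho>_def)
  then have "f2 powi n * poly P = poly P' * f2 powi n"
    by (rule conj_f2[where k = 4, rotated 4])
      (simp_all add: g2_serre1 P_def P'_def homogeneous_pmult[where k = 3 and n = 2])
  then show ?thesis
    by (simp add: P_def P'_def \<alpha>_def C_def D_def peval_ops powi_succ mult.assoc sc_left_commute[of "_ powi _"])
qed

lemma g2_step5:
  "f1 powi (d - c) * poly (g2_poly4 q ((q powi c)^2) ((q powi d)^2))
     = poly (g2_poly4 q ((q powi d)^2) ((q powi c)^2)) * f1 powi (d - c)"
proof -
  define C D where "C = q powi c" and "D = q powi d"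
  have CD: "C \<noteq> 0" "D \<noteq> 0" by (simp_all add: C_def D_def)
  have n: "(q powi 3) powi (d - c) = D^3 / C^3"
    by (simp add: C_def D_def power_int_diff power_int_mult[symmetric] mult.commute
        flip: power_int_numeral)
  define P P' where "P = g2_poly4 q (C^2) (D^2)" and "P' = g2_poly4 q (D^2) (C^2)"
  define \<Delta> where "\<Delta> w = (D^3 / C^3) powi sum_list w * pcoef (q powi 3) P w - pcoef (q powi 3) P' w" for w
  define \<rho> where "\<rho> = pcoef (q powi 3) (g2_serre2 q)"
  define z :: "int \<Rightarrow> int list" where "z d = (if d = 2 then [1, 1, 1, -1] else if d = 0 then [1, 1, -1, -1]
      else [-1, -1, -1, 1])" for d
  have \<rho>: "\<forall>w\<in>tuples {-1, 1} 4. \<rho> w = g2_rel5 q w / q^12"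
    unfolding \<rho>_def
  proof
    fix w :: "int list" assume w: "w \<in> tuples {-1, 1} 4"
    have "\<forall>w\<in>tuples {-1, 1} 4. \<forall>(c, u)\<in>set (g2_serre2 q). 0 \<le> int 12 + 3 * wdeg u w"
      unfolding ball_tuples by (simp add: g2_serre2_def)
    then show "pcoef (q powi 3) (g2_serre2 q) w = g2_rel5 q w / q^12"
      using w by (intro pcoef_ncoef[where k = 2]) (auto simp: tuples_def)
  qed
  have n4: "pcoef (q powi 3) (g2_poly4 q x y) w = ncoef q 3 24 (g2_poly4 q x y) w / q^24"
    if w: "w \<in> tuples {-1, 1} 4" for w x y
  proof -
    have "\<forall>w\<in>tuples {-1, 1} 4. \<forall>(c, u)\<in>set (g2_poly4 q x y). 0 \<le> int 24 + 3 * wdeg u w"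
      unfolding ball_tuples by (simp add: g2_poly4_def)
    then show ?thesis
      using w by (intro pcoef_ncoef[where k = 2]) (auto simp: tuples_def)
  qed
  have \<Delta>: "\<forall>w\<in>tuples {-1, 1} 4. \<Delta> w = g2_diff5 q (C^2) (D^2) w / (q^24 * C^12 * D^12)"
  proof
    fix w :: "int list" assume w: "w \<in> tuples {-1, 1} 4"
    show "\<Delta> w = g2_diff5 q (C^2) (D^2) w / (q^24 * C^12 * D^12)"
      unfolding \<Delta>_def P_def P'_def n4[OF w] by (rule g2_diff5_eq[OF q_nonzero CD, rule_format, OF w])
  qed
  have "\<forall>w\<in>tuples {-1, 1} 4. \<Delta> w = (\<lambda>d. \<Delta> (z d) / \<rho> (z d)) (sum_list w) * \<rho> w"
  proof (rule graded_ratio)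
    show "\<forall>w\<in>tuples {-1, 1} 4. \<rho> (z (sum_list w)) \<noteq> 0
        \<and> \<Delta> w * \<rho> (z (sum_list w)) = \<Delta> (z (sum_list w)) * \<rho> w \<or> \<Delta> w = 0 \<and> \<rho> w = 0"
      using CD \<Delta> \<rho> unfolding ball_tuples
      by (simp add: z_def g2_diff5_relations g2_rel_nonzero g2_rel_values(11,12))
  qed
  then have "\<forall>w\<in>tuples {-1, 1} 4. ((q powi 3) powi (d - c)) powi sum_list w * pcoef (q powi 3) P w
      - pcoef (q powi 3) P' w
      = (\<lambda>d. \<Delta> (z d) / \<rho> (z d)) (sum_list w) * pcoef (q powi 3) (g2_serre2 q) w"
    by (simp only: n \<Delta>_def \<rho>_def)
  then have "f1 powi (d - c) * poly P = poly P' * f1 powi (d - c)"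
    by (rule conj_f1[where k = 2, rotated 4]) (simp_all add: g2_serre2 P_def P'_def)
  then show ?thesis by (simp add: P_def P'_def C_def D_def)
qed

theorem verma_G2:
  "f1 powi a * f2 powi (3 * a + b) * f1 powi (2 * a + b) * f2 powi (3 * a + 2 * b) * f1 powi (a + b) * f2 powi b
     = f2 powi b * f1 powi (a + b) * f2 powi (3 * a + 2 * b) * f1 powi (2 * a + b) * f2 powi (3 * a + b) * f1 powi a"
proof (rule int_eq_by_common_factor[where b = b])
  show "f1 powi a * f2 powi (3 * a + b) * f1 powi (2 * a + b) * f2 powi (3 * a + 2 * b) * f1 powi (a + b)
      * f2 powi b \<noteq> 0" for b
    using f1 f2 by simp
  define \<delta> where "\<delta> = br q * br (q^2) * br (q^3)"
  have \<delta>: "\<delta> \<noteq> 0" using br_nonzero by (simp add: \<delta>_def)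
  define c1 c2 c3 where "c1 = 1 / br (q^3)" and "c2 = c1 / \<delta>" and "c3 = c2 / br (q^6)"
  define c4 where "c4 c d = c3 / (br (q^2)^2 * q^10 * (q powi c)^6 * (q powi d)^6 / \<delta>) * (q^3 + 1 / q^3)" for c d
  define k1 where "k1 c = sc c1 * poly (g2_poly1 q (q powi c))" for c
  define k2 where "k2 c d = sc c2 * poly (g2_poly2 q (q powi c) (q powi c * q powi d))" for c d
  define k3 where "k3 c d = sc c3 * poly (g2_poly3 q (q powi c) (q powi d))" for c d
  define k4 where "k4 c d = sc (c4 c d) * poly (g2_poly4 q ((q powi c)^2) ((q powi d)^2))" for c d
  have 1: "f1 powi (c + 1) * f2 = k1 c * f1 powi c" for c
    using rescale[OF g2_step1 br_nonzero(3), of c 1] by (simp add: k1_def c1_def)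
  have 2: "f2 powi (c + d + 2) * k1 c = k2 c d * f2 powi (c + d)" for c d
    using rescale[OF g2_step2, of "q powi c" "c + d" c1] \<delta>
    by (simp add: k1_def k2_def c2_def \<delta>_def power_int_add)
  have 3: "f1 powi (d + 1) * k2 c d = k3 c d * f1 powi d" for c d
    using rescale[OF g2_step3 br_nonzero(4), of "q powi c" d c2] by (simp add: k2_def k3_def c3_def)
  have 4: "f2 powi (n + 1) * k3 c d = k4 c d * f2 powi n" if "n = 2 * d - c" for n c d
  proof -
    have "br (q^2)^2 * q^10 * (q powi c)^6 * (q powi d)^6 / \<delta> \<noteq> 0"
      using br_nonzero(2) \<delta> by simp
    moreover have "sc (br (q^2)^2 * q^10 * (q powi c)^6 * (q powi d)^6 / \<delta>)
        * (f2 powi (n + 1) * poly (g2_poly3 q (q powi c) (q powi d)))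
      = sc (q^3 + 1 / q^3) * poly (g2_poly4 q ((q powi c)^2) ((q powi d)^2)) * f2 powi n"
      using g2_step4[OF that] by (simp only: \<delta>_def)
    ultimately show ?thesis
      unfolding k3_def k4_def c4_def sc_mult[of _ "q^3 + 1 / q^3"] mult.assoc[of _ "sc (q^3 + 1 / q^3)"]
      by (intro rescale)
  qed
  have 5: "f1 powi (d - c) * k4 c d = k4 d c * f1 powi (d - c)" for c d
  proof -
    have "c4 c d = c4 d c" by (simp add: c4_def mult_ac)
    then show ?thesis
      unfolding k4_def sc_left_commute[of "f1 powi _"] g2_step5 mult.assoc by simp
  qed
  have comm: "f1 powi (n + 1) = f1 * f1 powi n" "f2 powi (n + 1) = f2 * f2 powi n" for n
    using f1 f2 by (simp_all add: power_int_add_1')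
  text \<open>Both sides at \<open>b + 1\<close> are built from \<open>k4\<close>, with the roles of \<open>c\<close> and \<open>d\<close> exchanged.\<close>
  have chain: "f2 powi (n + 1) * f1 powi (d + 1) * f2 powi (c + d + 2) * f1 powi (c + 1) * f2
      = k4 c d * (f2 powi n * f1 powi d * f2 powi (c + d) * f1 powi c)" if n: "n = 2 * d - c" for n c d
  proof -
    have "f2 powi (n + 1) * f1 powi (d + 1) * f2 powi (c + d + 2) * f1 powi (c + 1) * f2
        = f2 powi (n + 1) * (f1 powi (d + 1) * (f2 powi (c + d + 2) * k1 c)) * f1 powi c"
      by (simp only: mult.assoc 1)
    also have "\<dots> = f2 powi (n + 1) * (f1 powi (d + 1) * k2 c d) * (f2 powi (c + d) * f1 powi c)"
      by (simp only: mult.assoc 2)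
    also have "\<dots> = (f2 powi (n + 1) * k3 c d) * (f1 powi d * (f2 powi (c + d) * f1 powi c))"
      by (simp only: mult.assoc 3)
    also have "\<dots> = k4 c d * (f2 powi n * f1 powi d * f2 powi (c + d) * f1 powi c)"
      by (simp only: mult.assoc 4[OF n])
    finally show ?thesis .
  qed
  show "\<exists>x. f1 powi a * f2 powi (3 * a + (b + 1)) * f1 powi (2 * a + (b + 1)) * f2 powi (3 * a + 2 * (b + 1))
            * f1 powi (a + (b + 1)) * f2 powi (b + 1)
          = x * (f1 powi a * f2 powi (3 * a + b) * f1 powi (2 * a + b) * f2 powi (3 * a + 2 * b)
            * f1 powi (a + b) * f2 powi b) \<and>
        f2 powi (b + 1) * f1 powi (a + (b + 1)) * f2 powi (3 * a + 2 * (b + 1)) * f1 powi (2 * a + (b + 1))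
            * f2 powi (3 * a + (b + 1)) * f1 powi a
          = x * (f2 powi b * f1 powi (a + b) * f2 powi (3 * a + 2 * b) * f1 powi (2 * a + b)
            * f2 powi (3 * a + b) * f1 powi a)" for b
  proof (intro exI conjI)
    define c d where "c = a + b" and "d = 2 * a + b"
    have e: "3 * a + b = 2 * d - c" "3 * a + 2 * b = c + d" "a + b = c" "2 * a + b = d"
        "3 * a + (b + 1) = 2 * d - c + 1" "3 * a + 2 * (b + 1) = c + d + 2" "a + (b + 1) = c + 1"
        "2 * a + (b + 1) = d + 1" "b = 2 * c - d" "a = d - c"
      by (simp_all add: c_def d_def)
    have b: "f2 powi (b + 1) = f2 * f2 powi b" by (rule comm)
    have "f1 powi a * f2 powi (2 * d - c + 1) * f1 powi (d + 1) * f2 powi (c + d + 2) * f1 powi (c + 1) * f2 powi (b + 1)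
        = f1 powi a * (f2 powi (2 * d - c + 1) * f1 powi (d + 1) * f2 powi (c + d + 2) * f1 powi (c + 1) * f2) * f2 powi b"
      by (simp only: b mult.assoc)
    also have "\<dots> = (f1 powi a * k4 c d) * (f2 powi (2 * d - c) * f1 powi d * f2 powi (c + d) * f1 powi c * f2 powi b)"
      by (subst chain[OF refl]) (simp only: mult.assoc)
    also have "\<dots> = k4 d c * (f1 powi a * f2 powi (2 * d - c) * f1 powi d * f2 powi (c + d) * f1 powi c * f2 powi b)"
      unfolding e(10) by (simp only: 5 mult.assoc)
    finally show "f1 powi a * f2 powi (3 * a + (b + 1)) * f1 powi (2 * a + (b + 1)) * f2 powi (3 * a + 2 * (b + 1))
            * f1 powi (a + (b + 1)) * f2 powi (b + 1)
          = k4 d c * (f1 powi a * f2 powi (3 * a + b) * f1 powi (2 * a + b) * f2 powi (3 * a + 2 * b)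
            * f1 powi (a + b) * f2 powi b)"
      unfolding e(1-8) .
    have "f2 powi (b + 1) * f1 powi (c + 1) * f2 powi (c + d + 2) * f1 powi (d + 1) * f2 powi (2 * d - c + 1) * f1 powi a
        = (f2 powi (b + 1) * f1 powi (c + 1) * f2 powi (d + c + 2) * f1 powi (d + 1) * f2) * f2 powi (2 * d - c) * f1 powi a"
      by (simp only: comm(2)[of "2 * d - c"] mult.assoc add.commute[of d c])
    also have "\<dots> = k4 d c * (f2 powi b * f1 powi c * f2 powi (c + d) * f1 powi d * f2 powi (2 * d - c) * f1 powi a)"
      by (subst chain[OF e(9)]) (simp only: mult.assoc add.commute[of d c])
    finally show "f2 powi (b + 1) * f1 powi (a + (b + 1)) * f2 powi (3 * a + 2 * (b + 1)) * f1 powi (2 * a + (b + 1))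
            * f2 powi (3 * a + (b + 1)) * f1 powi a
          = k4 d c * (f2 powi b * f1 powi (a + b) * f2 powi (3 * a + 2 * b) * f1 powi (2 * a + b)
            * f2 powi (3 * a + b) * f1 powi a)"
      unfolding e(1-8) .
  qed
qed simp

end

section \<open>The algebra generated by the \<open>f\<^sub>i\<close>\<close>

lemma tvar_power: "tvar ^ n = Fract ([:0, 1:] ^ n) 1"
  by (induction n) (simp_all add: tvar_def One_fract_def)

lemma generic_q_tvar: "generic_q tvar"
proof
  show t: "tvar \<noteq> 0"
    by (simp add: tvar_def Zero_fract_def eq_fract)
  have pow: "n = 0" if "tvar ^ n = 1" for n
  proof -
    have "[:0, 1:] ^ n = (1 :: rat poly)"
      using that by (simp add: tvar_power One_fract_def eq_fract)
    then have "degree ([:0, 1:] ^ n :: rat poly) = 0" by simp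
    then show ?thesis by (simp add: degree_power_eq)
  qed
  fix n :: int
  assume "tvar powi n = 1"
  then show "n = 0"
    using pow[of "nat n"] pow[of "nat (- n)"] by (auto simp: power_int_def power_inverse split: if_splits)
qed

lemma generic_q_powi:
  assumes "generic_q (q :: 'f::field)" "r \<noteq> 0"
  shows "generic_q (q powi r)"
proof -
  interpret generic_q q by fact
  show ?thesis
    by unfold_locales (use assms(2) q_powi_inj[of _ 0] in \<open>auto simp: power_int_mult[symmetric]\<close>)
qed

lemma additive_zmul: "Modules.additive h \<Longrightarrow> h (zmul n x) = n * h x" for h :: "'a::ab_group_add \<Rightarrow> int"
proof -
  assume h: "Modules.additive h"
  then have "h (\<Sum>_<k. x) = int k * h x" for k :: nat
    by (induction k) (simp_all add: additive.zero additive.add algebra_simps)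
  then show ?thesis
    using h by (simp add: zmul_def additive.diff algebra_simps)
qed

lemma lcden_integral:
  fixes R :: "('i::finite, 'x, 'y) root_data"
  shows "lcden R > 0" and "of_nat (lcden R) * symz R i \<in> \<int>"
proof -
  define n where "n = (\<Prod>i\<in>UNIV. nat (snd (quotient_of (symz R i))))"
  have pos: "snd (quotient_of (symz R i)) > 0" for i
    by (rule quotient_of_denom_pos')
  have "of_nat n * symz R i \<in> \<int>" for i
  proof -
    obtain a b where ab: "quotient_of (symz R i) = (a, b)" by (cases "quotient_of (symz R i)")
    have "n = nat b * (\<Prod>j\<in>UNIV - {i}. nat (snd (quotient_of (symz R j))))"
      using prod.remove[of UNIV i "\<lambda>j. nat (snd (quotient_of (symz R j)))"] ab
      by (simp add: n_def)
    moreover have "of_nat (nat b) * symz R i = of_int a"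
      using pos[of i] quotient_of_div[OF ab] ab by simp
    ultimately have "of_nat n * symz R i
        = of_int a * of_nat (\<Prod>j\<in>UNIV - {i}. nat (snd (quotient_of (symz R j))))"
      by (metis mult.assoc mult.commute of_nat_mult)
    then show ?thesis by (simp del: of_nat_prod)
  qed
  moreover have "n > 0" using pos by (simp add: n_def)
  ultimately have "lcden R > 0 \<and> (\<forall>i. of_nat (lcden R) * symz R i \<in> \<int>)"
    unfolding lcden_def by (intro LeastI_ex[of "\<lambda>n. n > 0 \<and> (\<forall>i. of_nat n * symz R i \<in> \<int>)"]) blast
  then show "lcden R > 0" and "of_nat (lcden R) * symz R i \<in> \<int>" by auto
qed

locale weyl_setting =
  fixes R :: "('i::finite, 'x::ab_group_add, 'y::ab_group_add) root_data"
    and Q :: "('i, 'b::ring_1, 'y, 'k::division_ring) alg_data"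
  assumes gcm: "gcm (cartan R)"
    and symmetrized: "symmetrized_by (cartan R) (symz R)"
    and root: "root_datum R"
    and alg: "alg_datum R Q"
    and fgen0_nonzero: "\<And>i. fgen0 R Q i \<noteq> 0"
begin

abbreviation a where "a \<equiv> cartan R"

lemma cartan_diag: "a i i = 2" and cartan_nonpos: "i \<noteq> j \<Longrightarrow> a i j \<le> 0"
  using gcm by (auto simp: gcm_def)

definition N :: "'i \<Rightarrow> int" where
  "N i = \<lfloor>of_nat (lcden R) * symz R i\<rfloor>"

lemma N_eq: "of_int (N i) = of_nat (lcden R) * symz R i"
  using lcden_integral(2)[of R i] by (auto simp: N_def elim!: Ints_cases)

lemma N_pos: "N i > 0"
proof -
  have "(of_int (N i) :: rat) > 0"
    using lcden_integral(1)[of R] symmetrized by (simp add: N_eq symmetrized_by_def)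
  then show ?thesis by simp
qed

lemma N_cartan: "N i * a i j = N j * a j i"
proof -
  have "(of_int (N i * a i j) :: rat) = of_int (N j * a j i)"
    using symmetrized by (simp add: N_eq symmetrized_by_def mult.assoc)
  then show ?thesis by (simp only: of_int_eq_iff)
qed

lemma qi_eq: "qi R i = tvar powi N i"
  by (simp add: qi_def qpow_def N_def)

lemma generic_qi: "generic_q (qi R i)"
  unfolding qi_eq using N_pos[of i] by (intro generic_q_powi generic_q_tvar) simp

lemma emb: "inj (emb Q)" "emb Q 1 = 1" "emb Q (x + y) = emb Q x + emb Q y"
    "emb Q (x * y) = emb Q x * emb Q y"
  and emb_right: "\<exists>x y. y \<noteq> 0 \<and> z = emb Q x * inverse (emb Q y)"
  using alg by (auto simp: alg_datum_def skew_field_of_fractions_def)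

lemma emb_0 [simp]: "emb Q 0 = 0"
  using emb(3)[of 0 0] by simp

lemma emb_eq_0_iff [simp]: "emb Q x = 0 \<longleftrightarrow> x = 0"
  using emb(1) emb_0 by (metis injD)

definition E :: "'b \<Rightarrow> 'k" where
  "E b = emb Q (Poly_Mapping.single 0 b)"

lemma E_hom: "E 1 = 1" "E 0 = 0" "E (x + y) = E x + E y" "E (x * y) = E x * E y"
  "E (- x) = - E x" "E (x ^ n) = E x ^ n" "E x = 0 \<longleftrightarrow> x = 0"
proof -
  show *: "E 1 = 1" "E 0 = 0" "E (x + y) = E x + E y" "E (x * y) = E x * E y" for x y
    using emb(2) by (simp_all add: E_def single_add emb(3) mult_single flip: emb(4))
  show "E (- x) = - E x"
    using *(2) *(3)[of x "- x"] by (simp add: eq_neg_iff_add_eq_0 add.commute)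
  show "E (x ^ n) = E x ^ n"
    by (induction n) (simp_all add: *)
  show "E x = 0 \<longleftrightarrow> x = 0"
    by (metis E_def emb_eq_0_iff lookup_single_eq lookup_zero single_zero)
qed

lemma scaleA: "Vector_Spaces.vector_space (scaleA Q)"
    "scaleA Q c (x * y) = scaleA Q c x * y" "scaleA Q c (x * y) = x * scaleA Q c y"
proof -
  have "assoc_algebra (scaleA Q)"
    using alg by (simp add: alg_datum_def tempered_domain_def)
  then show "Vector_Spaces.vector_space (scaleA Q)"
    "scaleA Q c (x * y) = scaleA Q c x * y" "scaleA Q c (x * y) = x * scaleA Q c y"
    unfolding assoc_algebra_def by blast+
qed

definition sc :: "qfield \<Rightarrow> 'k" where
  "sc c = E (scaleA Q c 1)"

lemma E_scaleA: "E (scaleA Q c x) = sc c * E x"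
  using scaleA(2)[of c 1 x] by (simp add: sc_def flip: E_hom(4))

lemma central_E: "sc c * E x = E x * sc c"
  using scaleA(2)[of c 1 x] scaleA(3)[of c x 1] by (simp add: sc_def flip: E_hom(4))

lemma scaleA_laws: "scaleA Q 1 x = x" "scaleA Q 0 x = 0" "scaleA Q (c + d) x = scaleA Q c x + scaleA Q d x"
  "scaleA Q (c * d) x = scaleA Q c (scaleA Q d x)"
proof -
  interpret vector_space "scaleA Q" by (rule scaleA)
  show "scaleA Q 1 x = x" "scaleA Q 0 x = 0" "scaleA Q (c + d) x = scaleA Q c x + scaleA Q d x"
    "scaleA Q (c * d) x = scaleA Q c (scaleA Q d x)"
    by (simp_all add: scale_left_distrib)
qed

lemma single_decompose: "emb Q (Poly_Mapping.single v b) = E b * emb Q (Poly_Mapping.single v 1)"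
  by (simp add: E_def mult_single flip: emb(4))

lemma poly_mapping_induct:
  assumes "\<And>v b. P (Poly_Mapping.single v b)" "\<And>x y. P x \<Longrightarrow> P y \<Longrightarrow> P (x + y)"
  shows "P (x :: 'v \<Rightarrow>\<^sub>0 'c::comm_monoid_add)"
proof -
  have zero: "P 0" using assms(1)[of _ 0] by simp
  have "x = (\<Sum>v\<in>Poly_Mapping.keys x. Poly_Mapping.single v (Poly_Mapping.lookup x v))"
    by (rule poly_mapping_eqI) (auto simp: lookup_sum lookup_single when_def in_keys_iff)
  moreover have "P (\<Sum>v\<in>S. Poly_Mapping.single v (Poly_Mapping.lookup x v))" if "finite S" for S
    using that by (induction S rule: finite_induct) (auto intro: assms zero)
  ultimately show ?thesis by (metis finite_keys)
qed

lemma central_emb: "sc c * emb Q x = emb Q x * sc c"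
proof (induction x rule: poly_mapping_induct)
  case (1 v b)
  let ?w = "emb Q (Poly_Mapping.single v 1)"
  have w: "sc c * ?w = ?w * sc c"
    by (simp add: sc_def E_def mult_single flip: emb(4))
  have "sc c * (E b * ?w) = (sc c * E b) * ?w"
    by (simp only: mult.assoc)
  also have "\<dots> = E b * (sc c * ?w)"
    by (simp only: central_E mult.assoc)
  also have "\<dots> = E b * ?w * sc c"
    by (simp only: w mult.assoc)
  finally show ?case
    unfolding single_decompose[of v b] .
next
  case (2 x y)
  then show ?case by (simp add: emb(3) distrib_left distrib_right)
qed

sublocale central_scalars sc
proof
  show "sc 1 = 1" "sc (c + d) = sc c + sc d" "sc (c * d) = sc c * sc d" for c d
    using E_scaleA[of c "scaleA Q d 1"] by (simp_all add: sc_def scaleA_laws E_hom)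
  fix c x
  obtain u v where x: "x = emb Q u * inverse (emb Q v)" "v \<noteq> 0" using emb_right by blast
  let ?v = "emb Q v"
  have v: "?v \<noteq> 0" using x(2) by simp
  have "inverse ?v * sc c = inverse ?v * (sc c * ?v) * inverse ?v"
    using v by (simp add: mult.assoc)
  also have "\<dots> = sc c * inverse ?v"
    unfolding central_emb using v by (simp flip: mult.assoc)
  finally have v': "inverse ?v * sc c = sc c * inverse ?v" .
  show "sc c * x = x * sc c"
    unfolding x(1) mult.assoc v' unfolding mult.assoc[symmetric] central_emb ..
qed

lemma scalar_eq: "scalar Q c = sc c"
  by (simp add: scalar_def of_U0_def const0_def sc_def E_def scaleA_laws)

lemma qexp_eq: "qexp Q v = emb Q (Poly_Mapping.single v 1)"
  by (simp add: qexp_def of_U0_def qexp0_def scaleA_laws)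

lemma fgen_eq: "fgen R Q i = E (fgen0 R Q i)" and fgen_nonzero: "fgen R Q i \<noteq> 0"
proof -
  show "fgen R Q i = E (fgen0 R Q i)" by (simp add: fgen_def E_def)
  then show "fgen R Q i \<noteq> 0" using fgen0_nonzero by (simp add: E_hom(7))
qed

end

lemma (in ring_1) ring_of_type_algebra_ring: "ring (ring_of_type_algebra :: 'a ring)"
proof -
  have "\<exists>y. x + y = 0" for x :: 'a
    using add.right_inverse by blast
  then show ?thesis
    unfolding ring_of_type_algebra_def using add.right_inverse
    by unfold_locales (auto simp: algebra_simps Units_def)
qed

lemma (in generic_q) qbinom_symmetric:
  assumes "k \<le> n"
  shows "qbinom q (int n) (n - k) = qbinom q (int n) k"
proof -
  have fact: "qfact q (n - k) * (\<Prod>\<nu><k. qnum q (int n - int \<nu>)) = qfact q n" if "k \<le> n" for k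
    using that
  proof (induction k)
    case (Suc k)
    then have "qfact q (n - k) = qfact q (n - Suc k) * qnum q (int n - int k)"
      using qfact_Suc[of "n - Suc k"] by (simp add: Suc_diff_Suc of_nat_diff algebra_simps)
    then show ?case using Suc by (simp add: mult_ac)
  qed simp
  have binom: "qbinom q (int n) k = qfact q n / (qfact q k * qfact q (n - k))" if "k \<le> n" for k
    using fact[OF that] qfact_nonzero[of "n - k"]
    by (simp add: qbinom_def field_simps)
  show ?thesis using binom[OF assms] binom[of "n - k"] assms by (simp add: mult.commute)
qed

context weyl_setting
begin

definition pr :: "'i free_alg \<Rightarrow> 'b" where
  "pr x = proj Q (Uq_class R x)"

lemma quotient: "quotient_of_Uq_minus R (scaleA Q) (proj Q)"
  using alg by (simp add: alg_datum_def)

lemma serre_ideal: "ideal (serre_ideal R) ring_of_type_algebra"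
  unfolding serre_ideal_def
  by (intro ring.genideal_ideal ring_of_type_algebra_ring) (simp add: ring_of_type_algebra_def)

lemma pr_hom: "pr (x + y) = pr x + pr y" "pr (x * y) = pr x * pr y" "pr 1 = 1"
proof -
  have c: "x \<in> carrier ring_of_type_algebra" for x :: "'i free_alg"
    by (simp add: ring_of_type_algebra_def)
  have cl: "Uq_class R x \<in> carrier (Uq_minus R)"
    and cls: "Uq_class R (x * y) = Uq_class R x \<otimes>\<^bsub>Uq_minus R\<^esub> Uq_class R y"
      "Uq_class R (x + y) = Uq_class R x \<oplus>\<^bsub>Uq_minus R\<^esub> Uq_class R y"
      "Uq_class R 1 = \<one>\<^bsub>Uq_minus R\<^esub>" for x y
    using ring_hom_memE(1-4)[OF ideal.rcos_ring_hom[OF serre_ideal]] c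
    unfolding Uq_class_def Uq_minus_def
    by (simp_all add: ring_of_type_algebra_def)
  have hom: "proj Q \<in> ring_hom (Uq_minus R) ring_of_type_algebra"
    using quotient by (simp add: quotient_of_Uq_minus_def)
  show "pr (x + y) = pr x + pr y" "pr (x * y) = pr x * pr y" "pr 1 = 1"
    unfolding pr_def cls
    using ring_hom_memE(2-4)[OF hom] cl by (simp_all add: ring_of_type_algebra_def)
qed

lemma pr_scale: "pr (free_const c * x) = scaleA Q c (pr x)"
  using quotient by (simp add: quotient_of_Uq_minus_def pr_def)

lemma pr_surj: "\<exists>x. pr x = b"
proof -
  have "carrier (Uq_minus R) = range (Uq_class R)"
    unfolding Uq_minus_def Uq_class_def FactRing_def A_RCOSETS_def'
    by (auto simp: ring_of_type_algebra_def)
  then have "b \<in> proj Q ` range (Uq_class R)"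
    using quotient by (simp add: quotient_of_Uq_minus_def)
  then show ?thesis unfolding pr_def by blast
qed

lemma pr_0: "pr 0 = 0"
  using pr_hom(1)[of 0 0] by simp

lemma pr_serre: "i \<noteq> j \<Longrightarrow> pr (serre R i j) = 0"
proof -
  assume "i \<noteq> j"
  interpret ideal "serre_ideal R" ring_of_type_algebra by (rule serre_ideal)
  have "serre R i j \<in> serre_ideal R"
    unfolding serre_ideal_def
    using \<open>i \<noteq> j\<close> ring.genideal_self[OF ring_of_type_algebra_ring, of "{serre R i j |i j. i \<noteq> j}"]
    by (auto simp: ring_of_type_algebra_def)
  moreover have "0 \<in> serre_ideal R"
    using additive_subgroup.zero_closed[OF is_additive_subgroup] by (simp add: ring_of_type_algebra_def)
  ultimately have "Uq_class R (serre R i j) = Uq_class R 0"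
    unfolding Uq_class_def by (simp add: a_rcos_const)
  then show ?thesis using pr_0 by (simp add: pr_def)
qed

lemma pr_free_gen: "pr (free_gen i) = fgen0 R Q i"
  by (simp add: pr_def fgen0_def)

lemma pr_power: "pr (x ^ n) = pr x ^ n"
  by (induction n) (simp_all add: pr_hom)

lemma pr_sum: "pr (\<Sum>i\<in>A. x i) = (\<Sum>i\<in>A. pr (x i))"
  by (induction A rule: infinite_finite_induct) (simp_all add: pr_0 pr_hom)

lemma pr_uminus: "pr (- x) = - pr x"
  using pr_hom(1)[of x "- x"] by (simp add: pr_0 eq_neg_iff_add_eq_0 add.commute)

lemma b_generated:
  assumes "\<And>c. P (scaleA Q c 1)" "\<And>i. P (fgen0 R Q i)"
    and "\<And>x y. P x \<Longrightarrow> P y \<Longrightarrow> P (x + y)" "\<And>x y. P x \<Longrightarrow> P y \<Longrightarrow> P (x * y)"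
  shows "P b"
proof -
  have word: "P (pr (Poly_Mapping.single (FMon w) 1))" for w
  proof (induction w)
    case Nil
    have "Poly_Mapping.single (FMon []) 1 = (1 :: 'i free_alg)"
      unfolding zero_fmon_def[symmetric] by (rule single_one)
    then show ?case using assms(1)[of 1] by (simp add: pr_hom(3) scaleA_laws)
  next
    case (Cons i w)
    have "Poly_Mapping.single (FMon (i # w)) 1 = free_gen i * Poly_Mapping.single (FMon w) 1"
      by (simp add: free_gen_def mult_single)
    then show ?case using Cons assms(2,4) by (simp add: pr_hom pr_free_gen)
  qed
  have "P (pr x)" for x
  proof (induction x rule: poly_mapping_induct)
    case (1 v c)
    obtain w where w: "v = FMon w" by (cases v)
    have "Poly_Mapping.single v c = free_const c * Poly_Mapping.single (FMon w) 1"
      by (simp add: w free_const_def mult_single)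
    then have "pr (Poly_Mapping.single v c) = scaleA Q c 1 * pr (Poly_Mapping.single (FMon w) 1)"
      using scaleA(2)[of c 1 "pr (Poly_Mapping.single (FMon w) 1)"] by (simp add: pr_scale)
    then show ?case using word assms(1,4) by simp
  next
    case (2 x y)
    then show ?case using assms(3) by (simp add: pr_hom)
  qed
  then show ?thesis using pr_surj[of b] by blast
qed

lemma serre_fgen:
  assumes "i \<noteq> j"
  shows "(\<Sum>k\<le>nat (1 - a i j). (- 1) ^ k * sc (qbinom (qi R i) (1 - a i j) k)
    * fgen R Q i ^ k * fgen R Q j * fgen R Q i ^ (nat (1 - a i j) - k)) = 0"
proof -
  have const: "pr (free_const c) = scaleA Q c 1" for c
    using pr_scale[of c 1] by (simp add: pr_hom)
  have sumE: "E (\<Sum>i\<in>A. x i) = (\<Sum>i\<in>A. E (x i))" for A and x :: "nat \<Rightarrow> 'b"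
    by (induction A rule: infinite_finite_induct) (simp_all add: E_hom)
  have "E (pr (serre R i j)) = 0"
    using pr_serre[OF assms] by (simp add: E_hom)
  then show ?thesis
    unfolding serre_def Let_def pr_sum sumE
    by (simp add: const pr_hom pr_power pr_uminus pr_free_gen E_hom fgen_eq flip: sc_def)
qed

lemma q_serre:
  assumes "i \<noteq> j"
  shows "q_serre sc (qi R i) (fgen R Q i) (fgen R Q j) (a i j)"
proof -
  interpret generic_q "qi R i" by (rule generic_qi)
  interpret q_conjugation sc "qi R i" "fgen R Q i" "fgen R Q j" "a i j"
    by unfold_locales (use fgen_nonzero cartan_nonpos[OF assms] in auto)
  define n where "n = nat (1 - a i j)"
  have n: "int n = 1 - a i j" using a_nonpos by (simp add: n_def)
  let ?t = "\<lambda>k. sc (qbinom (qi R i) (int n) k) * fgen R Q i ^ k * fgen R Q j * fgen R Q i ^ (n - k)"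
  have "adp n = (\<Sum>k\<le>n. (- 1) ^ (n - k) * ?t k)"
  proof -
    have "adp n = (\<Sum>\<nu>\<le>n. (- 1) ^ \<nu> * sc (qbinom (qi R i) (int n) \<nu>)
        * fgen R Q i ^ (n - \<nu>) * fgen R Q j * fgen R Q i ^ \<nu>)"
      by (simp add: adp_def n)
    also have "\<dots> = (\<Sum>k\<le>n. (- 1) ^ (n - k) * sc (qbinom (qi R i) (int n) (n - k))
        * fgen R Q i ^ (n - (n - k)) * fgen R Q j * fgen R Q i ^ (n - k))"
      by (subst (1) atMost_atLeast0, subst sum.atLeastAtMost_rev) (simp only: add_0_right atMost_atLeast0)
    also have "\<dots> = (\<Sum>k\<le>n. (- 1) ^ (n - k) * ?t k)"
      by (intro sum.cong refl) (simp add: qbinom_symmetric; simp only: mult.assoc)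
    finally show ?thesis .
  qed
  also have "\<dots> = (- 1) ^ n * (\<Sum>k\<le>n. (- 1) ^ k * ?t k)"
    unfolding sum_distrib_left
  proof (intro sum.cong refl)
    fix k assume "k \<in> {..n}"
    then have "(- 1) ^ n * (- 1) ^ k = ((- 1) ^ (n - k) :: 'k)"
      by (auto simp: minus_one_power_iff)
    then show "(- 1) ^ (n - k) * ?t k = (- 1) ^ n * ((- 1) ^ k * ?t k)"
      by (simp flip: mult.assoc)
  qed
  also have "\<dots> = 0"
    using serre_fgen[OF assms] by (simp add: n_def[symmetric] n[symmetric] mult.assoc)
  finally show ?thesis
    by unfold_locales (simp add: n_def)
qed

lemma ad_pow_eq: "i \<noteq> j \<Longrightarrow>
    ad_pow R Q i k j = q_conjugation.adp sc (qi R i) (fgen R Q i) (fgen R Q j) (a i j) k"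
proof -
  assume "i \<noteq> j"
  then interpret q_serre sc "qi R i" "fgen R Q i" "fgen R Q j" "a i j" by (rule q_serre)
  show ?thesis unfolding ad_pow_def adp_def scalar_eq ..
qed

lemma conjugation_fgen:
  assumes "i \<noteq> j"
  shows "fgen R Q i powi n * fgen R Q j * fgen R Q i powi (- n) =
    (\<Sum>k = 0..nat (- a i j). sc (qi R i powi ((int k + a i j) * (n - int k)) * qbinom (qi R i) n k)
       * ad_pow R Q i k j * inverse (fgen R Q i) ^ k)"
proof -
  interpret q_serre sc "qi R i" "fgen R Q i" "fgen R Q j" "a i j" by (rule q_serre[OF assms])
  show ?thesis unfolding ad_pow_eq[OF assms] conjugation_by_power ..
qed

end

section \<open>Evaluation at points of the dual lattice\<close>

fun numerator :: "'y dlat \<Rightarrow> 'y" where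
  "numerator (OverD y) = y"

lemma additive_numerator: "Modules.additive h \<Longrightarrow> Modules.additive (\<lambda>v. h (numerator v))"
  for h :: "'y::ab_group_add \<Rightarrow> int"
proof
  fix v w :: "'y dlat"
  assume "Modules.additive h"
  then show "h (numerator (v + w)) = h (numerator v) + h (numerator w)"
    by (cases v; cases w) (simp add: additive.add)
qed

lemma numerator_inject: "numerator v = numerator w \<longleftrightarrow> v = w"
  by (cases v; cases w) simp

definition chi :: "('y \<Rightarrow> int) \<Rightarrow> 'y dlat \<Rightarrow> qfield" where
  "chi h v = tvar powi h (numerator v)"

lemma tvar_nonzero: "tvar \<noteq> 0"
  by (rule generic_q.q_nonzero[OF generic_q_tvar])

lemma chi_add: "Modules.additive h \<Longrightarrow> chi h (v + w) = chi h v * chi h w"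
  using additive.add[OF additive_numerator, of h] by (simp add: chi_def power_int_add tvar_nonzero)

lemma chi_0: "Modules.additive h \<Longrightarrow> chi h 0 = 1"
  using additive.zero[OF additive_numerator, of h] by (simp add: chi_def)

lemma pairing_nonvanishing:
  fixes p :: "'y::ab_group_add \<Rightarrow> 'x::ab_group_add \<Rightarrow> int"
  assumes p: "perfect_pairing p" and "finite D" "0 \<notin> D"
  shows "\<exists>x. \<forall>d\<in>D. p d x \<noteq> 0"
  using assms(2,3)
proof (induction D rule: finite_induct)
  case (insert d D)
  then obtain x where x: "\<forall>e\<in>D. p e x \<noteq> 0" by auto
  have add: "p e (zmul n x + y) = n * p e x + p e y" for e n y
    using p additive_zmul[of "p e"] by (simp add: perfect_pairing_def additive.add)
  have "p d \<noteq> p 0"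
    using p insert.prems by (auto simp: perfect_pairing_def bij_betw_def dest: injD)
  then obtain x' where x': "p d x' \<noteq> p 0 x'" by auto
  have "p 0 x' = 0"
    using p additive.zero[of "\<lambda>y. p y x'"] by (simp add: perfect_pairing_def)
  with x' have x': "p d x' \<noteq> 0" by simp
  define bad where "bad e = {n. n * p e x + p e x' = 0}" for e
  have "finite (bad e)" if "e \<in> insert d D" for e
  proof (cases "p e x = 0")
    case True
    then have "bad e = {}" using that x x' by (auto simp: bad_def)
    then show ?thesis by simp
  next
    case False
    have "bad e \<subseteq> {- p e x' div p e x}"
    proof
      fix n assume "n \<in> bad e"
      then have "- p e x' = n * p e x" by (simp add: bad_def)
      then show "n \<in> {- p e x' div p e x}" using False by simp
    qed
    then show ?thesis by (rule finite_subset) simp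
  qed
  then have "finite (\<Union>e\<in>insert d D. bad e)" using insert.hyps by blast
  then obtain n where "n \<notin> (\<Union>e\<in>insert d D. bad e)"
    using ex_new_if_finite infinite_UNIV_int by blast
  then have "\<forall>e\<in>insert d D. p e (zmul n x + x') \<noteq> 0" by (auto simp: bad_def add)
  then show ?case ..
qed simp

lemma pairing_separates:
  fixes p :: "'y::ab_group_add \<Rightarrow> 'x::ab_group_add \<Rightarrow> int"
  assumes p: "perfect_pairing p" and "finite S"
  shows "\<exists>x. inj_on (\<lambda>y. p y x) S"
proof -
  define D where "D = {y - y' | y y'. y \<in> S \<and> y' \<in> S} - {0}"
  have "D \<subseteq> (\<lambda>(y, y'). y - y') ` (S \<times> S)" by (auto simp: D_def)
  then have "finite D" using assms(2) by (meson finite_SigmaI finite_imageI finite_subset)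
  then obtain x where x: "\<forall>d\<in>D. p d x \<noteq> 0"
    using pairing_nonvanishing[OF p, of D] by (auto simp: D_def)
  have "p (y - y') x = p y x - p y' x" for y y'
    using p additive.diff[of "\<lambda>y. p y x"] by (simp add: perfect_pairing_def)
  have "inj_on (\<lambda>y. p y x) S"
  proof (intro inj_onI, rule ccontr)
    fix y y' assume "y \<in> S" "y' \<in> S" "p y x = p y' x" "y \<noteq> y'"
    moreover from this have "y - y' \<in> D" by (auto simp: D_def)
    ultimately show False using x \<open>\<And>y y'. p (y - y') x = p y x - p y' x\<close> by fastforce
  qed
  then show ?thesis ..
qed

context weyl_setting
begin

definition evl :: "('c::ring_1 \<Rightarrow> 'k) \<Rightarrow> ('y \<Rightarrow> int) \<Rightarrow> ('y dlat \<Rightarrow>\<^sub>0 'c) \<Rightarrow> 'k" where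
  "evl e h x = (\<Sum>v\<in>Poly_Mapping.keys x. sc (chi h v) * e (Poly_Mapping.lookup x v))"

lemma evl_superset:
  assumes "e 0 = 0" "finite S" "Poly_Mapping.keys x \<subseteq> S"
  shows "evl e h x = (\<Sum>v\<in>S. sc (chi h v) * e (Poly_Mapping.lookup x v))"
  unfolding evl_def using assms
  by (intro sum.mono_neutral_left) (auto simp: in_keys_iff)

lemma evl_single: "e 0 = 0 \<Longrightarrow> evl e h (Poly_Mapping.single v b) = sc (chi h v) * e b"
  by (subst evl_superset[where S = "{v}"]) auto

lemma evl_add:
  assumes "e 0 = 0" "\<And>b c. e (b + c) = e b + e c"
  shows "evl e h (x + y) = evl e h x + evl e h y"
proof -
  let ?S = "Poly_Mapping.keys x \<union> Poly_Mapping.keys y"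
  have "Poly_Mapping.keys (x + y) \<subseteq> ?S" by (rule Poly_Mapping.keys_add)
  then show ?thesis
    using assms evl_superset[of e ?S x h] evl_superset[of e ?S y h] evl_superset[of e ?S "x + y" h]
    by (simp add: lookup_add distrib_left sum.distrib)
qed

lemma evl_mult:
  assumes h: "Modules.additive h"
    and e: "e 0 = 0" "\<And>b c. e (b + c) = e b + e c" "\<And>b c. e (b * c) = e b * e c"
  shows "evl e h (x * y) = evl e h x * evl e h y"
proof (induction x rule: poly_mapping_induct)
  case (1 v b)
  show ?case
  proof (induction y rule: poly_mapping_induct)
    case (1 w c)
    have "sc (chi h v) * sc (chi h w) * (e b * e c) = sc (chi h v) * (sc (chi h w) * e b) * e c"
      by (simp only: mult.assoc)
    also have "\<dots> = sc (chi h v) * e b * (sc (chi h w) * e c)"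
      unfolding sc_commute[of "chi h w" "e b"] by (simp only: mult.assoc)
    finally show ?case
      using e by (simp add: mult_single evl_single chi_add[OF h] sc_mult)
  qed (simp add: distrib_left evl_add[OF e(1,2)])
qed (simp add: distrib_right evl_add[OF e(1,2)])

abbreviation ev where "ev \<equiv> evl E"

lemma ev_single: "ev h (Poly_Mapping.single v b) = sc (chi h v) * E b"
  by (simp add: evl_single E_hom)

lemma ev_add: "ev h (x + y) = ev h x + ev h y"
  by (simp add: evl_add E_hom)

lemma ev_mult: "Modules.additive h \<Longrightarrow> ev h (x * y) = ev h x * ev h y"
  by (simp add: evl_mult E_hom)

lemma ev_0 [simp]: "ev h 0 = 0"
  by (simp add: evl_def)

lemma ev_1: "Modules.additive h \<Longrightarrow> ev h 1 = 1"
  using ev_single[of h 0 1] by (simp add: chi_0 E_hom)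

definition generic :: "(('y \<Rightarrow> int) \<Rightarrow> bool) \<Rightarrow> bool" where
  "generic P \<longleftrightarrow> (\<exists>b\<noteq>0. \<forall>h. Modules.additive h \<longrightarrow> ev h b \<noteq> 0 \<longrightarrow> P h)"

lemma genericI: "(\<And>h. Modules.additive h \<Longrightarrow> P h) \<Longrightarrow> generic P"
  unfolding generic_def by (intro exI[of _ 1]) simp

lemma generic_nonzero: "b \<noteq> 0 \<Longrightarrow> generic (\<lambda>h. ev h b \<noteq> 0)"
  unfolding generic_def by blast

lemma emb_mult_nonzero: "(b :: 'y dlat \<Rightarrow>\<^sub>0 'b) \<noteq> 0 \<Longrightarrow> c \<noteq> 0 \<Longrightarrow> b * c \<noteq> 0"
  using emb(4)[of b c] by (metis emb_eq_0_iff mult_eq_0_iff)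

lemma generic_mp2:
  assumes "generic P" "generic P'"
    and "\<And>h. Modules.additive h \<Longrightarrow> P h \<Longrightarrow> P' h \<Longrightarrow> P'' h"
  shows "generic P''"
proof -
  obtain b c where bc: "b \<noteq> 0" "\<forall>h. Modules.additive h \<longrightarrow> ev h b \<noteq> 0 \<longrightarrow> P h"
    "c \<noteq> 0" "\<forall>h. Modules.additive h \<longrightarrow> ev h c \<noteq> 0 \<longrightarrow> P' h"
    using assms(1,2) unfolding generic_def by blast
  show ?thesis
    unfolding generic_def
    by (intro exI[of _ "b * c"]) (use bc assms(3) in \<open>simp add: emb_mult_nonzero ev_mult\<close>)
qed

lemma generic_mp:
  assumes "generic P" "\<And>h. Modules.additive h \<Longrightarrow> P h \<Longrightarrow> P' h"
  shows "generic P'"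
  by (rule generic_mp2[OF assms(1,1)]) (use assms(2) in blast)

lemma generic_conj: "generic P \<Longrightarrow> generic P' \<Longrightarrow> generic (\<lambda>h. P h \<and> P' h)"
  by (rule generic_mp2[of P P']) simp_all

lemma generic_ex:
  assumes "generic P"
  shows "\<exists>h. Modules.additive h \<and> P h"
proof -
  obtain b where b: "b \<noteq> 0" "\<And>h. Modules.additive h \<Longrightarrow> ev h b \<noteq> 0 \<Longrightarrow> P h"
    using assms unfolding generic_def by blast
  have p: "perfect_pairing (pairing R)" using root by (simp add: root_datum_def)
  obtain x where x: "inj_on (\<lambda>y. pairing R y x) (numerator ` Poly_Mapping.keys b)"
    using pairing_separates[OF p] finite_keys by blast
  define h where "h n y = int n * pairing R y x" for n y
  have h: "Modules.additive (h n)" for n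
    using p additive.add[of "\<lambda>y. pairing R y x"]
    by unfold_locales (simp add: h_def perfect_pairing_def distrib_left)
  define l where "l v = tvar powi pairing R (numerator v) x" for v
  have l: "inj_on l (Poly_Mapping.keys b)"
    using x by (auto simp: inj_on_def l_def generic_q.q_powi_inj[OF generic_q_tvar] numerator_inject)
  have chi: "chi (h n) v = l v ^ n" for n v
    by (simp only: chi_def h_def l_def mult.commute[of "int n"] power_int_mult power_int_of_nat)
  have "\<exists>n. ev (h n) b \<noteq> 0"
  proof (rule ccontr)
    assume "\<not> ?thesis"
    then have zero: "(\<Sum>v\<in>Poly_Mapping.keys b. sc (l v ^ n) * E (Poly_Mapping.lookup b v)) = 0" for n
      by (auto simp: evl_def chi)
    have "\<not> v \<in> Poly_Mapping.keys b" for v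
      using vandermonde[OF finite_keys l zero] by (auto simp: E_hom(7) in_keys_iff)
    then show False using b(1) by (metis ex_in_conv keys_eq_empty)
  qed
  then show ?thesis using b(2) h by blast
qed

definition iota :: "'k \<Rightarrow> ('y \<Rightarrow> int) \<Rightarrow> 'k" where
  "iota z h = (let ab = SOME ab. snd ab \<noteq> 0 \<and> z = emb Q (fst ab) * inverse (emb Q (snd ab))
     in ev h (fst ab) * inverse (ev h (snd ab)))"

lemma ore:
  fixes b c :: "'y dlat \<Rightarrow>\<^sub>0 'b"
  assumes b: "b \<noteq> 0"
  shows "\<exists>p p'. p' \<noteq> 0 \<and> c * p' = b * p"
proof -
  obtain p p' where p: "p' \<noteq> 0" "inverse (emb Q b) * emb Q c = emb Q p * inverse (emb Q p')"
    using emb_right by blast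
  have "emb Q (c * p') = emb Q b * (inverse (emb Q b) * emb Q c) * emb Q p'"
    using b by (simp add: emb(4) flip: mult.assoc)
  also have "\<dots> = emb Q (b * p)"
    unfolding p(2) using p(1) by (simp add: emb(4) mult.assoc)
  finally show ?thesis using p(1) emb(1) by (auto dest: injD)
qed

lemma iota_frac:
  assumes "b \<noteq> 0" "z = emb Q u * inverse (emb Q b)"
  shows "generic (\<lambda>h. iota z h = ev h u * inverse (ev h b))"
proof -
  obtain u' b' where ab': "b' \<noteq> 0" "z = emb Q u' * inverse (emb Q b')"
    and iota: "\<And>h. iota z h = ev h u' * inverse (ev h b')"
  proof -
    let ?P = "\<lambda>ab. snd ab \<noteq> 0 \<and> z = emb Q (fst ab) * inverse (emb Q (snd ab))"
    define ub where "ub = (SOME ab. ?P ab)"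
    have "?P ub" unfolding ub_def using assms by (intro someI[of ?P "(u, b)"]) simp
    moreover have "iota z h = ev h (fst ub) * inverse (ev h (snd ub))" for h
      by (simp add: iota_def ub_def Let_def)
    ultimately show ?thesis using that by blast
  qed
  obtain p p' where p: "p' \<noteq> 0" "b' * p' = b * p" using ore[OF assms(1)] by blast
  have inv: "inverse (emb Q (x * y)) = inverse (emb Q y) * inverse (emb Q x)" if "x \<noteq> 0" "y \<noteq> 0" for x y
    using that by (simp add: emb(4) nonzero_inverse_mult_distrib)
  have "b * p \<noteq> 0" using emb_mult_nonzero[OF ab'(1) p(1)] p(2) by simp
  then have "p \<noteq> 0" by auto
  have "emb Q (u' * p') = z * emb Q (b' * p')"
    unfolding ab'(2) using ab'(1) by (simp add: emb(4) mult.assoc) (simp flip: mult.assoc)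
  also have "\<dots> = emb Q (u * p)"
    unfolding p(2) assms(2) using assms(1) by (simp add: emb(4) mult.assoc) (simp flip: mult.assoc)
  finally have u: "u' * p' = u * p" using emb(1) by (auto dest: injD)
  have frac: "ev h x * inverse (ev h y) = ev h (x * p) * inverse (ev h (y * p))"
    if "Modules.additive h" "ev h (y * p) \<noteq> 0" for h x y p
    using that by (simp add: ev_mult nonzero_inverse_mult_distrib mult.assoc)
      (simp flip: mult.assoc)
  show ?thesis
    using generic_nonzero[OF \<open>b * p \<noteq> 0\<close>]
  proof (rule generic_mp)
    fix h :: "'y \<Rightarrow> int"
    assume h: "Modules.additive h" "ev h (b * p) \<noteq> 0"
    show "iota z h = ev h u * inverse (ev h b)"
      unfolding iota using frac[of h b' p' u'] frac[of h b p u] h by (simp add: p(2) u)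
  qed
qed

lemma iota_emb: "generic (\<lambda>h. iota (emb Q x) h = ev h x)"
  by (rule generic_mp[OF iota_frac[of 1 _ x]]) (simp_all add: emb(2) ev_1)

lemma iota_mult: "generic (\<lambda>h. iota (x * y) h = iota x h * iota y h)"
proof -
  obtain u b where ab: "b \<noteq> 0" "x = emb Q u * inverse (emb Q b)" using emb_right by blast
  obtain c d where cd: "d \<noteq> 0" "y = emb Q c * inverse (emb Q d)" using emb_right by blast
  obtain p p' where p: "p' \<noteq> 0" "c * p' = b * p" using ore[OF ab(1)] by blast
  have dp: "d * p' \<noteq> 0" using cd(1) p(1) by (rule emb_mult_nonzero)
  have "emb Q c = emb Q b * emb Q p * inverse (emb Q p')"
    using p(1) by (simp add: mult.assoc flip: emb(4) p(2)) (simp add: emb(4) mult.assoc)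
  then have xy: "x * y = emb Q (u * p) * inverse (emb Q (d * p'))"
    unfolding ab(2) cd(2) using ab(1) cd(1) p(1)
    by (simp add: emb(4) nonzero_inverse_mult_distrib mult.assoc) (simp flip: mult.assoc)
  show ?thesis
  proof (rule generic_mp2[OF generic_conj[OF iota_frac[OF ab] iota_frac[OF cd]]
        generic_conj[OF iota_frac[OF dp xy] generic_nonzero[OF emb_mult_nonzero[OF ab(1) dp]]]])
    fix h :: "'y \<Rightarrow> int"
    assume h: "Modules.additive h"
      "iota x h = ev h u * inverse (ev h b) \<and> iota y h = ev h c * inverse (ev h d)"
      "iota (x * y) h = ev h (u * p) * inverse (ev h (d * p')) \<and> ev h (b * (d * p')) \<noteq> 0"
    have "ev h c * ev h p' = ev h b * ev h p"
      using h(1) p(2) by (simp flip: ev_mult)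
    moreover have "ev h b \<noteq> 0" "ev h d \<noteq> 0" "ev h p' \<noteq> 0"
      using h by (auto simp: ev_mult)
    ultimately have "ev h c = ev h b * ev h p * inverse (ev h p')"
      by (metis mult.assoc right_inverse mult_1_right)
    with h \<open>ev h b \<noteq> 0\<close> \<open>ev h d \<noteq> 0\<close> \<open>ev h p' \<noteq> 0\<close>
    show "iota (x * y) h = iota x h * iota y h"
      by (simp add: ev_mult nonzero_inverse_mult_distrib mult.assoc) (simp flip: mult.assoc)
  qed
qed

lemma iota_add: "generic (\<lambda>h. iota (x + y) h = iota x h + iota y h)"
proof -
  obtain u b where ab: "b \<noteq> 0" "x = emb Q u * inverse (emb Q b)" using emb_right by blast
  obtain c d where cd: "d \<noteq> 0" "y = emb Q c * inverse (emb Q d)" using emb_right by blast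
  obtain p p' where p: "p' \<noteq> 0" "d * p' = b * p" using ore[OF ab(1)] by blast
  define m where "m = d * p'"
  have m: "m \<noteq> 0" unfolding m_def using cd(1) p(1) by (rule emb_mult_nonzero)
  then have "p \<noteq> 0" using p(2) by (auto simp: m_def)
  have frac: "emb Q x * inverse (emb Q y) = emb Q (x * w) * inverse (emb Q (y * w))"
    if "y \<noteq> 0" "w \<noteq> 0" for x y w
    using that by (simp add: emb(4) nonzero_inverse_mult_distrib mult.assoc)
      (simp flip: mult.assoc)
  have x: "x = emb Q (u * p) * inverse (emb Q m)" and y: "y = emb Q (c * p') * inverse (emb Q m)"
    using frac[OF ab(1) \<open>p \<noteq> 0\<close>, of u] frac[OF cd(1) p(1), of c] ab(2) cd(2) p(2)
    by (simp_all add: m_def)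
  have xy: "x + y = emb Q (u * p + c * p') * inverse (emb Q m)"
    unfolding x y by (simp add: emb(3) distrib_right)
  show ?thesis
    by (rule generic_mp2[OF generic_conj[OF iota_frac[OF m x] iota_frac[OF m y]]
          iota_frac[OF m xy]]) (auto simp: ev_add distrib_right)
qed

lemma iota_inj:
  assumes "generic (\<lambda>h. iota x h = iota y h)"
  shows "x = y"
proof -
  have neg: "generic (\<lambda>h. iota (x - y) h = 0)"
    by (rule generic_mp2[OF assms iota_add[of "x - y" y]]) simp
  obtain u b where ab: "b \<noteq> 0" "x - y = emb Q u * inverse (emb Q b)" using emb_right by blast
  show ?thesis
  proof (rule ccontr)
    assume "x \<noteq> y"
    then have "u \<noteq> 0" using ab(2) by auto
    have "generic (\<lambda>h. False)"
      by (rule generic_mp2[OF generic_conj[OF neg iota_frac[OF ab]]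
            generic_nonzero[OF emb_mult_nonzero[OF \<open>u \<noteq> 0\<close> ab(1)]]]) (auto simp: ev_mult)
    then show False using generic_ex by blast
  qed
qed

lemma iota_E: "generic (\<lambda>h. iota (E b) h = E b)"
  by (rule generic_mp[OF iota_emb[of "Poly_Mapping.single 0 b"]]) (simp add: ev_single chi_0 flip: E_def)

lemma iota_sc: "generic (\<lambda>h. iota (sc c) h = sc c)"
  unfolding sc_def by (rule iota_E)

lemma iota_qexp: "generic (\<lambda>h. iota (qexp Q v) h = sc (chi h v))"
  by (rule generic_mp[OF iota_emb[of "Poly_Mapping.single v 1"]]) (simp_all add: qexp_eq ev_single E_hom)

lemma iota_inverse: "generic (\<lambda>h. iota (inverse x) h = inverse (iota x h))"
proof (cases "x = 0")
  case True
  then show ?thesis using iota_sc[of 0] by (simp add: generic_mp)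
next
  case False
  show ?thesis
  proof (rule generic_mp2[OF iota_mult[of x "inverse x"] iota_sc[of 1]])
    fix h :: "'y \<Rightarrow> int"
    assume "iota (x * inverse x) h = iota x h * iota (inverse x) h" "iota (sc 1) h = sc 1"
    then have "iota x h * iota (inverse x) h = 1" using False by simp
    then show "iota (inverse x) h = inverse (iota x h)" by (rule inverse_unique[symmetric])
  qed
qed

section \<open>Automorphisms implemented by conjugation and change of points\<close>

lemma k_generated:
  assumes sc: "\<And>c. P (sc c)" and f: "\<And>i. P (fgen R Q i)" and q: "\<And>v. P (qexp Q v)"
    and add: "\<And>x y. P x \<Longrightarrow> P y \<Longrightarrow> P (x + y)" and mult: "\<And>x y. P x \<Longrightarrow> P y \<Longrightarrow> P (x * y)"
    and inv: "\<And>x. P x \<Longrightarrow> P (inverse x)"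
  shows "P z"
proof -
  have E: "P (E b)" for b
  proof (induction b rule: b_generated)
    case (1 c)
    then show ?case using sc[of c] by (simp add: sc_def)
  next
    case (2 i)
    then show ?case using f[of i] by (simp add: fgen_eq)
  qed (simp_all add: E_hom add mult)
  have "P (emb Q x)" for x
  proof (induction x rule: poly_mapping_induct)
    case (1 v b)
    then show ?case using mult[OF E q[of v], of b] by (simp add: single_decompose[of v b] qexp_eq)
  qed (simp add: emb(3) add)
  then show ?thesis using emb_right[of z] mult inv by metis
qed

definition admissible :: "(('y \<Rightarrow> int) \<Rightarrow> 'y \<Rightarrow> int) \<Rightarrow> bool" where
  "admissible \<rho> \<longleftrightarrow> (\<forall>h. Modules.additive h \<longrightarrow> Modules.additive (\<rho> h)) \<and>
     (\<forall>P. generic P \<longrightarrow> generic (\<lambda>h. P (\<rho> h)))"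

definition implements ::
  "('k \<Rightarrow> 'k) \<Rightarrow> (('y \<Rightarrow> int) \<Rightarrow> 'k) \<Rightarrow> (('y \<Rightarrow> int) \<Rightarrow> 'y \<Rightarrow> int) \<Rightarrow> bool" where
  "implements \<sigma> u \<rho> \<longleftrightarrow> admissible \<rho> \<and> (\<forall>h. Modules.additive h \<longrightarrow> u h \<noteq> 0) \<and>
     (\<forall>z. generic (\<lambda>h. iota (\<sigma> z) h = u h * iota z (\<rho> h) * inverse (u h)))"

lemma implements_value:
  assumes "implements \<sigma> u \<rho>" "generic (\<lambda>h. iota z' h = u h * iota z (\<rho> h) * inverse (u h))"
  shows "\<sigma> z = z'"
proof (rule iota_inj)
  have "generic (\<lambda>h. iota (\<sigma> z) h = u h * iota z (\<rho> h) * inverse (u h))"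
    using assms(1) by (simp add: implements_def)
  then show "generic (\<lambda>h. iota (\<sigma> z) h = iota z' h)"
    using assms(2) by (rule generic_mp2) simp
qed

lemma implements_exists:
  assumes \<rho>: "admissible \<rho>" and u: "\<And>h. Modules.additive h \<Longrightarrow> u h \<noteq> 0"
    and f: "\<And>i. \<exists>z'. generic (\<lambda>h. iota z' h = u h * iota (fgen R Q i) (\<rho> h) * inverse (u h))"
    and q: "\<And>v. \<exists>z'. generic (\<lambda>h. iota z' h = u h * iota (qexp Q v) (\<rho> h) * inverse (u h))"
  shows "\<exists>\<sigma>. implements \<sigma> u \<rho>"
proof -
  let ?P = "\<lambda>z. \<exists>z'. generic (\<lambda>h. iota z' h = u h * iota z (\<rho> h) * inverse (u h))"
  have tr: "generic (\<lambda>h. P (\<rho> h))" if "generic P" for P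
    using \<rho> that by (simp add: admissible_def)
  have "?P z" for z
  proof (induction z rule: k_generated)
    case (1 c)
    have "generic (\<lambda>h. iota (sc c) h = u h * iota (sc c) (\<rho> h) * inverse (u h))"
      by (rule generic_mp2[OF iota_sc[of c] tr[OF iota_sc[of c]]])
        (simp add: u mult.assoc flip: sc_commute)
    then show ?case ..
  next
    case (4 x y)
    then obtain x' y' where "generic (\<lambda>h. iota x' h = u h * iota x (\<rho> h) * inverse (u h))"
      "generic (\<lambda>h. iota y' h = u h * iota y (\<rho> h) * inverse (u h))" by blast
    from generic_conj[OF generic_conj[OF this] generic_conj[OF iota_add[of x' y'] tr[OF iota_add[of x y]]]]
    have "generic (\<lambda>h. iota (x' + y') h = u h * iota (x + y) (\<rho> h) * inverse (u h))"
      by (rule generic_mp) (simp add: algebra_simps)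
    then show ?case ..
  next
    case (5 x y)
    then obtain x' y' where "generic (\<lambda>h. iota x' h = u h * iota x (\<rho> h) * inverse (u h))"
      "generic (\<lambda>h. iota y' h = u h * iota y (\<rho> h) * inverse (u h))" by blast
    from generic_conj[OF generic_conj[OF this] generic_conj[OF iota_mult[of x' y'] tr[OF iota_mult[of x y]]]]
    have "generic (\<lambda>h. iota (x' * y') h = u h * iota (x * y) (\<rho> h) * inverse (u h))"
    proof (rule generic_mp)
      fix h :: "'y \<Rightarrow> int"
      assume "Modules.additive h"
      then have "inverse (u h) * (u h * z) = z" for z using u by (simp flip: mult.assoc)
      moreover assume "(iota x' h = u h * iota x (\<rho> h) * inverse (u h) \<and>
            iota y' h = u h * iota y (\<rho> h) * inverse (u h)) \<and>
           iota (x' * y') h = iota x' h * iota y' h \<and>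
           iota (x * y) (\<rho> h) = iota x (\<rho> h) * iota y (\<rho> h)"
      ultimately show "iota (x' * y') h = u h * iota (x * y) (\<rho> h) * inverse (u h)"
        by (simp add: mult.assoc)
    qed
    then show ?case ..
  next
    case (6 x)
    then obtain x' where "generic (\<lambda>h. iota x' h = u h * iota x (\<rho> h) * inverse (u h))" by blast
    from generic_conj[OF this generic_conj[OF iota_inverse[of x'] tr[OF iota_inverse[of x]]]]
    have "generic (\<lambda>h. iota (inverse x') h = u h * iota (inverse x) (\<rho> h) * inverse (u h))"
    proof (rule generic_mp)
      fix h :: "'y \<Rightarrow> int"
      assume "Modules.additive h"
      then have "u h \<noteq> 0" by (rule u)
      moreover assume "iota x' h = u h * iota x (\<rho> h) * inverse (u h) \<and>
           iota (inverse x') h = inverse (iota x' h) \<and>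
           iota (inverse x) (\<rho> h) = inverse (iota x (\<rho> h))"
      ultimately show "iota (inverse x') h = u h * iota (inverse x) (\<rho> h) * inverse (u h)"
        by (cases "iota x (\<rho> h) = 0") (simp_all add: nonzero_inverse_mult_distrib mult.assoc)
    qed
    then show ?case ..
  qed (use f q in blast)+
  then obtain \<sigma> where "\<And>z. generic (\<lambda>h. iota (\<sigma> z) h = u h * iota z (\<rho> h) * inverse (u h))"
    by metis
  then have "implements \<sigma> u \<rho>" using \<rho> u by (simp add: implements_def)
  then show ?thesis by blast
qed

lemma implements_comp:
  assumes \<sigma>: "implements \<sigma> u \<rho>" and \<tau>: "implements \<tau> v \<pi>"
  shows "implements (\<sigma> \<circ> \<tau>) (\<lambda>h. u h * v (\<rho> h)) (\<lambda>h. \<pi> (\<rho> h))"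
proof -
  have add: "Modules.additive (\<rho> h)" "u h \<noteq> 0" "v (\<rho> h) \<noteq> 0" if "Modules.additive h" for h
    using that \<sigma> \<tau> by (simp_all add: implements_def admissible_def)
  have adm: "admissible (\<lambda>h. \<pi> (\<rho> h))"
  proof -
    have "generic (\<lambda>h. P (\<pi> (\<rho> h)))" if "generic P" for P
    proof -
      have "generic (\<lambda>h. P (\<pi> h))" using \<tau> that by (simp add: implements_def admissible_def)
      moreover have "generic P' \<Longrightarrow> generic (\<lambda>h. P' (\<rho> h))" for P'
        using \<sigma> by (simp add: implements_def admissible_def)
      ultimately show ?thesis by blast
    qed
    then show ?thesis using \<sigma> \<tau> by (simp add: implements_def admissible_def)
  qed
  have "generic (\<lambda>h. iota (\<sigma> (\<tau> z)) h = u h * v (\<rho> h) * iota z (\<pi> (\<rho> h)) * inverse (u h * v (\<rho> h)))" for z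
  proof (rule generic_mp2)
    show "generic (\<lambda>h. iota (\<sigma> (\<tau> z)) h = u h * iota (\<tau> z) (\<rho> h) * inverse (u h))"
      using \<sigma> by (simp add: implements_def)
    have "generic (\<lambda>h. iota (\<tau> z) h = v h * iota z (\<pi> h) * inverse (v h))"
      using \<tau> by (simp add: implements_def)
    moreover have "generic P' \<Longrightarrow> generic (\<lambda>h. P' (\<rho> h))" for P'
      using \<sigma> by (simp add: implements_def admissible_def)
    ultimately show "generic (\<lambda>h. iota (\<tau> z) (\<rho> h) = v (\<rho> h) * iota z (\<pi> (\<rho> h)) * inverse (v (\<rho> h)))"
      by blast
  qed (simp add: add nonzero_inverse_mult_distrib mult.assoc)
  with adm add show ?thesis by (simp add: implements_def)
qed

lemma implements_unique:
  assumes \<sigma>: "implements \<sigma> u \<rho>" and \<tau>: "implements \<tau> v \<pi>"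
    and "\<And>h. Modules.additive h \<Longrightarrow> u h = v h" "\<And>h. Modules.additive h \<Longrightarrow> \<rho> h = \<pi> h"
  shows "\<sigma> = \<tau>"
proof
  fix z
  have "generic (\<lambda>h. iota (\<tau> z) h = v h * iota z (\<pi> h) * inverse (v h))"
    using \<tau> by (simp add: implements_def)
  then have "generic (\<lambda>h. iota (\<tau> z) h = u h * iota z (\<rho> h) * inverse (u h))"
    by (rule generic_mp) (simp add: assms(3,4))
  with \<sigma> show "\<sigma> z = \<tau> z" by (rule implements_value)
qed

lemma implements_id: "implements id (\<lambda>_. 1) (\<lambda>h. h)"
  by (auto simp: implements_def admissible_def intro: genericI)

lemma implements_homomorphism:
  assumes \<sigma>: "implements \<sigma> u \<rho>"
  shows "\<sigma> 1 = 1" "\<sigma> (x + y) = \<sigma> x + \<sigma> y" "\<sigma> (x * y) = \<sigma> x * \<sigma> y" "\<sigma> (scalar Q c * x) = scalar Q c * \<sigma> x"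
proof -
  have gen: "generic (\<lambda>h. iota (\<sigma> z) h = u h * iota z (\<rho> h) * inverse (u h))" for z
    using \<sigma> by (simp add: implements_def)
  have tr: "generic (\<lambda>h. P (\<rho> h))" if "generic P" for P
    using \<sigma> that by (simp add: implements_def admissible_def)
  have u: "u h \<noteq> 0" if "Modules.additive h" for h
    using \<sigma> that by (simp add: implements_def)
  have sc: "\<sigma> (sc c) = sc c" for c
    by (rule implements_value[OF \<sigma> generic_mp2[OF iota_sc[of c] tr[OF iota_sc[of c]]]])
      (simp add: u mult.assoc flip: sc_commute)
  show mult: "\<sigma> (x * y) = \<sigma> x * \<sigma> y" for x y
  proof (rule implements_value[OF \<sigma> generic_mp2[OF generic_conj[OF gen[of x] gen[of y]]
          generic_conj[OF iota_mult[of "\<sigma> x" "\<sigma> y"] tr[OF iota_mult[of x y]]]]])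
    fix h :: "'y \<Rightarrow> int"
    assume "Modules.additive h"
    then have "inverse (u h) * (u h * z) = z" for z using u by (simp flip: mult.assoc)
    moreover assume "iota (\<sigma> x) h = u h * iota x (\<rho> h) * inverse (u h) \<and>
          iota (\<sigma> y) h = u h * iota y (\<rho> h) * inverse (u h)"
      "iota (\<sigma> x * \<sigma> y) h = iota (\<sigma> x) h * iota (\<sigma> y) h \<and>
         iota (x * y) (\<rho> h) = iota x (\<rho> h) * iota y (\<rho> h)"
    ultimately show "iota (\<sigma> x * \<sigma> y) h = u h * iota (x * y) (\<rho> h) * inverse (u h)"
      by (simp add: mult.assoc)
  qed
  show "\<sigma> (x + y) = \<sigma> x + \<sigma> y"
    by (rule implements_value[OF \<sigma> generic_mp2[OF generic_conj[OF gen[of x] gen[of y]]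
          generic_conj[OF iota_add[of "\<sigma> x" "\<sigma> y"] tr[OF iota_add[of x y]]]]])
      (simp add: algebra_simps)
  show "\<sigma> 1 = 1" using sc[of 1] by simp
  show "\<sigma> (scalar Q c * x) = scalar Q c * \<sigma> x" by (simp add: mult sc scalar_eq)
qed

lemma implements_automorphism:
  assumes "implements \<sigma> u \<rho>" "\<sigma> \<circ> \<tau> = id" "\<tau> \<circ> \<sigma> = id"
  shows "algebra_automorphism Q \<sigma>"
  using implements_homomorphism[OF assms(1)] o_bij[OF assms(3,2)]
  by (simp add: algebra_automorphism_def)

lemma automorphism_eqI:
  assumes \<sigma>: "algebra_automorphism Q \<sigma>" and \<tau>: "algebra_automorphism Q \<tau>"
    and "\<And>j. \<sigma> (fgen R Q j) = \<tau> (fgen R Q j)" "\<And>v. \<sigma> (qexp Q v) = \<tau> (qexp Q v)"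
  shows "\<sigma> = \<tau>"
proof
  have inv: "\<phi> (inverse x) = inverse (\<phi> x)" if "algebra_automorphism Q \<phi>" for \<phi> x
  proof (cases "x = 0")
    case True
    have "\<phi> 0 + \<phi> 0 = \<phi> 0"
      using that by (metis algebra_automorphism_def add_0_left)
    then show ?thesis using True by simp
  next
    case False
    have "\<phi> x * \<phi> (inverse x) = \<phi> (x * inverse x)"
      using that by (simp add: algebra_automorphism_def)
    also have "\<dots> = 1" using False that by (simp add: algebra_automorphism_def)
    finally show ?thesis by (rule inverse_unique[symmetric])
  qed
  fix z
  show "\<sigma> z = \<tau> z"
  proof (induction z rule: k_generated)
    case (1 c)
    have "\<phi> (sc c) = sc c" if "algebra_automorphism Q \<phi>" for \<phi>
      using that by (metis algebra_automorphism_def scalar_eq mult_1_right)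
    from this[OF \<sigma>] this[OF \<tau>] show ?case by simp
  qed (use \<sigma> \<tau> assms(3,4) in \<open>simp_all add: inv\<close>,
      use \<sigma> \<tau> in \<open>simp_all add: algebra_automorphism_def\<close>)
qed

definition is_const :: "'k \<Rightarrow> bool" where
  "is_const z \<longleftrightarrow> generic (\<lambda>h. iota z h = z)"

lemma is_const_sc: "is_const (sc c)" and is_const_fgen: "is_const (fgen R Q i)"
  by (simp_all add: is_const_def iota_sc iota_E fgen_eq)

lemma is_const_add:
  assumes "is_const x" "is_const y"
  shows "is_const (x + y)"
  unfolding is_const_def
  by (rule generic_mp2[OF generic_conj[OF assms[unfolded is_const_def]] iota_add[of x y]]) simp

lemma is_const_mult:
  assumes "is_const x" "is_const y"
  shows "is_const (x * y)"
  unfolding is_const_def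
  by (rule generic_mp2[OF generic_conj[OF assms[unfolded is_const_def]] iota_mult[of x y]]) simp

lemma is_const_inverse: "is_const x \<Longrightarrow> is_const (inverse x)"
  unfolding is_const_def
  by (rule generic_mp2[OF _ iota_inverse[of x]]) auto

lemma is_const_power: "is_const x \<Longrightarrow> is_const (x ^ n)"
  using is_const_sc[of 1] by (induction n) (simp_all add: is_const_mult)

lemma is_const_sum: "(\<And>i. i \<in> A \<Longrightarrow> is_const (x i)) \<Longrightarrow> is_const (\<Sum>i\<in>A. x i)"
  using is_const_sc[of 0] by (induction A rule: infinite_finite_induct) (simp_all add: is_const_add)

lemma is_const_ad_pow: "is_const (ad_pow R Q i k j)"
proof -
  have "is_const (- 1)" using is_const_sc[of "- 1"] by (simp add: sc_minus)
  then show ?thesis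
    unfolding ad_pow_def scalar_eq
    by (intro is_const_sum is_const_mult is_const_power is_const_sc is_const_fgen)
qed

lemma iota_sum:
  "generic (\<lambda>h. iota (\<Sum>i\<in>A. x i) h = (\<Sum>i\<in>A. iota (x i) h))"
proof (induction A rule: infinite_finite_induct)
  case (insert i A)
  show ?case
    by (rule generic_mp2[OF insert.IH iota_add[of "x i" "\<Sum>i\<in>A. x i"]])
      (simp add: insert.hyps)
qed (use iota_sc[of 0] in simp_all)

lemma iota_of_U0: "generic (\<lambda>h. iota (of_U0 Q u) h = evl sc h u)"
proof (rule generic_mp[OF iota_emb[of "Poly_Mapping.map (\<lambda>c. scaleA Q c 1) u"]])
  fix h :: "'y \<Rightarrow> int"
  let ?m = "Poly_Mapping.map (\<lambda>c. scaleA Q c 1) u"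
  assume "iota (emb Q ?m) h = ev h ?m"
  moreover have lookup: "Poly_Mapping.lookup ?m v = scaleA Q (Poly_Mapping.lookup u v) 1" for v
    by (simp add: map.rep_eq when_def scaleA_laws)
  moreover have "Poly_Mapping.keys ?m \<subseteq> Poly_Mapping.keys u"
    by (auto simp: in_keys_iff lookup scaleA_laws)
  then have "ev h ?m = (\<Sum>v\<in>Poly_Mapping.keys u. sc (chi h v) * E (Poly_Mapping.lookup ?m v))"
    by (intro evl_superset) (simp_all add: E_hom)
  ultimately show "iota (of_U0 Q u) h = evl sc h u"
    by (simp add: of_U0_def evl_def sc_def)
qed

lemma evl_sc_mult: "Modules.additive h \<Longrightarrow> evl sc h (x * y) = evl sc h x * evl sc h y"
  by (simp add: evl_mult sc_add sc_mult)

lemma evl_const0: "Modules.additive h \<Longrightarrow> evl sc h (const0 c) = sc c"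
  by (simp add: const0_def evl_single chi_0)

lemma evl_qexp0: "evl sc h (qexp0 v) = sc (chi h v)"
  by (simp add: qexp0_def evl_single)

lemma chi_dscale: "Modules.additive h \<Longrightarrow> chi h (dscale R (symz R i) l) = qi R i powi h l"
  by (simp add: chi_def dscale_def additive_zmul qi_eq power_int_mult flip: N_def)

lemma chi_zmul: "Modules.additive h \<Longrightarrow> chi h (zmul m v) = chi h v powi m"
  using additive_zmul[OF additive_numerator, of h m v]
  by (simp add: chi_def mult.commute[of m] power_int_mult)

lemma chi_minus: "Modules.additive h \<Longrightarrow> chi h (- v) = inverse (chi h v)"
  using chi_zmul[of h "- 1" v] by (simp add: zmul_minus power_int_minus)

lemma evl_qi_shift:
  assumes "Modules.additive h"
  shows "evl sc h (qi_shift R i m l k) = sc (qi R i powi (m * (h l - k)))"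
proof -
  interpret generic_q "qi R i" by (rule generic_qi)
  have "(qi R i powi (h l)) powi m * qi R i powi (- (m * k)) = qi R i powi (m * (h l - k))"
    by (simp add: algebra_simps flip: power_int_mult power_int_add)
  then show ?thesis
    using assms
    by (simp add: qi_shift_def evl_sc_mult evl_const0 evl_qexp0 chi_zmul chi_dscale flip: sc_mult)
qed

lemma evl_qnum0:
  assumes "Modules.additive h"
  shows "evl sc h (qnum0 R i l \<nu>) = sc (qnum (qi R i) (h l - \<nu>))"
proof -
  interpret generic_q "qi R i" by (rule generic_qi)
  have diff: "evl sc h (x - y) = evl sc h x - evl sc h y" for x y
    using evl_add[of sc h "x - y" y] by (simp add: sc_add)
  have "inverse (qi R i - inverse (qi R i)) *
      (qi R i powi h l * qi R i powi (- \<nu>) - inverse (qi R i powi h l) * qi R i powi \<nu>)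
    = qnum (qi R i) (h l - \<nu>)"
    by (simp add: qnum_def divide_inverse power_int_diff power_int_minus mult.commute)
  then show ?thesis
    using assms
    by (simp add: qnum0_def evl_sc_mult evl_const0 evl_qexp0 diff chi_minus chi_dscale flip: sc_mult sc_diff)
qed

lemma evl_qbinom0:
  assumes "Modules.additive h"
  shows "evl sc h (qbinom0 R i l k) = sc (qbinom (qi R i) (h l) k)"
proof -
  have one: "evl sc h 1 = 1"
    using evl_single[of sc h 0 1] assms by (simp add: chi_0)
  have "evl sc h (\<Prod>\<nu><k. qnum0 R i l (int \<nu>)) = sc (\<Prod>\<nu><k. qnum (qi R i) (h l - int \<nu>))"
    by (induction k) (simp_all add: one evl_sc_mult[OF assms] evl_qnum0[OF assms] sc_mult)
  then show ?thesis
    using assms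
    by (simp add: qbinom0_def qbinom_def divide_inverse evl_sc_mult evl_const0 mult.commute flip: sc_mult)
qed

definition conjugate_image :: "'i \<Rightarrow> 'y \<Rightarrow> 'i \<Rightarrow> 'k" where
  "conjugate_image i l j = (if i = j then fgen R Q i
     else \<Sum>k = 0..nat (- a i j).
       of_U0 Q (qi_shift R i (int k + a i j) l (int k) * qbinom0 R i l k)
       * ad_pow R Q i k j * inverse (fgen R Q i) ^ k)"

lemma iota_conjugate_image:
  "generic (\<lambda>h. iota (conjugate_image i l j) h
     = fgen R Q i powi h l * fgen R Q j * inverse (fgen R Q i powi h l))"
proof (cases "i = j")
  case True
  have "f powi n * f * inverse (f powi n) = f" if "f \<noteq> 0" for f :: 'k and n
  proof -
    have "f powi n * f = f * f powi n"
      using that power_int_add[of f n 1] power_int_add[of f 1 n] by (simp add: add.commute)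
    then show ?thesis using that by (simp add: mult.assoc)
  qed
  then show ?thesis
    using is_const_fgen[of i] True fgen_nonzero[of i]
    by (simp add: conjugate_image_def is_const_def)
next
  case False
  let ?x = "\<lambda>k. of_U0 Q (qi_shift R i (int k + a i j) l (int k) * qbinom0 R i l k)"
  let ?y = "\<lambda>k. ad_pow R Q i k j * inverse (fgen R Q i) ^ k"
  let ?c = "\<lambda>h k. sc (qi R i powi ((int k + a i j) * (h l - int k)) * qbinom (qi R i) (h l) k)"
  have summand: "generic (\<lambda>h. iota (?x k * ?y k) h = ?c h k * ?y k)" for k
  proof -
    have "is_const (?y k)"
      by (intro is_const_mult is_const_power is_const_inverse is_const_ad_pow is_const_fgen)
    then have y: "generic (\<lambda>h. iota (?y k) h = ?y k)" by (simp add: is_const_def)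
    show ?thesis
      by (rule generic_mp2[OF generic_conj[OF iota_of_U0[of "qi_shift R i (int k + a i j) l (int k) * qbinom0 R i l k"] y]
            iota_mult[of "?x k" "?y k"]])
        (simp add: evl_sc_mult evl_qi_shift evl_qbinom0 sc_mult)
  qed
  have "generic (\<lambda>h. \<forall>k\<in>A. iota (?x k * ?y k) h = ?c h k * ?y k)" if "finite A" for A
    using that
  proof (induction A rule: finite_induct)
    case (insert k A)
    show ?case by (rule generic_mp2[OF insert.IH summand[of k]]) simp
  qed (simp add: genericI)
  from this[of "{0..nat (- a i j)}"]
  have all: "generic (\<lambda>h. \<forall>k\<in>{0..nat (- a i j)}. iota (?x k * ?y k) h = ?c h k * ?y k)" by simp
  show ?thesis
  proof (rule generic_mp2[OF all iota_sum[of "\<lambda>k. ?x k * ?y k" "{0..nat (- a i j)}"]])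
    fix h :: "'y \<Rightarrow> int"
    assume "\<forall>k\<in>{0..nat (- a i j)}. iota (?x k * ?y k) h = ?c h k * ?y k"
      "iota (\<Sum>k\<in>{0..nat (- a i j)}. ?x k * ?y k) h = (\<Sum>k\<in>{0..nat (- a i j)}. iota (?x k * ?y k) h)"
    moreover have "fgen R Q i powi h l * fgen R Q j * inverse (fgen R Q i powi h l)
        = (\<Sum>k\<in>{0..nat (- a i j)}. ?c h k * ?y k)"
      using conjugation_fgen[OF False, of "h l"] by (simp add: power_int_minus mult.assoc)
    ultimately show "iota (conjugate_image i l j) h
        = fgen R Q i powi h l * fgen R Q j * inverse (fgen R Q i powi h l)"
      using False by (simp add: conjugate_image_def mult.assoc)
  qed
qed

lemma admissible_id: "admissible (\<lambda>h. h)"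
  by (simp add: admissible_def)

lemma gamma_exists:
  "\<exists>\<sigma>. implements \<sigma> (\<lambda>h. fgen R Q i powi h l) (\<lambda>h. h)"
proof (rule implements_exists[OF admissible_id])
  show "fgen R Q i powi h l \<noteq> 0" for h
    by (simp add: fgen_nonzero)
  fix j
  show "\<exists>z'. generic (\<lambda>h. iota z' h
      = fgen R Q i powi h l * iota (fgen R Q j) h * inverse (fgen R Q i powi h l))"
    using generic_mp2[OF iota_conjugate_image[of i l j] is_const_fgen[of j, unfolded is_const_def]]
    by (intro exI[of _ "conjugate_image i l j"]) simp
next
  fix v
  have "generic (\<lambda>h. iota (qexp Q v) h
      = fgen R Q i powi h l * iota (qexp Q v) h * inverse (fgen R Q i powi h l))"
    by (rule generic_mp[OF iota_qexp[of v]]) (simp add: fgen_nonzero mult.assoc flip: sc_commute)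
  then show "\<exists>z'. generic (\<lambda>h. iota z' h
      = fgen R Q i powi h l * iota (qexp Q v) h * inverse (fgen R Q i powi h l))" by blast
qed

lemma gamma_implements:
  "implements (gamma R Q i l) (\<lambda>h. fgen R Q i powi h l) (\<lambda>h. h)"
  and gamma_qexp: "gamma R Q i l (qexp Q v) = qexp Q v"
  and gamma_fgen: "gamma R Q i l (fgen R Q j) = conjugate_image i l j"
proof -
  obtain \<sigma> \<tau> where \<sigma>: "implements \<sigma> (\<lambda>h. fgen R Q i powi h l) (\<lambda>h. h)"
    and \<tau>: "implements \<tau> (\<lambda>h. fgen R Q i powi h (- l)) (\<lambda>h. h)"
    using gamma_exists by blast
  have "\<sigma> \<circ> \<tau> = id" "\<tau> \<circ> \<sigma> = id"
    by (rule implements_unique[OF implements_comp[OF \<sigma> \<tau>] implements_id]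
        implements_unique[OF implements_comp[OF \<tau> \<sigma>] implements_id];
        simp add: fgen_nonzero additive.minus flip: power_int_add)+
  with \<sigma> have aut: "algebra_automorphism Q \<sigma>" by (rule implements_automorphism)
  have v: "\<sigma> (qexp Q v) = qexp Q v" for v
    by (rule implements_value[OF \<sigma> generic_mp[OF iota_qexp[of v]]])
      (simp add: fgen_nonzero mult.assoc flip: sc_commute)
  have f: "\<sigma> (fgen R Q j) = conjugate_image i l j" for j
    by (rule implements_value[OF \<sigma> generic_mp2[OF iota_conjugate_image[of i l j]
            is_const_fgen[of j, unfolded is_const_def]]]) simp
  have "gamma R Q i l = \<sigma>"
    unfolding gamma_def
  proof (rule the_equality, intro conjI allI impI)
    fix \<tau>
    assume *: "algebra_automorphism Q \<tau> \<and> (\<forall>v. \<tau> (qexp Q v) = qexp Q v) \<and>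
      \<tau> (fgen R Q i) = fgen R Q i \<and>
      (\<forall>j. j \<noteq> i \<longrightarrow> \<tau> (fgen R Q j) = (\<Sum>k = 0..nat (- a i j).
         of_U0 Q (qi_shift R i (int k + a i j) l (int k) * qbinom0 R i l k)
         * ad_pow R Q i k j * inverse (fgen R Q i) ^ k))"
    then have "\<tau> (fgen R Q j) = conjugate_image i l j" for j
      by (auto simp: conjugate_image_def)
    with * show "\<tau> = \<sigma>" by (intro automorphism_eqI aut) (simp_all add: v f)
  qed (auto simp: aut v f conjugate_image_def)
  then show "implements (gamma R Q i l) (\<lambda>h. fgen R Q i powi h l) (\<lambda>h. h)"
    "gamma R Q i l (qexp Q v) = qexp Q v"
    "gamma R Q i l (fgen R Q j) = conjugate_image i l j"
    using \<sigma> aut v f by simp_all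
qed

definition reflect :: "'i \<Rightarrow> ('y \<Rightarrow> int) \<Rightarrow> 'y \<Rightarrow> int" where
  "reflect i h y = h y - pairing R y (simple_root R i) * h (coroot R i)"

lemma pairing_additive: "Modules.additive (\<lambda>y. pairing R y x)"
  and pairing_coroot: "pairing R (coroot R i) (simple_root R j) = a i j"
  using root by (simp_all add: root_datum_def perfect_pairing_def)

lemma reflect_additive: "Modules.additive h \<Longrightarrow> Modules.additive (reflect i h)"
  using additive.add[OF pairing_additive]
  by unfold_locales (simp add: reflect_def additive.add distrib_right)

lemma reflect_reflect: "reflect i (reflect i h) = h"
  by (rule ext) (simp add: reflect_def pairing_coroot cartan_diag algebra_simps)

lemma chi_reflect: "Modules.additive h \<Longrightarrow> chi (reflect i h) v = chi h (reflection R i v)"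
proof (cases v)
  case (OverD y)
  assume h: "Modules.additive h"
  have "reflection R i v = OverD (y - zmul (pairing R y (simple_root R i)) (coroot R i))"
    using lcden_integral(1)[of R] by (simp add: OverD reflection_def dscale_def)
  then show ?thesis
    using h by (simp add: OverD chi_def reflect_def additive.diff additive_zmul)
qed

lemma admissible_reflect: "admissible (reflect i)"
  unfolding admissible_def
proof (intro conjI allI impI)
  fix P assume "generic P"
  then obtain b where b: "b \<noteq> 0" "\<And>h. Modules.additive h \<Longrightarrow> ev h b \<noteq> 0 \<Longrightarrow> P h"
    unfolding generic_def by blast
  define b' where "b' = (\<Sum>v\<in>Poly_Mapping.keys b.
      Poly_Mapping.single (reflection R i v) (Poly_Mapping.lookup b v))"
  have sum: "ev h (\<Sum>v\<in>S. x v) = (\<Sum>v\<in>S. ev h (x v))" for S h and x :: "'y dlat \<Rightarrow> _"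
    by (induction S rule: infinite_finite_induct) (simp_all add: ev_add)
  have b': "ev h b' = ev (reflect i h) b" if "Modules.additive h" for h
    by (simp add: b'_def sum ev_single evl_def[of E _ b] chi_reflect[OF that])
  obtain h where h: "Modules.additive h" "ev h b \<noteq> 0"
    using generic_ex[OF generic_nonzero[OF b(1)]] by blast
  have "ev (reflect i h) b' \<noteq> 0"
    using b'[OF reflect_additive[OF h(1)]] h(2) by (simp add: reflect_reflect)
  then have "b' \<noteq> 0" by auto
  then show "generic (\<lambda>h. P (reflect i h))"
    unfolding generic_def using b(2) b' reflect_additive by metis
qed (rule reflect_additive)

lemma s_tilde_implements: "implements (s_tilde R Q i) (\<lambda>_. 1) (reflect i)"
  and s_tilde_qexp: "s_tilde R Q i (qexp Q v) = qexp Q (reflection R i v)"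
  and s_tilde_fgen: "s_tilde R Q i (fgen R Q j) = fgen R Q j"
proof -
  have tr: "generic (\<lambda>h. P (reflect i h))" if "generic P" for P
    using admissible_reflect that by (simp add: admissible_def)
  have genf: "generic (\<lambda>h. iota (fgen R Q j) h = 1 * iota (fgen R Q j) (reflect i h) * inverse 1)" for j
    using is_const_fgen[of j] unfolding is_const_def
    by (intro generic_mp2[OF is_const_fgen[of j, unfolded is_const_def]
          tr[OF is_const_fgen[of j, unfolded is_const_def]]]) simp
  have genq: "generic (\<lambda>h. iota (qexp Q (reflection R i v)) h
      = 1 * iota (qexp Q v) (reflect i h) * inverse 1)" for v
    by (intro generic_mp2[OF iota_qexp[of "reflection R i v"] tr[OF iota_qexp[of v]]])
      (simp add: chi_reflect)
  have "\<exists>\<sigma>. implements \<sigma> (\<lambda>_. 1) (reflect i)"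
    by (rule implements_exists[OF admissible_reflect]) (use genf genq in \<open>auto intro: exI\<close>)
  then obtain \<sigma> where \<sigma>: "implements \<sigma> (\<lambda>_. 1) (reflect i)" by blast
  have "\<sigma> \<circ> \<sigma> = id"
    by (rule implements_unique[OF implements_comp[OF \<sigma> \<sigma>] implements_id]) (simp_all add: reflect_reflect)
  then have aut: "algebra_automorphism Q \<sigma>" using \<sigma> by (intro implements_automorphism)
  have f: "\<sigma> (fgen R Q j) = fgen R Q j" for j
    by (rule implements_value[OF \<sigma> genf])
  have v: "\<sigma> (qexp Q v) = qexp Q (reflection R i v)" for v
    by (rule implements_value[OF \<sigma> genq])
  have "s_tilde R Q i = \<sigma>"
    unfolding s_tilde_def
  proof (rule the_equality)
    fix \<tau>
    assume "algebra_automorphism Q \<tau> \<and> (\<forall>j. \<tau> (fgen R Q j) = fgen R Q j) \<and>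
       (\<forall>v. \<tau> (qexp Q v) = qexp Q (reflection R i v))"
    then show "\<tau> = \<sigma>" by (intro automorphism_eqI aut) (simp_all add: v f)
  qed (simp add: aut v f)
  then show "implements (s_tilde R Q i) (\<lambda>_. 1) (reflect i)"
    "s_tilde R Q i (qexp Q v) = qexp Q (reflection R i v)"
    "s_tilde R Q i (fgen R Q j) = fgen R Q j"
    using \<sigma> aut v f by simp_all
qed

abbreviation S where "S \<equiv> S_op R Q"

lemma S_op_eq: "S i = gamma R Q i (coroot R i) \<circ> s_tilde R Q i"
  and S_op_implements: "implements (S i) (\<lambda>h. fgen R Q i powi h (coroot R i)) (reflect i)"
proof -
  note S = implements_comp[OF s_tilde_implements[of i] gamma_implements[of i "- coroot R i"]]
  note S' = implements_comp[OF gamma_implements[of i "coroot R i"] s_tilde_implements[of i]]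
  show eq: "S i = gamma R Q i (coroot R i) \<circ> s_tilde R Q i"
    unfolding S_op_def
    by (rule implements_unique[OF S S'])
      (simp_all add: additive.minus reflect_additive, simp add: reflect_def pairing_coroot cartan_diag)
  show "implements (S i) (\<lambda>h. fgen R Q i powi h (coroot R i)) (reflect i)"
    unfolding eq using S' by simp
qed

lemma S_op_qexp: "S i (qexp Q v) = qexp Q (reflection R i v)"
  by (simp add: S_op_def gamma_qexp s_tilde_qexp)

lemma S_op_fgen: "S i (fgen R Q j) = conjugate_image i (coroot R i) j"
  by (simp add: S_op_eq gamma_fgen s_tilde_fgen)

section \<open>The action of the Weyl group\<close>

fun word_factor :: "'i list \<Rightarrow> ('y \<Rightarrow> int) \<Rightarrow> 'k" where
  "word_factor [] h = 1"
| "word_factor (i # w) h = fgen R Q i powi h (coroot R i) * word_factor w (reflect i h)"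

fun word_reflect :: "'i list \<Rightarrow> ('y \<Rightarrow> int) \<Rightarrow> 'y \<Rightarrow> int" where
  "word_reflect [] h = h"
| "word_reflect (i # w) h = word_reflect w (reflect i h)"

definition word_op :: "'i list \<Rightarrow> 'k \<Rightarrow> 'k" where
  "word_op w = foldr (\<lambda>i \<sigma>. S i \<circ> \<sigma>) w id"

lemma word_op_simps [simp]: "word_op [] = id" "word_op (i # w) = S i \<circ> word_op w"
  by (simp_all add: word_op_def)

lemma word_op_append: "word_op (u @ v) = word_op u \<circ> word_op v"
  by (induction u) (simp_all add: comp_assoc)

lemma implements_word: "implements (word_op w) (word_factor w) (word_reflect w)"
proof (induction w)
  case Nil
  show ?case using implements_id by (simp add: id_def)
next
  case (Cons i w)
  show ?case using implements_comp[OF S_op_implements[of i] Cons] by (simp add: comp_def)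
qed

lemma word_op_eqI:
  assumes "\<And>h. Modules.additive h \<Longrightarrow> word_factor u h = word_factor v h"
    and "\<And>h. Modules.additive h \<Longrightarrow> word_reflect u h = word_reflect v h"
  shows "word_op u = word_op v"
  using implements_unique[OF implements_word implements_word assms] .

lemma reflect_coroot: "reflect i h (coroot R j) = h (coroot R j) - a j i * h (coroot R i)"
  by (simp add: reflect_def pairing_coroot)

lemma involution: "word_op [i, i] = word_op []"
  by (rule word_op_eqI)
    (simp_all add: reflect_coroot cartan_diag reflect_reflect fgen_nonzero flip: power_int_add)

lemma braid_commuting:
  assumes "i \<noteq> j" "a i j = 0" "a j i = 0"
  shows "word_op [i, j] = word_op [j, i]"
proof (rule word_op_eqI)
  fix h :: "'y \<Rightarrow> int"
  have "fgen R Q i powi n * fgen R Q j * fgen R Q i powi (- n) = ad_pow R Q i 0 j" for n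
    using conjugation_fgen[OF assms(1), of n] assms(2)
    by (simp add: generic_q.qbinom_0[OF generic_qi])
  from this[of 1] this[of 0]
  have "fgen R Q i powi 1 * fgen R Q j * fgen R Q i powi (- 1) = fgen R Q j" by simp
  then have "fgen R Q i * fgen R Q j * inverse (fgen R Q i) * fgen R Q i = fgen R Q j * fgen R Q i"
    by (simp add: power_int_minus)
  then have "fgen R Q i * fgen R Q j = sc 1 * (fgen R Q j * fgen R Q i)"
    using fgen_nonzero[of i] by (simp add: mult.assoc)
  from powi_eigenvector[OF fgen_nonzero this]
  have "fgen R Q j * fgen R Q i powi n = sc 1 * (fgen R Q i powi n * fgen R Q j)" for n
    by simp
  from powi_eigenvector[OF fgen_nonzero this]
  have "fgen R Q j powi m * fgen R Q i powi n = fgen R Q i powi n * fgen R Q j powi m" for m n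
    by simp
  then show "word_factor [i, j] h = word_factor [j, i] h"
    by (simp add: reflect_coroot assms)
  show "word_reflect [i, j] h = word_reflect [j, i] h"
    by (rule ext) (simp add: reflect_coroot assms, simp add: reflect_def pairing_coroot assms)
qed

lemma rank_two:
  assumes "i \<noteq> j" "a i j = - 1" "a j i = - r" "r > 0"
  shows "\<exists>s t. rank_two sc (qi R j) (fgen R Q i) (fgen R Q j) r ((\<lambda>k. - r + 2 * int k) ` {..nat r}) s t"
proof -
  interpret generic_q "qi R j" by (rule generic_qi)
  have "N i = r * N j" using N_cartan[of i j] assms by simp
  then have q: "qi R i = qi R j powi r"
    by (simp add: qi_eq mult.commute flip: power_int_mult)
  obtain s where s: "fgen R Q j = (\<Sum>m\<in>(\<lambda>k. - 1 + 2 * int k) ` {..nat 1}. s m)"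
    "\<forall>m\<in>(\<lambda>k. - 1 + 2 * int k) ` {..nat 1}. fgen R Q i * s m = sc (qi R i powi m) * (s m * fgen R Q i)"
    using q_serre.conjugation_eigenvectors[OF q_serre[OF assms(1)]] assms(2) by auto
  obtain t where t: "fgen R Q i = (\<Sum>m\<in>(\<lambda>k. - r + 2 * int k) ` {..nat r}. t m)"
    "\<forall>m\<in>(\<lambda>k. - r + 2 * int k) ` {..nat r}. fgen R Q j * t m = sc (qi R j powi m) * (t m * fgen R Q j)"
    using q_serre.conjugation_eigenvectors[OF q_serre[OF assms(1)[symmetric]]] assms(3) by auto
  have set: "(\<lambda>k. - 1 + 2 * int k) ` {..nat 1} = {- 1, 1}"
    by (auto simp: atMost_Suc numeral_eq_Suc)
  have "rank_two sc (qi R j) (fgen R Q i) (fgen R Q j) r ((\<lambda>k. - r + 2 * int k) ` {..nat r}) s t"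
  proof
    show "fgen R Q i \<noteq> 0" "fgen R Q j \<noteq> 0" by (rule fgen_nonzero)+
    show "r \<noteq> 0" using assms(4) by simp
    show "finite ((\<lambda>k. - r + 2 * int k) ` {..nat r})" by simp
    show "fgen R Q j = (\<Sum>e\<in>{- 1, 1}. s e)" by (rule s(1)[unfolded set])
    show "fgen R Q i = (\<Sum>m\<in>(\<lambda>k. - r + 2 * int k) ` {..nat r}. t m)" by (rule t(1))
    show "fgen R Q i * s e = sc ((qi R j powi r) powi e) * (s e * fgen R Q i)" if "e \<in> {- 1, 1}" for e
      using s(2)[unfolded set q] that by blast
    show "fgen R Q j * t m = sc (qi R j powi m) * (t m * fgen R Q j)"
      if "m \<in> (\<lambda>k. - r + 2 * int k) ` {..nat r}" for m
      using t(2) that by blast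
  qed
  then show ?thesis by blast
qed

lemma braid_A2:
  assumes "i \<noteq> j" "a i j = - 1" "a j i = - 1"
  shows "word_op [i, j, i] = word_op [j, i, j]"
proof (rule word_op_eqI)
  fix h :: "'y \<Rightarrow> int"
  have set: "(\<lambda>k. - 1 + 2 * int k) ` {..nat 1} = {- 1, 1}"
    by (auto simp: atMost_Suc numeral_eq_Suc)
  obtain s t where "rank_two sc (qi R j) (fgen R Q i) (fgen R Q j) 1 {- 1, 1} s t"
    using rank_two[of i j 1] assms unfolding set by auto
  then interpret rank_two_A2 sc "qi R j" "fgen R Q i" "fgen R Q j" s t
    unfolding rank_two_A2_def .
  show "word_factor [i, j, i] h = word_factor [j, i, j] h"
    using verma_A2[of "h (coroot R i)" "h (coroot R j)"]
    by (simp add: reflect_coroot assms cartan_diag mult.assoc add.commute)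
  show "word_reflect [i, j, i] h = word_reflect [j, i, j] h"
    by (rule ext) (simp add: reflect_def pairing_coroot assms cartan_diag algebra_simps)
qed

lemma braid_B2:
  assumes "i \<noteq> j" "a i j = - 1" "a j i = - 2"
  shows "word_op [i, j, i, j] = word_op [j, i, j, i]"
proof (rule word_op_eqI)
  fix h :: "'y \<Rightarrow> int"
  have set: "(\<lambda>k. - 2 + 2 * int k) ` {..nat 2} = {- 2, 0, 2}"
    by (auto simp: atMost_Suc numeral_eq_Suc)
  obtain s t where "rank_two sc (qi R j) (fgen R Q i) (fgen R Q j) 2 {- 2, 0, 2} s t"
    using rank_two[of i j 2] assms unfolding set by auto
  then interpret rank_two_B2 sc "qi R j" "fgen R Q i" "fgen R Q j" s t
    unfolding rank_two_B2_def .
  show "word_factor [i, j, i, j] h = word_factor [j, i, j, i] h"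
    using verma_B2[of "h (coroot R i)" "h (coroot R j)"]
    by (simp add: reflect_coroot assms cartan_diag mult.assoc algebra_simps)
  show "word_reflect [i, j, i, j] h = word_reflect [j, i, j, i] h"
    by (rule ext) (simp add: reflect_def pairing_coroot assms cartan_diag algebra_simps)
qed

lemma braid_G2:
  assumes "i \<noteq> j" "a i j = - 1" "a j i = - 3"
  shows "word_op [i, j, i, j, i, j] = word_op [j, i, j, i, j, i]"
proof (rule word_op_eqI)
  fix h :: "'y \<Rightarrow> int"
  have set: "(\<lambda>k. - 3 + 2 * int k) ` {..nat 3} = {- 3, - 1, 1, 3}"
    by (auto simp: atMost_Suc numeral_eq_Suc)
  obtain s t where "rank_two sc (qi R j) (fgen R Q i) (fgen R Q j) 3 {- 3, - 1, 1, 3} s t"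
    using rank_two[of i j 3] assms unfolding set by auto
  then interpret rank_two_G2 sc "qi R j" "fgen R Q i" "fgen R Q j" s t
    unfolding rank_two_G2_def .
  show "word_factor [i, j, i, j, i, j] h = word_factor [j, i, j, i, j, i] h"
    using verma_G2[of "h (coroot R i)" "h (coroot R j)"]
    by (simp add: reflect_coroot assms cartan_diag mult.assoc algebra_simps)
  show "word_reflect [i, j, i, j, i, j] h = word_reflect [j, i, j, i, j, i] h"
    by (rule ext) (simp add: reflect_def pairing_coroot assms cartan_diag algebra_simps)
qed

lemma int_mult_nonpos_prime_cases:
  fixes x y p :: int
  assumes "x * y = p" "x \<le> 0" "p \<in> {1, 2, 3}"
  shows "x = - 1 \<and> y = - p \<or> x = - p \<and> y = - 1"
proof -
  have "x dvd p" using assms(1) by (metis dvd_triv_left)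
  then have "\<bar>x\<bar> \<le> \<bar>p\<bar>" using assms(3) by (intro dvd_imp_le_int) auto
  then have "x \<in> {-3, -2, -1, 0}" using assms(2,3) by auto
  then show ?thesis using assms(1,3) by auto presburger+
qed

lemma weyl_relation_word_op:
  assumes "(u, v) \<in> weyl_relations a"
  shows "word_op (map fst u) = word_op (map fst v)"
proof -
  note numeral_2_eq_2 [simp] numeral_3_eq_3 [simp]
  consider i where "u = [(i, True), (i, True)]" "v = []"
    | (A1) i j where "u = alternating 1 i j" "v = alternating 1 j i" "i \<noteq> j" "a i j * a j i = 0"
    | (A2) i j where "u = [(i, True), (j, True), (i, True)]" "v = [(j, True), (i, True), (j, True)]"
        "i \<noteq> j" "a i j * a j i = 1"
    | (B2) i j where "u = alternating 2 i j" "v = alternating 2 j i" "i \<noteq> j" "a i j * a j i = 2"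
    | (G2) i j where "u = alternating 3 i j" "v = alternating 3 j i" "i \<noteq> j" "a i j * a j i = 3"
    using assms unfolding weyl_relations_def by blast
  then show ?thesis
  proof cases
    case 1
    then show ?thesis using involution by simp
  next
    case (A1 i j)
    moreover have "a i j = 0 \<longleftrightarrow> a j i = 0" using gcm unfolding gcm_def by blast
    ultimately have "a i j = 0" "a j i = 0" by simp_all
    then show ?thesis using A1 braid_commuting[of i j] by simp
  next
    case (A2 i j)
    then have "a i j = - 1" "a j i = - 1"
      using int_mult_nonpos_prime_cases[of "a i j" "a j i" 1] cartan_nonpos[of i j] by auto
    then show ?thesis using A2 braid_A2[of i j] by simp
  next
    case (B2 i j)
    then have "a i j = - 1 \<and> a j i = - 2 \<or> a i j = - 2 \<and> a j i = - 1"
      using int_mult_nonpos_prime_cases[of "a i j" "a j i" 2] cartan_nonpos[of i j] by auto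
    then show ?thesis using B2 braid_B2[of i j] braid_B2[of j i] by auto
  next
    case (G2 i j)
    then have "a i j = - 1 \<and> a j i = - 3 \<or> a i j = - 3 \<and> a j i = - 1"
      using int_mult_nonpos_prime_cases[of "a i j" "a j i" 3] cartan_nonpos[of i j] by auto
    then show ?thesis using G2 braid_G2[of i j] braid_G2[of j i] by auto
  qed
qed

lemma pres_cong_word_op:
  "pres_cong (weyl_relations a) u v \<Longrightarrow> word_op (map fst u) = word_op (map fst v)"
proof (induction rule: pres_cong.induct)
  case (1 u v)
  then show ?case by (rule weyl_relation_word_op)
next
  case (2 g e)
  then show ?case using involution[of g] by simp
qed (simp_all add: word_op_append)

lemma S_op_involution: "S i \<circ> S i = id"
  using involution[of i] by simp

lemma S_op_automorphism: "algebra_automorphism Q (S i)"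
  by (rule implements_automorphism[OF S_op_implements S_op_involution S_op_involution])

lemma word_op_automorphism: "algebra_automorphism Q (word_op w)"
proof (induction w)
  case Nil
  then show ?case by (simp add: algebra_automorphism_def bij_id[unfolded id_def])
next
  case (Cons i w)
  then show ?case
    using S_op_automorphism[of i] bij_comp[of "word_op w" "S i"] by (auto simp: algebra_automorphism_def comp_def)
qed

definition weyl_action :: "'i signed_word set \<Rightarrow> 'k \<Rightarrow> 'k" where
  "weyl_action c = word_op (map fst (SOME u. c = pres_class (weyl_relations a) u))"

lemma weyl_action_class: "weyl_action (pres_class (weyl_relations a) u) = word_op (map fst u)"
proof -
  have "pres_class (weyl_relations a) u
      = pres_class (weyl_relations a) (SOME v. pres_class (weyl_relations a) u = pres_class (weyl_relations a) v)"
    by (rule someI[of "\<lambda>v. pres_class (weyl_relations a) u = pres_class (weyl_relations a) v" u]) simp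
  then have "pres_cong (weyl_relations a) u
      (SOME v. pres_class (weyl_relations a) u = pres_class (weyl_relations a) v)"
    by (simp only: pres_class_eq_iff)
  from pres_cong_word_op[OF this] show ?thesis by (simp add: weyl_action_def)
qed

lemma weyl_group_carrier: "carrier (weyl_group a) = range (pres_class (weyl_relations a))"
  by (simp add: weyl_group_def presented_group_def)

lemma group_action_weyl_action: "group_action (weyl_group a) UNIV weyl_action"
  unfolding group_action_def
proof (intro group_hom.intro group_hom_axioms.intro homI)
  show "group (weyl_group a)" unfolding weyl_group_def by (rule group_presented_group)
  show "group (BijGroup UNIV)" by (rule group_BijGroup)
  have bij: "weyl_action c \<in> Bij UNIV" if "c \<in> carrier (weyl_group a)" for c
    using that word_op_automorphism
    by (auto simp: weyl_group_carrier weyl_action_class Bij_def algebra_automorphism_def bij_betw_def)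
  then show "weyl_action c \<in> carrier (BijGroup UNIV)" if "c \<in> carrier (weyl_group a)" for c
    using that by (simp add: BijGroup_def)
  fix c d assume cd: "c \<in> carrier (weyl_group a)" "d \<in> carrier (weyl_group a)"
  then obtain u v where "c = pres_class (weyl_relations a) u" "d = pres_class (weyl_relations a) v"
    by (auto simp: weyl_group_carrier)
  then have "weyl_action (c \<otimes>\<^bsub>weyl_group a\<^esub> d) = weyl_action c \<circ> weyl_action d"
    by (simp add: weyl_group_def presented_group_mult weyl_action_class word_op_append)
  then show "weyl_action (c \<otimes>\<^bsub>weyl_group a\<^esub> d) = weyl_action c \<otimes>\<^bsub>BijGroup UNIV\<^esub> weyl_action d"
    using bij cd by (simp add: BijGroup_def compose_def comp_def restrict_def)
qed

end

theorem theorem4p3: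
  fixes R :: "('i::finite, 'x::ab_group_add, 'y::ab_group_add) root_data"
    and Q :: "('i, 'b::ring_1, 'y, 'k::division_ring) alg_data"
  assumes "gcm (cartan R)"
    and "symmetrized_by (cartan R) (symz R)"
    and "root_datum R"
    and "alg_datum R Q"
    and "\<And>i. fgen0 R Q i \<noteq> 0"
  shows "(\<forall>i. algebra_automorphism Q (S_op R Q i) \<and>
              S_op R Q i = gamma R Q i (coroot R i) \<circ> s_tilde R Q i) \<and>
         (\<exists>\<phi>. group_action (weyl_group (cartan R)) UNIV \<phi> \<and>
            (\<forall>w \<in> carrier (weyl_group (cartan R)). algebra_automorphism Q (\<phi> w)) \<and>
            (\<forall>i x. \<phi> (weyl_gen (cartan R) i) x = S_op R Q i x) \<and>
            (\<forall>i j. \<phi> (weyl_gen (cartan R) i) (fgen R Q j) =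
               (if i = j then fgen R Q i
                else \<Sum>k = 0..nat (- cartan R i j).
                  of_U0 Q (qi_shift R i (int k + cartan R i j) (coroot R i) (int k)
                           * qbinom0 R i (coroot R i) k)
                  * ad_pow R Q i k j * inverse (fgen R Q i) ^ k)) \<and>
            (\<forall>i v. \<phi> (weyl_gen (cartan R) i) (qexp Q v) = qexp Q (reflection R i v)))"
proof -
  interpret weyl_setting R Q by unfold_locales fact+
  have gen: "weyl_action (weyl_gen (cartan R) i) = S_op R Q i" for i
    by (simp add: weyl_gen_def weyl_action_class)
  show ?thesis
  proof (intro conjI allI ballI exI[of _ weyl_action])
    show "algebra_automorphism Q (weyl_action w)" if "w \<in> carrier (weyl_group (cartan R))" for w
      using that word_op_automorphism by (auto simp: weyl_group_carrier weyl_action_class)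
  qed (simp_all only: gen S_op_automorphism S_op_eq[symmetric] S_op_qexp group_action_weyl_action
      S_op_fgen conjugate_image_def)
qed

end
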